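(* Let $n\geq 4$. An interval $[I,J]$ (with $I<J$) in the higher Bruhat order $B(n,n-3)$ is spherical if and only if it is facial. Moreover, every interval $[I,J]$ (with $I<J$) in $B(n,n-3)$ that is not facial is contractible.
   Context: Higher Bruhat orders. For $K=\{k_1<\cdots<k_{d+2}\}\subseteq[n]=\{1,\dots,n\}$ the packet of $K$ is the ordered list $P(K)=(K\setminus\{k_{d+2}\},K\setminus\{k_{d+1}\},\ldots,K\setminus\{k_1\})$. A set $I\subseteq\binom{[n]}{d+1}$ is consistent if for every $K\in\binom{[n]}{d+2}$ the intersection $I\cap P(K)$ is a beginning or ending segment of $P(K)$ (possibly empty or all of it). The elements of $B(n,d)$ are the consistent subsets of $\binom{[n]}{d+1}$; the order is the reflexive-transitive closure of the relations $I\lessdot I\cup\{A\}$ with $A\notin I$ and both sets consistent. Here $d=n-3$. Graph notation. Writing $ij$ for the $(n-2)$-subset $[n]\setminus\{i,j\}$, a consistent set becomes a graph (edge set) $G\subseteq\binom{[n]}{2}$ that is coconsistent: for every $i\in[n]$ the set of neighbors of $i$ in $G$ is a beginning or ending segment (possibly empty or everything) of $1<\cdots<i-1<i+1<\cdots<n$. Extensions. Choose reals $t_1<\cdots<t_n$ and let $X_c^{n,2}$ be the arrangement of the lines $H_i=\{(x_1,x_2)\in\mathbb R^2: x_1+t_ix_2+t_i^2=0\}$; the vertex $H_i\cap H_j$ is labeled $ij$, and along $H_i$ the vertices $ij$ occur in the order (up to reversal) of $j$. Consider single-element extensions of this arrangement by an oriented pseudoline (a repeated copy of an old line, or a loop,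 is also allowed as the new element). Such an extension is recorded by the labeling $\sigma$ of the vertices $ij$ by $-,0,+$ according to whether the vertex is on the negative side of, on, or on the positive side of the new element (all labels are $0$ for a loop). By Las Vergnas' localization theorem, a labeling $\sigma:\binom{[n]}{2}\to\{-,0,+\}$ comes from an extension if and only if for every $i$ the sequence $(\sigma(ij))_{j\ne i}$, with $j$ increasing, has the form $-\cdots-+\cdots+$ or $-\cdots-0+\cdots+$ or the reverse of one of these (blocks of equal signs may be empty), or consists entirely of zeros. The extension is uniform if $\sigma$ takes no value $0$, and non-uniform otherwise. Uniform extensions correspond to elements of $B(n,n-3)$ via $G=\{ij:\sigma(ij)=-\}$. A uniform extension $\sigma'$ refines $\sigma$ if $\sigma'(ij)=\sigma(ij)$ whenever $\sigma(ij)\neq0$. Facial, spherical, contractible. An interval $[I,J]$ is facial if it is the set of all uniform extensions refining some fixed non-uniform extension. Let $\Delta(I,J)$ be the simplicial complex whose simplices are the chains in the open interval $(I,J)$. The interval $[I,J]$ is spherical if $\Delta(I,J)$ is homotopy equivalent to a sphere $S^k$ for some $k\ge-1$, where the empty complex is regarded as $S^{-1}$; it is contractible if $\Delta(I,J)$ is contractible. *)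

theory Defs
  imports "HOL-Analysis.Analysis" "HOL-Library.Ramsey"
begin

section \<open>Higher Bruhat orders\<close>

definition packet :: "nat set \<Rightarrow> nat set list" where
  "packet K = map (\<lambda>k. K - {k}) (rev (sorted_list_of_set K))"

definition consistent :: "nat \<Rightarrow> nat \<Rightarrow> nat set set \<Rightarrow> bool" where
  "consistent n d I \<longleftrightarrow>
     I \<subseteq> nsets {1..n} (d + 1) \<and>
     (\<forall>K \<in> nsets {1..n} (d + 2). \<exists>m.
        I \<inter> set (packet K) = set (take m (packet K)) \<or>
        I \<inter> set (packet K) = set (drop m (packet K)))"

definition higher_bruhat :: "nat \<Rightarrow> nat \<Rightarrow> nat set set set" where
  "higher_bruhat n d = {I. consistent n d I}"

definition bruhat_step :: "nat \<Rightarrow> nat \<Rightarrow> nat set set \<Rightarrow> nat set set \<Rightarrow> bool" where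
  "bruhat_step n d I J \<longleftrightarrow>
     I \<in> higher_bruhat n d \<and> J \<in> higher_bruhat n d \<and> (\<exists>A. A \<notin> I \<and> J = insert A I)"

definition bruhat_le :: "nat \<Rightarrow> nat \<Rightarrow> nat set set \<Rightarrow> nat set set \<Rightarrow> bool" where
  "bruhat_le n d = (bruhat_step n d)\<^sup>*\<^sup>*"

definition bruhat_less :: "nat \<Rightarrow> nat \<Rightarrow> nat set set \<Rightarrow> nat set set \<Rightarrow> bool" where
  "bruhat_less n d I J \<longleftrightarrow> bruhat_le n d I J \<and> I \<noteq> J"

definition closed_interval :: "nat \<Rightarrow> nat \<Rightarrow> nat set set \<Rightarrow> nat set set \<Rightarrow> nat set set set" where
  "closed_interval n d I J =
     {X \<in> higher_bruhat n d. bruhat_le n d I X \<and> bruhat_le n d X J}"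

definition open_interval :: "nat \<Rightarrow> nat \<Rightarrow> nat set set \<Rightarrow> nat set set \<Rightarrow> nat set set set" where
  "open_interval n d I J =
     {X \<in> higher_bruhat n d. bruhat_less n d I X \<and> bruhat_less n d X J}"


section \<open>Order complexes and their homotopy types\<close>

text \<open>Simplices are the nonempty finite chains.\<close>

definition order_complex :: "('a \<Rightarrow> 'a \<Rightarrow> bool) \<Rightarrow> 'a set \<Rightarrow> 'a set set" where
  "order_complex le P =
     {C. C \<subseteq> P \<and> finite C \<and> C \<noteq> {} \<and> (\<forall>x\<in>C. \<forall>y\<in>C. le x y \<or> le y x)}"

text \<open>Barycentric coordinates, with the topology of pointwise convergence. This is the usual
  topology on the geometric realization of a complex with finitely many vertices, the only
  case used here; for infinite complexes it can be coarser than the weak topology.\<close>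

definition geometric_realization :: "'a set set \<Rightarrow> ('a \<Rightarrow> real) topology" where
  "geometric_realization \<Delta> = subtopology (powertop_real UNIV)
     {x. (\<forall>v. 0 \<le> x v) \<and> {v. x v \<noteq> 0} \<in> \<Delta> \<and> (\<Sum>v\<in>{v. x v \<noteq> 0}. x v) = 1}"

definition interval_space ::
    "nat \<Rightarrow> nat \<Rightarrow> nat set set \<Rightarrow> nat set set \<Rightarrow> (nat set set \<Rightarrow> real) topology" where
  "interval_space n d I J =
     geometric_realization (order_complex (bruhat_le n d) (open_interval n d I J))"

text \<open>The first disjunct is the empty complex, regarded as the sphere of dimension \<open>-1\<close>.\<close>

definition spherical_interval :: "nat \<Rightarrow> nat \<Rightarrow> nat set set \<Rightarrow> nat set set \<Rightarrow> bool" where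
  "spherical_interval n d I J \<longleftrightarrow>
     topspace (interval_space n d I J) = {} \<or>
     (\<exists>k. interval_space n d I J homotopy_equivalent_space nsphere k)"

text \<open>The predicate \<^const>\<open>contractible_space\<close> holds for the empty space, which is not
  contractible in the intended sense.\<close>

definition contractible_interval :: "nat \<Rightarrow> nat \<Rightarrow> nat set set \<Rightarrow> nat set set \<Rightarrow> bool" where
  "contractible_interval n d I J \<longleftrightarrow>
     topspace (interval_space n d I J) \<noteq> {} \<and> contractible_space (interval_space n d I J)"


section \<open>Single-element extensions of the cyclic line arrangement\<close>

text \<open>Chirotopes of rank 3 oriented matroids on \<open>E\<close>: alternating sign maps whose nonzero triples
  are the bases of a matroid (nonempty, basis exchange) and which satisfy the three-term
  Grassmann-Pluecker relations. Since the map is alternating, it is enough to exchange the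
  first entry, and a \<open>w\<close> with \<open>chi w b c \<noteq> 0\<close> is different from \<open>b\<close> and \<open>c\<close>.\<close>

definition chirotope3 :: "'a set \<Rightarrow> ('a \<Rightarrow> 'a \<Rightarrow> 'a \<Rightarrow> int) \<Rightarrow> bool" where
  "chirotope3 E chi \<longleftrightarrow>
     (\<forall>a\<in>E. \<forall>b\<in>E. \<forall>c\<in>E.
        chi a b c \<in> {-1, 0, 1} \<and> chi b a c = - chi a b c \<and> chi a c b = - chi a b c) \<and>
     (\<exists>a\<in>E. \<exists>b\<in>E. \<exists>c\<in>E. chi a b c \<noteq> 0) \<and>
     (\<forall>a\<in>E. \<forall>b\<in>E. \<forall>c\<in>E. \<forall>x\<in>E. \<forall>y\<in>E. \<forall>z\<in>E.
        chi a b c \<noteq> 0 \<and> chi x y z \<noteq> 0 \<longrightarrow> (\<exists>w\<in>{x, y, z}. chi w b c \<noteq> 0)) \<and>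
     (\<forall>a\<in>E. \<forall>b\<in>E. \<forall>c\<in>E. \<forall>d\<in>E. \<forall>e\<in>E.
        (let T = {chi a b c * chi a d e, - (chi a b d * chi a c e), chi a b e * chi a c d}
        in T = {0} \<or> {-1, 1} \<subseteq> T))"

text \<open>The chirotope of the arrangement of the oriented lines
  \<open>H\<^sub>i = {(x\<^sub>1, x\<^sub>2). x\<^sub>1 + t\<^sub>i x\<^sub>2 + t\<^sub>i\<^sup>2 = 0}\<close>: signs of determinants of their coefficient vectors.\<close>

definition line_vec :: "real \<Rightarrow> real^3" where
  "line_vec s = vector [1, s, s ^ 2]"

definition arrangement_chirotope :: "(nat \<Rightarrow> real) \<Rightarrow> nat \<Rightarrow> nat \<Rightarrow> nat \<Rightarrow> real" where
  "arrangement_chirotope t i j k =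
     sgn (det (vector [line_vec (t i), line_vec (t j), line_vec (t k)] :: real^3^3))"

text \<open>An extension by an oriented pseudoline is an oriented matroid of the same rank on
  \<open>{1..n}\<close> together with a new element, here \<open>Suc n\<close>, that restricts to the one of the
  arrangement. Loops and elements parallel to an old one are not excluded.

  For \<open>i < j\<close> the vertex \<open>ij\<close> is on the side \<open>chi i j (Suc n)\<close> of the new element: if the new
  element is the line \<open>f = 0\<close> with \<open>f (x\<^sub>1, x\<^sub>2) = a x\<^sub>1 + b x\<^sub>2 + c\<close>, then, since
  \<open>H\<^sub>i \<inter> H\<^sub>j = {(t\<^sub>i t\<^sub>j, - t\<^sub>i - t\<^sub>j)}\<close>, the determinant with rows \<open>line_vec t\<^sub>i\<close>, \<open>line_vec t\<^sub>j\<close>,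
  \<open>(a, b, c)\<close> is \<open>(t\<^sub>j - t\<^sub>i) f (t\<^sub>i t\<^sub>j, - t\<^sub>i - t\<^sub>j)\<close>. Only the values of a labeling on the
  two-element subsets of \<open>{1..n}\<close> are relevant.\<close>

definition extension_labeling :: "nat \<Rightarrow> (nat \<Rightarrow> real) \<Rightarrow> (nat set \<Rightarrow> int) \<Rightarrow> bool" where
  "extension_labeling n t \<sigma> \<longleftrightarrow>
     (\<exists>chi. chirotope3 {1..Suc n} chi \<and>
        (\<forall>i\<in>{1..n}. \<forall>j\<in>{1..n}. \<forall>k\<in>{1..n}.
           of_int (chi i j k) = arrangement_chirotope t i j k) \<and>
        (\<forall>i\<in>{1..n}. \<forall>j\<in>{1..n}. i < j \<longrightarrow> \<sigma> {i, j} = chi i j (Suc n)))"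

definition uniform_labeling :: "nat \<Rightarrow> (nat set \<Rightarrow> int) \<Rightarrow> bool" where
  "uniform_labeling n \<sigma> \<longleftrightarrow> (\<forall>e \<in> nsets {1..n} 2. \<sigma> e \<noteq> 0)"

definition refines :: "nat \<Rightarrow> (nat set \<Rightarrow> int) \<Rightarrow> (nat set \<Rightarrow> int) \<Rightarrow> bool" where
  "refines n \<sigma>' \<sigma> \<longleftrightarrow> (\<forall>e \<in> nsets {1..n} 2. \<sigma> e \<noteq> 0 \<longrightarrow> \<sigma>' e = \<sigma> e)"

text \<open>The pair \<open>ij\<close> stands for the \<open>(n - 2)\<close>-subset \<open>{1..n} - {i, j}\<close>.\<close>

definition consistent_of_labeling :: "nat \<Rightarrow> (nat set \<Rightarrow> int) \<Rightarrow> nat set set" where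
  "consistent_of_labeling n \<sigma> = {{1..n} - e | e. e \<in> nsets {1..n} 2 \<and> \<sigma> e = -1}"

definition facial_interval :: "nat \<Rightarrow> (nat \<Rightarrow> real) \<Rightarrow> nat set set \<Rightarrow> nat set set \<Rightarrow> bool" where
  "facial_interval n t I J \<longleftrightarrow>
     (\<exists>\<sigma>. extension_labeling n t \<sigma> \<and> \<not> uniform_labeling n \<sigma> \<and>
        closed_interval n (n - 3) I J =
          {consistent_of_labeling n \<sigma>' | \<sigma>'.
             extension_labeling n t \<sigma>' \<and> uniform_labeling n \<sigma>' \<and> refines n \<sigma>' \<sigma>})"

end

theory Submission
  imports Defs "HOL-Homology.Brouwer_Degree"
begin

text \<open>Identify an \<open>(n - 2)\<close>-subset with its complementary pair. A consistent set becomes a graph on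
  \<open>{1..n}\<close> in which every neighborhood is a beginning or an ending segment, and this can be said
  with triples: in the row of a vertex, of three entries \<open>c < d < e\<close> the middle one never differs
  from both others. Three facts carry the theorem.

  The order is inclusion: if \<open>E\<close> is properly contained in \<open>F\<close>, some edge of \<open>F\<close> can be added to \<open>E\<close>
  so that the graph stays coconsistent (\<open>coconsistent_growable\<close>). So every element of an open
  interval contains an atom of the interval.

  Facial means localized: let \<open>\<sigma>\<close> be \<open>-\<close> on \<open>E\<close>, \<open>0\<close> on \<open>F - E\<close> and \<open>+\<close> elsewhere. The interval is
  facial if and only if \<open>\<sigma>\<close> satisfies the three-term sign condition on all triples in all rows
  (\<open>facial_interval_iff\<close>). Here the localization theorem is proved for the cyclic arrangement: the
  Grassmann-Pluecker relations through an old line are the row conditions, and those through the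
  new line involve four old lines and follow from the row conditions by inspection of all sign
  patterns (\<open>four_lines\<close>). In a localized labeling a row has at most one zero or is zero. Hence
  the zeros form a matching, or they are all pairs through one vertex, or all pairs. The interval
  is then a Boolean lattice, or a union of two chains with common ends, or everything. In each case,
  the map from \<open>X\<close> to the set of atoms below \<open>X\<close> has an order-preserving section, the join, and the join
  of the atoms below \<open>X\<close> lies below \<open>X\<close>. So the open interval is homotopy equivalent to the proper part
  of a Boolean lattice, which is a sphere (\<open>localized_sphere\<close>).

  In all other cases the identity of the open interval is comparable with a map that is comparable
  with a constant, so that the interval is contractible (\<open>not_localized_contractible\<close>). If the
  atoms are pairwise disjoint edges, any set of them can be added to \<open>E\<close>, and \<open>X\<close> contracts via
  \<open>E \<union> {atoms below X}\<close> to the join of all atoms, which is not \<open>F\<close>. Otherwise two atoms meet in a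
  vertex \<open>i\<close>. Then the row of \<open>i\<close> is empty, the atoms lead to the first and to the last vertex, and \<open>E\<close>
  is contained in a graph \<open>K\<close> that depends only on \<open>i\<close> and one bit: the cliques on both sides of \<open>i\<close>, or
  the complete bipartite graph between them (\<open>pencil_cases\<close>). Geometrically, \<open>K\<close> belongs to a copy of
  the line \<open>i\<close> in one of its two orientations. Every element above both atoms contains \<open>K\<close>, and the
  union of \<open>K\<close> with any coconsistent graph above \<open>E\<close> is coconsistent. So \<open>X \<le> X \<union> K \<ge> K\<close> contracts the open
  interval if \<open>K \<noteq> E\<close>. If \<open>K = E\<close>, the two atoms are the only ones, unless \<open>E\<close> is empty and \<open>F\<close> is
  complete, and their join is \<open>E\<close> with all edges at \<open>i\<close>; this is not \<open>F\<close>, since the interval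
  would be facial.

  Homotopies between order complexes come from one explicit formula (\<open>push_homotopic\<close>).\<close>

section \<open>Order complexes of finite posets\<close>

definition poset_space :: "('a::order) set \<Rightarrow> ('a \<Rightarrow> real) topology" where
  "poset_space P = geometric_realization (order_complex (\<le>) P)"

lemma in_poset_space:
  fixes P :: "'a::order set"
  assumes "finite P"
  shows "x \<in> topspace (poset_space P) \<longleftrightarrow>
    (\<forall>v. 0 \<le> x v) \<and> (\<forall>v. v \<notin> P \<longrightarrow> x v = 0) \<and> sum x P = 1 \<and>
    (\<forall>u v. x u \<noteq> 0 \<longrightarrow> x v \<noteq> 0 \<longrightarrow> u \<le> v \<or> v \<le> u)" (is "?L \<longleftrightarrow> ?R")
proof -
  have top: "?L \<longleftrightarrow> (\<forall>v. 0 \<le> x v) \<and> {v. x v \<noteq> 0} \<in> order_complex (\<le>) P \<and>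
      (\<Sum>v\<in>{v. x v \<noteq> 0}. x v) = 1"
    by (simp add: poset_space_def geometric_realization_def)
  have sum: "sum x P = (\<Sum>v\<in>{v. x v \<noteq> 0}. x v)" if "{v. x v \<noteq> 0} \<subseteq> P"
    using that assms by (intro sum.mono_neutral_right) auto
  show ?thesis
  proof
    assume ?L
    then have "{v. x v \<noteq> 0} \<subseteq> P"
      using top by (auto simp: order_complex_def)
    then show ?R
      using \<open>?L\<close> sum top by (auto simp: order_complex_def)
  next
    assume R: ?R
    then have sub: "{v. x v \<noteq> 0} \<subseteq> P"
      by auto
    have "{v. x v \<noteq> 0} \<noteq> {}"
    proof
      assume "{v. x v \<noteq> 0} = {}"
      then have "sum x P = 0"
        by (intro sum.neutral) auto
      then show False
        using R by simp
    qed
    then show ?L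
      using R sub sum assms finite_subset[OF sub] by (auto simp: top order_complex_def)
  qed
qed

lemma continuous_map_coordinate:
  "continuous_map (poset_space P) euclideanreal (\<lambda>x. x v)"
  unfolding poset_space_def geometric_realization_def
  by (intro continuous_map_from_subtopology continuous_map_product_projection) simp

lemma continuous_map_into_poset_space:
  assumes "\<And>v. continuous_map X euclideanreal (\<lambda>a. f a v)"
    and "\<And>a. a \<in> topspace X \<Longrightarrow> f a \<in> topspace (poset_space P)"
  shows "continuous_map X (poset_space P) f"
proof -
  have "continuous_map X (powertop_real UNIV) f"
    using assms(1) by (simp add: continuous_map_componentwise_UNIV)
  then show ?thesis
    using assms(2)
    by (auto simp: poset_space_def geometric_realization_def continuous_map_in_subtopology)
qed

definition push :: "'a set \<Rightarrow> ('a \<Rightarrow> 'b) \<Rightarrow> ('a \<Rightarrow> real) \<Rightarrow> 'b \<Rightarrow> real" where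
  "push P f x = (\<lambda>q. \<Sum>p\<in>{p \<in> P. f p = q}. x p)"

lemma push_nonzero:
  assumes "push P f x q \<noteq> 0"
  obtains p where "p \<in> P" "f p = q" "x p \<noteq> 0"
  using assms unfolding push_def
  by (metis (mono_tags, lifting) mem_Collect_eq sum.not_neutral_contains_not_neutral)

lemma sum_push:
  assumes "finite P" "finite Q" "f ` P \<subseteq> Q"
  shows "sum (push P f x) Q = sum x P"
  unfolding push_def using assms by (intro sum.group) auto

lemma push_comp:
  assumes "finite P" "finite Q" "f ` P \<subseteq> Q"
  shows "push Q g (push P f x) = push P (g \<circ> f) x"
proof
  fix r
  have "push Q g (push P f x) r = (\<Sum>q\<in>{q \<in> Q. g q = r}. \<Sum>p\<in>{p \<in> {p \<in> P. g (f p) = r}. f p = q}. x p)"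
    unfolding push_def by (intro sum.cong refl) auto
  also have "\<dots> = (\<Sum>p\<in>{p \<in> P. g (f p) = r}. x p)"
    using assms by (intro sum.group) auto
  finally show "push Q g (push P f x) r = push P (g \<circ> f) x r"
    by (simp add: push_def)
qed

lemma push_ident:
  assumes "finite P" "\<And>p. p \<in> P \<Longrightarrow> f p = p" "x \<in> topspace (poset_space P)"
  shows "push P f x = x"
proof
  fix q
  have "{p \<in> P. f p = q} = (if q \<in> P then {q} else {})"
    using assms(2) by auto
  then show "push P f x q = x q"
    using in_poset_space[OF assms(1), of x] assms(3) by (auto simp: push_def)
qed

lemma push_const:
  assumes "finite P" "\<And>p. p \<in> P \<Longrightarrow> f p = v" "x \<in> topspace (poset_space P)"
  shows "push P f x = (\<lambda>q. if q = v then 1 else 0)"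
proof
  fix q
  have "{p \<in> P. f p = q} = (if q = v then P else {})"
    using assms(2) by auto
  then show "push P f x q = (if q = v then 1 else 0)"
    using in_poset_space[OF assms(1), of x] assms(3) by (auto simp: push_def)
qed

lemma push_in_poset_space:
  fixes f :: "'a::order \<Rightarrow> 'b::order"
  assumes "finite P" "finite Q" "f ` P \<subseteq> Q" "mono_on P f" "x \<in> topspace (poset_space P)"
  shows "push P f x \<in> topspace (poset_space Q)"
proof -
  note x = assms(5)[unfolded in_poset_space[OF assms(1)]]
  have "push P f x v = 0" if "v \<notin> Q" for v
    using push_nonzero[of P f x v] that assms(3) by blast
  moreover have "u \<le> v \<or> v \<le> u" if u: "push P f x u \<noteq> 0" and v: "push P f x v \<noteq> 0" for u v
  proof -
    obtain p p' where "p \<in> P" "f p = u" "x p \<noteq> 0" "p' \<in> P" "f p' = v" "x p' \<noteq> 0"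
      using push_nonzero[OF u] push_nonzero[OF v] by metis
    then show ?thesis
      using x \<open>mono_on P f\<close> unfolding mono_on_def by metis
  qed
  moreover have "0 \<le> push P f x v" for v
    unfolding push_def using x by (intro sum_nonneg) auto
  ultimately show ?thesis
    unfolding in_poset_space[OF assms(2)] using sum_push[OF assms(1-3)] x by simp
qed

lemma continuous_map_push:
  fixes f :: "'a::order \<Rightarrow> 'b::order"
  assumes "finite P" "finite Q" "f ` P \<subseteq> Q" "mono_on P f"
  shows "continuous_map (poset_space P) (poset_space Q) (push P f)"
proof (rule continuous_map_into_poset_space)
  show "continuous_map (poset_space P) euclideanreal (\<lambda>a. push P f a v)" for v
    unfolding push_def using assms(1)
    by (intro continuous_map_sum continuous_map_coordinate) auto
qed (use push_in_poset_space assms in blast)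

text \<open>The part of the mass at \<open>p\<close> that lies in the lowest \<open>s\<close> units of the total mass of \<open>x\<close>, if the chain
  carrying \<open>x\<close> is laid out from bottom to top.\<close>

definition lower_mass :: "'a::order set \<Rightarrow> real \<Rightarrow> ('a \<Rightarrow> real) \<Rightarrow> 'a \<Rightarrow> real" where
  "lower_mass P s x p = min (x p) (max 0 (s - (\<Sum>r\<in>{r \<in> P. r < p}. x r)))"

text \<open>A point of the realization is a probability measure on a chain. Lay the chain out from bottom to
  top as an interval of length \<open>1\<close>. At time \<open>s\<close>, the lower part of length \<open>1 - s\<close> is moved by \<open>f\<close> and
  the upper part by \<open>g\<close>. Since \<open>f \<le> g\<close>, the image is again carried by a chain. The straight line
  between the two push-forwards would not do: \<open>f p\<close> and \<open>g q\<close> with \<open>q < p\<close> may be incomparable.\<close>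

lemma push_homotopic:
  fixes f g :: "'a::order \<Rightarrow> 'b::order"
  assumes fin: "finite P" "finite Q"
    and f: "f ` P \<subseteq> Q" "mono_on P f"
    and g: "g ` P \<subseteq> Q" "mono_on P g"
    and le: "\<And>p. p \<in> P \<Longrightarrow> f p \<le> g p"
  shows "homotopic_with (\<lambda>_. True) (poset_space P) (poset_space Q) (push P f) (push P g)"
proof -
  define lo where "lo = (\<lambda>s x. lower_mass P (1 - s) x)"
  define hi where "hi = (\<lambda>s x p. x p - lower_mass P (1 - s) x p)"
  define H where "H = (\<lambda>(s, x) q. push P f (lo s x) q + push P g (hi s x) q)"
  let ?I = "top_of_set {0..1::real}"
  let ?PX = "prod_topology ?I (poset_space P)"
  have s: "continuous_map ?PX euclideanreal (\<lambda>z. fst z)"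
    using continuous_map_fst continuous_map_into_fulltopology by blast
  have x: "continuous_map ?PX euclideanreal (\<lambda>z. snd z v)" for v
    using continuous_map_compose[OF continuous_map_snd continuous_map_coordinate]
    by (simp add: o_def)
  have lo_cont: "continuous_map ?PX euclideanreal (\<lambda>z. lower_mass P (1 - fst z) (snd z) p)" for p
    unfolding lower_mass_def using fin
    by (intro continuous_map_real_min continuous_map_real_max continuous_map_diff
        continuous_map_sum s x) auto
  have lo_nonneg: "0 \<le> lo s x p" "0 \<le> hi s x p" if "x \<in> topspace (poset_space P)" for s x p
    using that by (auto simp: lo_def hi_def lower_mass_def in_poset_space[OF fin(1)])
  have in_Q: "H (s, x) \<in> topspace (poset_space Q)" if x: "x \<in> topspace (poset_space P)" for s x
  proof -
    note x' = x[unfolded in_poset_space[OF fin(1)]]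
    have nn: "0 \<le> push P f (lo s x) q" "0 \<le> push P g (hi s x) q" for q
      unfolding push_def using lo_nonneg[OF x] by (auto intro: sum_nonneg)
    have supp: "(\<exists>p\<in>P. f p = q \<and> lo s x p \<noteq> 0) \<or> (\<exists>p\<in>P. g p = q \<and> hi s x p \<noteq> 0)"
      if "H (s, x) q \<noteq> 0" for q
    proof -
      from that consider "push P f (lo s x) q \<noteq> 0" | "push P g (hi s x) q \<noteq> 0"
        unfolding H_def case_prod_conv by linarith
      then show ?thesis
        by cases (metis push_nonzero)+
    qed
    have loD: "x p \<noteq> 0" "(\<Sum>r\<in>{r \<in> P. r < p}. x r) < 1 - s" if "lo s x p \<noteq> 0" for p
      using that x'[THEN conjunct1, rule_format, of p] unfolding lo_def lower_mass_def by linarith+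
    have hiD: "x p \<noteq> 0" "x p + (\<Sum>r\<in>{r \<in> P. r < p}. x r) > 1 - s" if "hi s x p \<noteq> 0" for p
      using that x'[THEN conjunct1, rule_format, of p] unfolding hi_def lower_mass_def by linarith+
    \<comment> \<open>If \<open>q < p\<close>, then \<open>p\<close> cannot reach below the cut while \<open>q\<close> reaches above it.\<close>
    have lohi: "f p \<le> g q" if p: "p \<in> P" "lo s x p \<noteq> 0" and q: "q \<in> P" "hi s x q \<noteq> 0" for p q
    proof (cases "p \<le> q")
      case True
      then show ?thesis
        using f(2) le[OF q(1)] p q unfolding mono_on_def by (meson order_trans)
    next
      case False
      then have "q < p"
        using loD(1)[OF p(2)] hiD(1)[OF q(2)] x' by (metis order_less_le)
      then have "insert q {r \<in> P. r < q} \<subseteq> {r \<in> P. r < p}"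
        using q by auto
      then have "(\<Sum>r\<in>insert q {r \<in> P. r < q}. x r) \<le> (\<Sum>r\<in>{r \<in> P. r < p}. x r)"
        using fin x' by (intro sum_mono2) auto
      then show ?thesis
        using loD(2)[OF p(2)] hiD(2)[OF q(2)] fin by auto
    qed
    have "u \<le> v \<or> v \<le> u" if "H (s, x) u \<noteq> 0" "H (s, x) v \<noteq> 0" for u v
    proof -
      have mf: "f p \<le> f q \<or> f q \<le> f p" if "p \<in> P" "lo s x p \<noteq> 0" "q \<in> P" "lo s x q \<noteq> 0" for p q
        using that loD(1) x' f(2) unfolding mono_on_def by metis
      have mg: "g p \<le> g q \<or> g q \<le> g p" if "p \<in> P" "hi s x p \<noteq> 0" "q \<in> P" "hi s x q \<noteq> 0" for p q
        using that hiD(1) x' g(2) unfolding mono_on_def by metis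
      show ?thesis
        using supp[OF that(1)] supp[OF that(2)] lohi mf mg by metis
    qed
    moreover have "H (s, x) v = 0" if "v \<notin> Q" for v
      using supp[of v] that f(1) g(1) by blast
    moreover have "sum (H (s, x)) Q = 1"
    proof -
      have "sum (H (s, x)) Q = sum (push P f (lo s x)) Q + sum (push P g (hi s x)) Q"
        by (simp add: H_def sum.distrib)
      also have "\<dots> = sum (lo s x) P + sum (hi s x) P"
        using sum_push fin f g by metis
      also have "\<dots> = sum x P"
        by (simp add: lo_def hi_def flip: sum.distrib)
      finally show ?thesis
        using x' by simp
    qed
    moreover have "0 \<le> H (s, x) v" for v
      using nn[of v] by (simp add: H_def)
    ultimately show ?thesis
      unfolding in_poset_space[OF fin(2)] by blast
  qed
  have cont: "continuous_map ?PX (poset_space Q) H"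
  proof (rule continuous_map_into_poset_space)
    show "continuous_map ?PX euclideanreal (\<lambda>a. H a v)" for v
      unfolding H_def push_def lo_def hi_def case_prod_beta using fin
      by (intro continuous_map_add continuous_map_sum continuous_map_diff lo_cont x) auto
  qed (use in_Q in auto)
  have ends: "H (0, x) = push P f x" "H (1, x) = push P g x" if "x \<in> topspace (poset_space P)" for x
  proof -
    note x' = that[unfolded in_poset_space[OF fin(1)]]
    have "lo 0 x p = x p" "hi 0 x p = 0" if "p \<in> P" for p
    proof -
      have "(\<Sum>r\<in>insert p {r \<in> P. r < p}. x r) \<le> sum x P"
        using fin x' that by (intro sum_mono2) auto
      then show "lo 0 x p = x p" "hi 0 x p = 0"
        using fin x' by (auto simp: lo_def hi_def lower_mass_def)
    qed
    then show "H (0, x) = push P f x"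
      by (auto simp: H_def push_def)
    have "0 \<le> (\<Sum>r\<in>{r \<in> P. r < p}. x r)" for p
      using x' by (intro sum_nonneg) auto
    then have "lo 1 x p = 0" "hi 1 x p = x p" for p
      using x' by (auto simp: lo_def hi_def lower_mass_def)
    then show "H (1, x) = push P g x"
      by (auto simp: H_def push_def)
  qed
  show ?thesis
    by (subst homotopic_with) (use cont ends in \<open>auto intro!: exI[of _ H]\<close>)
qed

text \<open>Comparable order-preserving maps are homotopic, so a section below the identity is enough.\<close>

lemma poset_homotopy_equivalence:
  fixes f :: "'a::order \<Rightarrow> 'b::order" and g :: "'b \<Rightarrow> 'a"
  assumes fin: "finite P" "finite Q"
    and f: "f ` P \<subseteq> Q" "mono_on P f"
    and g: "g ` Q \<subseteq> P" "mono_on Q g"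
    and gf: "\<And>p. p \<in> P \<Longrightarrow> g (f p) \<le> p"
    and fg: "\<And>q. q \<in> Q \<Longrightarrow> f (g q) = q"
  shows "poset_space P homotopy_equivalent_space poset_space Q"
proof -
  have "mono_on P (g \<circ> f)"
    using f g unfolding mono_on_def by (simp add: image_subset_iff)
  then have "homotopic_with (\<lambda>_. True) (poset_space P) (poset_space P) (push P (g \<circ> f)) (push P id)"
    using fin f g gf
    by (intro push_homotopic) (auto simp: mono_on_def image_subset_iff)
  then have 1: "homotopic_with (\<lambda>_. True) (poset_space P) (poset_space P) (push Q g \<circ> push P f) id"
    by (rule homotopic_with_eq) (use fin f in \<open>auto simp: push_comp push_ident\<close>)
  have "homotopic_with (\<lambda>_. True) (poset_space Q) (poset_space Q) id id"
    by simp
  then have 2: "homotopic_with (\<lambda>_. True) (poset_space Q) (poset_space Q) (push P f \<circ> push Q g) id"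
    by (rule homotopic_with_eq) (use fin g fg in \<open>auto simp: push_comp push_ident\<close>)
  show ?thesis
    unfolding homotopy_equivalent_space_def
    using 1 2 continuous_map_push[OF fin f] continuous_map_push[OF fin(2,1) g] by blast
qed

lemma poset_space_nonempty:
  fixes v :: "'a::order"
  assumes "finite P" "v \<in> P"
  shows "topspace (poset_space P) \<noteq> {}"
proof -
  have "(\<lambda>q. if q = v then 1 else 0) \<in> topspace (poset_space P)"
    using assms by (subst in_poset_space) auto
  then show ?thesis
    by blast
qed

text \<open>The identity is comparable with \<open>f\<close>, and \<open>f\<close> is comparable with a constant map.\<close>

lemma contractible_poset_space:
  fixes f :: "'a::order \<Rightarrow> 'a"
  assumes fin: "finite P" and v: "v \<in> P"
    and f: "f ` P \<subseteq> P" "mono_on P f"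
    and fv: "(\<forall>p\<in>P. f p \<le> p \<and> f p \<le> v) \<or> (\<forall>p\<in>P. p \<le> f p \<and> v \<le> f p)"
  shows "contractible_space (poset_space P)"
proof -
  let ?X = "poset_space P"
  let ?h = "homotopic_with (\<lambda>_. True) ?X ?X"
  have "?h (push P f) (push P id) \<and> ?h (push P f) (push P (\<lambda>_. v))"
    using fv
  proof
    assume "\<forall>p\<in>P. f p \<le> p \<and> f p \<le> v"
    then show ?thesis
      using fin f v by (auto intro!: push_homotopic simp: mono_on_def)
  next
    assume "\<forall>p\<in>P. p \<le> f p \<and> v \<le> f p"
    then show ?thesis
      using fin f v
      by (auto intro!: homotopic_with_symD[OF push_homotopic] simp: mono_on_def)
  qed
  then have "?h (push P id) (push P (\<lambda>_. v))"
    using homotopic_with_symD homotopic_with_trans by blast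
  then have "?h id (\<lambda>_. \<lambda>q. if q = v then 1 else 0)"
    by (rule homotopic_with_eq) (use fin in \<open>auto simp: push_ident push_const\<close>)
  then show ?thesis
    unfolding contractible_space_def by blast
qed

section \<open>The proper part of a Boolean lattice\<close>

definition proper_subsets :: "'a set \<Rightarrow> 'a set set" where
  "proper_subsets S = {T. T \<noteq> {} \<and> T \<subset> S}"

lemma finite_proper_subsets: "finite S \<Longrightarrow> finite (proper_subsets S)"
  by (rule finite_subset[of _ "Pow S"]) (auto simp: proper_subsets_def)

text \<open>These sums are the coordinates of \<open>x\<close> in the cube, where a proper subset is placed at its indicator
  vector. The proper part of the Boolean lattice becomes the set of points with minimum \<open>0\<close> and maximum
  \<open>1\<close>, which is a sphere of directions modulo the diagonal.\<close>

definition cover_mass :: "nat set \<Rightarrow> (nat set \<Rightarrow> real) \<Rightarrow> nat \<Rightarrow> real" where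
  "cover_mass S x i = (\<Sum>T\<in>{T \<in> proper_subsets S. i \<in> T}. x T)"

text \<open>Every member of the chain that contains \<open>j\<close> is larger than \<open>T\<close> and so contains \<open>i\<close>; and \<open>T\<close> itself
  contributes only to \<open>i\<close>. So the chain carrying \<open>x\<close> consists of upper level sets of its coordinates.\<close>

lemma cover_mass_gap:
  assumes S: "finite S" and x: "x \<in> topspace (poset_space (proper_subsets S))"
    and T: "x T \<noteq> 0" "i \<in> T" "j \<notin> T"
  shows "cover_mass S x j < cover_mass S x i"
proof -
  note x' = x[unfolded in_poset_space[OF finite_proper_subsets[OF S]]]
  have "0 < x T"
    using x' T(1) by (metis order_less_le)
  have TP: "T \<in> proper_subsets S"
    using x' T(1) by blast
  have "cover_mass S x j = (\<Sum>U\<in>{U \<in> proper_subsets S. j \<in> U \<and> i \<in> U \<and> U \<noteq> T}. x U)"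
    unfolding cover_mass_def
  proof (rule sum.mono_neutral_right)
    show "\<forall>U\<in>{T \<in> proper_subsets S. j \<in> T} - {U \<in> proper_subsets S. j \<in> U \<and> i \<in> U \<and> U \<noteq> T}. x U = 0"
      using x' T by fastforce
  qed (use finite_proper_subsets[OF S] T in auto)
  also have "\<dots> \<le> (\<Sum>U\<in>{U \<in> proper_subsets S. i \<in> U \<and> U \<noteq> T}. x U)"
    using x' finite_proper_subsets[OF S] by (intro sum_mono2) auto
  also have "\<dots> < x T + \<dots>"
    using \<open>0 < x T\<close> by simp
  also have "\<dots> = (\<Sum>U\<in>insert T {U \<in> proper_subsets S. i \<in> U \<and> U \<noteq> T}. x U)"
    using finite_proper_subsets[OF S] by simp
  also have "insert T {U \<in> proper_subsets S. i \<in> U \<and> U \<noteq> T} = {U \<in> proper_subsets S. i \<in> U}"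
    using T TP by auto
  finally show ?thesis
    by (simp add: cover_mass_def)
qed

definition normalize_vec :: "nat \<Rightarrow> (nat \<Rightarrow> real) \<Rightarrow> nat \<Rightarrow> real" where
  "normalize_vec k z = (\<lambda>i. z i / sqrt (\<Sum>j\<le>k. (z j)\<^sup>2))"

lemma in_nsphere:
  "z \<in> topspace (nsphere k) \<longleftrightarrow> (\<Sum>j\<le>k. (z j)\<^sup>2) = 1 \<and> (\<forall>i>k. z i = 0)"
  by (auto simp: nsphere topspace_Euclidean_space Suc_le_eq)

lemma normalize_vec_pos:
  fixes z :: "nat \<Rightarrow> real"
  assumes "i \<le> k" "z i \<noteq> 0"
  shows "0 < (\<Sum>j\<le>k. (z j)\<^sup>2)"
  using assms by (intro sum_pos2[of "{..k}" i]) auto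

lemma normalize_vec_in_nsphere:
  assumes "0 < (\<Sum>j\<le>k. (z j)\<^sup>2)" "\<And>i. i > k \<Longrightarrow> z i = 0"
  shows "normalize_vec k z \<in> topspace (nsphere k)"
proof -
  have "(\<Sum>j\<le>k. (normalize_vec k z j)\<^sup>2) = (\<Sum>j\<le>k. (z j)\<^sup>2) / (\<Sum>j\<le>k. (z j)\<^sup>2)"
    using assms(1) by (simp add: normalize_vec_def power_divide flip: sum_divide_distrib)
  then show ?thesis
    using assms by (simp add: in_nsphere) (simp add: normalize_vec_def)
qed

lemma continuous_map_into_nsphere:
  assumes "\<And>v. continuous_map X euclideanreal (\<lambda>a. f a v)"
    and "\<And>a. a \<in> topspace X \<Longrightarrow> f a \<in> topspace (nsphere k)"
  shows "continuous_map X (nsphere k) f"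
proof -
  have "continuous_map X (powertop_real UNIV) f"
    using assms(1) by (simp add: continuous_map_componentwise_UNIV)
  then show ?thesis
    using assms(2)
    by (force simp: nsphere Euclidean_space_def continuous_map_in_subtopology)
qed

lemma continuous_map_normalize_vec:
  assumes cont: "\<And>v. continuous_map X euclideanreal (\<lambda>a. f a v)"
    and pos: "\<And>a. a \<in> topspace X \<Longrightarrow> 0 < (\<Sum>j\<le>k. (f a j)\<^sup>2)"
    and 0: "\<And>a i. a \<in> topspace X \<Longrightarrow> i > k \<Longrightarrow> f a i = 0"
  shows "continuous_map X (nsphere k) (\<lambda>a. normalize_vec k (f a))"
proof (rule continuous_map_into_nsphere)
  show "continuous_map X euclideanreal (\<lambda>a. normalize_vec k (f a) v)" for v
    unfolding normalize_vec_def
    by (intro continuous_map_real_divide continuous_map_sqrt continuous_map_sum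
        continuous_map_real_pow cont) (use pos in \<open>auto simp: less_le\<close>)
qed (use normalize_vec_in_nsphere pos 0 in blast)

text \<open>The coordinates of \<open>x\<close> modulo the diagonal: the last one is subtracted from all, which leaves
  \<open>k + 1\<close> of them.\<close>

definition sphere_of_chain :: "nat \<Rightarrow> (nat set \<Rightarrow> real) \<Rightarrow> nat \<Rightarrow> real" where
  "sphere_of_chain k x = normalize_vec k
     (\<lambda>i. if i \<le> k then cover_mass {..Suc k} x i - cover_mass {..Suc k} x (Suc k) else 0)"

text \<open>Positive exactly on the upper level sets of \<open>z\<close>, and continuous in \<open>z\<close>. Any such family of weights gives
  a homotopy inverse.\<close>

definition upset_weight :: "nat set \<Rightarrow> (nat \<Rightarrow> real) \<Rightarrow> nat set \<Rightarrow> real" where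
  "upset_weight S z T =
     (if T \<in> proper_subsets S then \<Prod>i\<in>T. \<Prod>j\<in>S - T. max 0 (z i - z j) else 0)"

definition chain_of_sphere :: "nat set \<Rightarrow> (nat \<Rightarrow> real) \<Rightarrow> nat set \<Rightarrow> real" where
  "chain_of_sphere S z T = upset_weight S z T / sum (upset_weight S z) (proper_subsets S)"

lemma upset_weight_nonneg: "0 \<le> upset_weight S z T"
  by (auto simp: upset_weight_def intro!: prod_nonneg)

lemma upset_weight_pos_iff:
  assumes "finite S"
  shows "upset_weight S z T \<noteq> 0 \<longleftrightarrow> T \<in> proper_subsets S \<and> (\<forall>i\<in>T. \<forall>j\<in>S - T. z j < z i)"
proof -
  have fin: "finite T" if "T \<in> proper_subsets S"
    using that assms by (auto simp: proper_subsets_def intro: finite_subset)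
  have "max 0 (z i - z j) \<noteq> 0 \<longleftrightarrow> z j < z i" for i j
    by auto
  then show ?thesis
    using fin assms by (auto simp: upset_weight_def)
qed

text \<open>Upper level sets of the same function are nested.\<close>

lemma upset_weight_chain:
  assumes S: "finite S" and "upset_weight S z T \<noteq> 0"
    and "T' \<subset> S" "\<And>i j. i \<in> T' \<Longrightarrow> j \<in> S - T' \<Longrightarrow> z j < z i"
  shows "T \<subseteq> T' \<or> T' \<subseteq> T"
proof (rule ccontr)
  assume "\<not> ?thesis"
  then obtain i j where "i \<in> T" "i \<notin> T'" "j \<in> T'" "j \<notin> T"
    by blast
  moreover have "T \<subseteq> S"
    using assms(2) by (auto simp: upset_weight_pos_iff[OF S] proper_subsets_def)
  ultimately have "z j < z i" "z i < z j"
    using assms(2-4) by (auto simp: upset_weight_pos_iff[OF S])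
  then show False
    by simp
qed

lemma chain_of_sphere_in_poset_space:
  assumes S: "finite S" and pos: "\<exists>T. upset_weight S z T \<noteq> 0"
  shows "chain_of_sphere S z \<in> topspace (poset_space (proper_subsets S))"
    and "chain_of_sphere S z T \<noteq> 0 \<longleftrightarrow> upset_weight S z T \<noteq> 0"
    and "0 < sum (upset_weight S z) (proper_subsets S)"
proof -
  obtain T0 where T0: "upset_weight S z T0 \<noteq> 0"
    using pos by blast
  then have T0P: "T0 \<in> proper_subsets S"
    by (auto simp: upset_weight_pos_iff[OF S])
  show sum: "0 < sum (upset_weight S z) (proper_subsets S)"
    using T0 upset_weight_nonneg[of S z]
    by (intro sum_pos2[OF finite_proper_subsets[OF S] T0P]) (auto simp: less_le)
  then show iff: "chain_of_sphere S z T \<noteq> 0 \<longleftrightarrow> upset_weight S z T \<noteq> 0" for T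
    by (auto simp: chain_of_sphere_def)
  have "sum (chain_of_sphere S z) (proper_subsets S) = 1"
    using sum by (simp add: chain_of_sphere_def flip: sum_divide_distrib)
  moreover have "0 \<le> chain_of_sphere S z T" for T
    using sum upset_weight_nonneg[of S z T] by (simp add: chain_of_sphere_def)
  moreover have "chain_of_sphere S z T = 0" if "T \<notin> proper_subsets S" for T
    using that by (simp add: chain_of_sphere_def upset_weight_def)
  moreover have "u \<subseteq> v \<or> v \<subseteq> u" if "chain_of_sphere S z u \<noteq> 0" "chain_of_sphere S z v \<noteq> 0" for u v
  proof (rule upset_weight_chain[OF S])
    show "upset_weight S z u \<noteq> 0"
      using that iff by blast
    show "v \<subset> S" "\<And>i j. i \<in> v \<Longrightarrow> j \<in> S - v \<Longrightarrow> z j < z i"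
      using that iff by (auto simp: upset_weight_pos_iff[OF S] proper_subsets_def)
  qed
  ultimately show "chain_of_sphere S z \<in> topspace (poset_space (proper_subsets S))"
    by (simp add: in_poset_space[OF finite_proper_subsets[OF S]])
qed

text \<open>The coordinates of \<open>z\<close> with index at most \<open>k\<close> are not all zero, while the one with index \<open>Suc k\<close> is zero.
  So the positive or the nonnegative coordinates form a proper upper level set.\<close>

lemma sphere_has_upset:
  assumes "z \<in> topspace (nsphere k)"
  shows "\<exists>T. upset_weight {..Suc k} z T \<noteq> 0"
proof -
  have z: "(\<Sum>j\<le>k. (z j)\<^sup>2) = 1" "z (Suc k) = 0"
    using assms by (auto simp: in_nsphere)
  then obtain i where i: "i \<le> k" "z i \<noteq> 0"
    by (metis (mono_tags, lifting) atMost_iff sum.neutral zero_neq_one zero_power2)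
  have "upset_weight {..Suc k} z {j \<in> {..Suc k}. 0 < z j} \<noteq> 0" if "0 < z i"
  proof -
    have "i \<in> {j \<in> {..Suc k}. 0 < z j}" "Suc k \<in> {..Suc k} - {j \<in> {..Suc k}. 0 < z j}"
      using that i z(2) by auto
    then have "{j \<in> {..Suc k}. 0 < z j} \<in> proper_subsets {..Suc k}"
      unfolding proper_subsets_def by blast
    then show ?thesis
      by (auto simp: upset_weight_pos_iff)
  qed
  moreover have "upset_weight {..Suc k} z {j \<in> {..Suc k}. 0 \<le> z j} \<noteq> 0" if "z i < 0"
  proof -
    have "Suc k \<in> {j \<in> {..Suc k}. 0 \<le> z j}" "i \<in> {..Suc k} - {j \<in> {..Suc k}. 0 \<le> z j}"
      using that i z(2) by auto
    then have "{j \<in> {..Suc k}. 0 \<le> z j} \<in> proper_subsets {..Suc k}"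
      unfolding proper_subsets_def by blast
    then show ?thesis
      by (auto simp: upset_weight_pos_iff)
  qed
  ultimately show ?thesis
    using i by (metis linorder_neqE)
qed

lemma sphere_of_chain_order:
  assumes x: "x \<in> topspace (poset_space (proper_subsets {..Suc k}))"
    and T: "x T \<noteq> 0" "i \<in> T" "j \<in> {..Suc k} - T"
  shows "sphere_of_chain k x j < sphere_of_chain k x i"
    and "0 < (\<Sum>l\<le>k. (if l \<le> k then cover_mass {..Suc k} x l - cover_mass {..Suc k} x (Suc k) else 0)\<^sup>2)"
proof -
  define y where "y = cover_mass {..Suc k} x"
  define w where "w = (\<lambda>l. if l \<le> k then y l - y (Suc k) else 0)"
  have w: "w l = y l - y (Suc k)" if "l \<le> Suc k" for l
    using that by (auto simp: w_def le_Suc_eq)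
  have "T \<in> proper_subsets {..Suc k}"
    using x T(1) in_poset_space[OF finite_proper_subsets] by blast
  then have ij: "i \<le> Suc k" "j \<le> Suc k"
    using T by (auto simp: proper_subsets_def)
  have "y j < y i"
    unfolding y_def using cover_mass_gap[OF _ x T(1,2)] T by auto
  then have "w j < w i"
    using ij w by simp
  then have "(i \<le> k \<and> w i \<noteq> 0) \<or> (j \<le> k \<and> w j \<noteq> 0)"
    by (auto simp: w_def split: if_splits)
  then have pos: "0 < (\<Sum>l\<le>k. (w l)\<^sup>2)"
    using normalize_vec_pos by blast
  then show "0 < (\<Sum>l\<le>k. (if l \<le> k then cover_mass {..Suc k} x l - cover_mass {..Suc k} x (Suc k) else 0)\<^sup>2)"
    by (simp only: w_def y_def)
  show "sphere_of_chain k x j < sphere_of_chain k x i"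
  proof -
    have "sphere_of_chain k x = normalize_vec k w"
      by (simp only: sphere_of_chain_def w_def y_def)
    moreover have "w j / sqrt (\<Sum>l\<le>k. (w l)\<^sup>2) < w i / sqrt (\<Sum>l\<le>k. (w l)\<^sup>2)"
      using \<open>w j < w i\<close> pos by (intro divide_strict_right_mono) auto
    ultimately show ?thesis
      by (simp only: normalize_vec_def)
  qed
qed

lemma poset_space_support:
  assumes "x \<in> topspace (poset_space (proper_subsets {..Suc k}))"
  obtains T i j where "x T \<noteq> 0" "i \<in> T" "j \<in> {..Suc k} - T"
proof -
  note x' = assms[unfolded in_poset_space[OF finite_proper_subsets[OF finite_atMost]]]
  then obtain T where "x T \<noteq> 0" "T \<in> proper_subsets {..Suc k}"
    by (metis sum.neutral zero_neq_one)
  then show thesis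
    using that by (auto simp: proper_subsets_def)
qed

text \<open>Both composites are homotopic to the identity along straight lines: the two endpoints have common
  upper level sets. On the side of the complex, all these level sets form one chain. On the side of the
  sphere, some pair of coordinates is strictly ordered in the same way at both ends, so that the segment
  avoids the diagonal and can be normalized.\<close>

lemma proper_subsets_atMost_sphere:
  "poset_space (proper_subsets {..Suc k}) homotopy_equivalent_space nsphere k"
proof -
  define S where "S = {..Suc k}"
  have S: "finite S"
    by (simp add: S_def)
  let ?P = "proper_subsets S"
  let ?X = "poset_space ?P"
  let ?I = "top_of_set {0..1::real}"
  note in_X = in_poset_space[OF finite_proper_subsets[OF S]]
  have f: "continuous_map ?X (nsphere k) (sphere_of_chain k)"
    unfolding sphere_of_chain_def
  proof (rule continuous_map_normalize_vec)
    show "continuous_map ?X euclideanreal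
        (\<lambda>a. if v \<le> k then cover_mass {..Suc k} a v - cover_mass {..Suc k} a (Suc k) else 0)" for v
      using finite_proper_subsets[OF S]
      by (cases "v \<le> k") (auto simp: cover_mass_def S_def
          intro!: continuous_map_diff continuous_map_sum continuous_map_coordinate)
    show "0 < (\<Sum>l\<le>k. (if l \<le> k then cover_mass {..Suc k} x l - cover_mass {..Suc k} x (Suc k) else 0)\<^sup>2)"
      if "x \<in> topspace ?X" for x
    proof -
      note x = that[unfolded S_def]
      obtain T i j where "x T \<noteq> 0" "i \<in> T" "j \<in> {..Suc k} - T"
        by (rule poset_space_support[OF x])
      then show ?thesis
        by (rule sphere_of_chain_order(2)[OF x])
    qed
  qed auto
  have fin: "sphere_of_chain k x \<in> topspace (nsphere k)" if "x \<in> topspace ?X" for x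
    using f that by (simp add: continuous_map_def Pi_iff)
  have z: "continuous_map (nsphere k) euclideanreal (\<lambda>z. z i)" for i
    by (rule continuous_map_nsphere_projection)
  have gin: "chain_of_sphere S z \<in> topspace ?X" if "z \<in> topspace (nsphere k)" for z
    using chain_of_sphere_in_poset_space(1)[OF S] sphere_has_upset[OF that] by (simp add: S_def)
  have g: "continuous_map (nsphere k) ?X (chain_of_sphere S)"
  proof (rule continuous_map_into_poset_space)
    have w: "continuous_map (nsphere k) euclideanreal (\<lambda>z. upset_weight S z T)" for T
    proof (cases "T \<in> ?P")
      case True
      then have "finite T"
        using S by (auto simp: proper_subsets_def intro: finite_subset)
      then show ?thesis
        using True S by (auto simp: upset_weight_def
            intro!: continuous_map_prod continuous_map_real_max continuous_map_diff z)
    qed (simp add: upset_weight_def)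
    show "continuous_map (nsphere k) euclideanreal (\<lambda>z. chain_of_sphere S z T)" for T
      unfolding chain_of_sphere_def
    proof (intro continuous_map_real_divide continuous_map_sum w finite_proper_subsets S)
      fix z assume "z \<in> topspace (nsphere k)"
      then show "sum (upset_weight S z) ?P \<noteq> 0"
        using chain_of_sphere_in_poset_space(3)[OF S] sphere_has_upset by (fastforce simp: S_def)
    qed
  qed (use gin in blast)
  have s: "continuous_map (prod_topology ?I Y) euclideanreal (\<lambda>a. fst a)" for Y :: "'b topology"
    using continuous_map_fst continuous_map_into_fulltopology by blast
  have upper: "sphere_of_chain k x j < sphere_of_chain k x i"
    if "x \<in> topspace ?X" "x T \<noteq> 0" "i \<in> T" "j \<in> S - T" for x T i j
    using sphere_of_chain_order(1) that unfolding S_def by blast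

  have "homotopic_with (\<lambda>_. True) ?X ?X (chain_of_sphere S \<circ> sphere_of_chain k) id"
  proof -
    define H where "H = (\<lambda>(s, x) T. (1 - s) * chain_of_sphere S (sphere_of_chain k x) T + s * x T)"
    have "H (s, x) \<in> topspace ?X" if x: "x \<in> topspace ?X" and s: "0 \<le> s" "s \<le> 1" for s x
    proof -
      let ?c = "chain_of_sphere S (sphere_of_chain k x)"
      have c: "?c \<in> topspace ?X"
        using x fin gin by blast
      note x' = x[unfolded in_X] and c' = c[unfolded in_X]
      have cw: "upset_weight S (sphere_of_chain k x) T \<noteq> 0" if "?c T \<noteq> 0" for T
        using that by (auto simp: chain_of_sphere_def)
      have comp: "T \<subseteq> T' \<or> T' \<subseteq> T" if "?c T \<noteq> 0" "x T' \<noteq> 0" for T T'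
      proof (rule upset_weight_chain[OF S cw[OF that(1)]])
        show "T' \<subset> S"
          using x' that(2) by (auto simp: proper_subsets_def)
      qed (use upper x that in blast)
      have "H (s, x) T = 0" if "T \<notin> ?P" for T
        using that x' c' by (simp add: H_def)
      moreover have "sum (H (s, x)) ?P = 1"
        using x' c' by (simp add: H_def sum.distrib flip: sum_distrib_left)
      moreover have "0 \<le> H (s, x) T" for T
        using x' c' s by (simp add: H_def)
      moreover have "T \<subseteq> T' \<or> T' \<subseteq> T" if "H (s, x) T \<noteq> 0" "H (s, x) T' \<noteq> 0" for T T'
      proof -
        have "?c T \<noteq> 0 \<or> x T \<noteq> 0" "?c T' \<noteq> 0 \<or> x T' \<noteq> 0"
          using that by (auto simp: H_def)
        then show ?thesis
          using comp x' c' by meson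
      qed
      ultimately show ?thesis
        unfolding in_X by blast
    qed
    moreover have "continuous_map (prod_topology ?I ?X) euclideanreal (\<lambda>a. H a T)" for T
    proof -
      have "continuous_map (prod_topology ?I ?X) ?X (\<lambda>a. chain_of_sphere S (sphere_of_chain k (snd a)))"
        using continuous_map_compose[OF continuous_map_snd continuous_map_compose[OF f g]]
        by (simp add: o_def)
      then have c: "continuous_map (prod_topology ?I ?X) euclideanreal
          (\<lambda>a. chain_of_sphere S (sphere_of_chain k (snd a)) T)"
        using continuous_map_compose[OF _ continuous_map_coordinate] by (force simp: o_def)
      have x: "continuous_map (prod_topology ?I ?X) euclideanreal (\<lambda>a. snd a T)"
        using continuous_map_compose[OF continuous_map_snd continuous_map_coordinate]
        by (simp add: o_def)
      show ?thesis
        unfolding H_def case_prod_beta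
        by (intro continuous_map_add continuous_map_real_mult continuous_map_diff s c x) simp
    qed
    ultimately have "continuous_map (prod_topology ?I ?X) ?X H"
      by (intro continuous_map_into_poset_space) auto
    then show ?thesis
      by (subst homotopic_with) (auto intro!: exI[of _ H] simp: H_def)
  qed
  moreover have "homotopic_with (\<lambda>_. True) (nsphere k) (nsphere k) (sphere_of_chain k \<circ> chain_of_sphere S) id"
  proof -
    define L where "L = (\<lambda>(s, z) i. (1 - s) * sphere_of_chain k (chain_of_sphere S z) i + s * z i)"
    define H where "H = (\<lambda>a. normalize_vec k (L a))"
    have L0: "L (s, z) i = 0" if "z \<in> topspace (nsphere k)" "i > k" for s z i
      using that fin[OF gin[OF that(1)]] by (auto simp: L_def in_nsphere)
    have "0 < (\<Sum>i\<le>k. (L (s, z) i)\<^sup>2)" if z: "z \<in> topspace (nsphere k)" and s: "0 \<le> s" "s \<le> 1" for s z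
    proof -
      obtain T where T: "upset_weight S z T \<noteq> 0"
        using sphere_has_upset[OF z] by (auto simp: S_def)
      then have "chain_of_sphere S z T \<noteq> 0"
        using chain_of_sphere_in_poset_space(2)[OF S] by blast
      moreover obtain i j where ij: "i \<in> T" "j \<in> S - T" "z j < z i" "i \<in> S"
        using T by (force simp: upset_weight_pos_iff[OF S] proper_subsets_def)
      ultimately have "sphere_of_chain k (chain_of_sphere S z) j < sphere_of_chain k (chain_of_sphere S z) i"
        using upper gin z by blast
      then have "L (s, z) j < L (s, z) i"
        using s ij(3) unfolding L_def case_prod_conv
        by (cases "s = 0") (auto intro!: add_le_less_mono mult_left_mono)
      then have "(i \<le> k \<and> L (s, z) i \<noteq> 0) \<or> (j \<le> k \<and> L (s, z) j \<noteq> 0)"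
        using L0[OF z, of i s] L0[OF z, of j s] ij by (metis not_le_imp_less order_less_irrefl)
      then show ?thesis
        using normalize_vec_pos by blast
    qed
    moreover have "continuous_map (prod_topology ?I (nsphere k)) euclideanreal (\<lambda>a. L a i)" for i
    proof -
      have "continuous_map (prod_topology ?I (nsphere k)) (nsphere k)
          (\<lambda>a. sphere_of_chain k (chain_of_sphere S (snd a)))"
        using continuous_map_compose[OF continuous_map_snd continuous_map_compose[OF g f]]
        by (simp add: o_def)
      then have c: "continuous_map (prod_topology ?I (nsphere k)) euclideanreal
          (\<lambda>a. sphere_of_chain k (chain_of_sphere S (snd a)) i)"
        using continuous_map_compose[OF _ z] by (force simp: o_def)
      have x: "continuous_map (prod_topology ?I (nsphere k)) euclideanreal (\<lambda>a. snd a i)"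
        using continuous_map_compose[OF continuous_map_snd z] by (simp add: o_def)
      show ?thesis
        unfolding L_def case_prod_beta
        by (intro continuous_map_add continuous_map_real_mult continuous_map_diff s c x) simp
    qed
    ultimately have "continuous_map (prod_topology ?I (nsphere k)) (nsphere k) H"
      unfolding H_def using L0 by (intro continuous_map_normalize_vec) auto
    moreover have "normalize_vec k z = z" if "z \<in> topspace (nsphere k)" for z
      using that by (simp add: normalize_vec_def in_nsphere)
    ultimately show ?thesis
      by (subst homotopic_with)
        (auto intro!: exI[of _ H] simp: H_def L_def fin gin)
  qed
  ultimately show ?thesis
    unfolding homotopy_equivalent_space_def S_def[symmetric] using f g by blast
qed

lemma proper_subsets_sphere:
  fixes S :: "'a set"
  assumes "card S = k + 2"
  shows "poset_space (proper_subsets S) homotopy_equivalent_space nsphere k"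
proof -
  have S: "finite S"
    using assms by (simp add: card_ge_0_finite)
  then obtain h where h: "bij_betw h S {..Suc k}"
    using assms finite_same_card_bij[of S "{..Suc k}"] by auto
  define h' where "h' = inv_into S h"
  have h': "bij_betw h' {..Suc k} S"
    using h by (simp add: h'_def bij_betw_inv_into)
  have img: "(`) a ` proper_subsets A \<subseteq> proper_subsets B" if "bij_betw a A B" for a :: "'b \<Rightarrow> 'c" and A B
  proof -
    have "a ` T \<subset> B" if "T \<subset> A" for T
      using that \<open>bij_betw a A B\<close> unfolding bij_betw_def psubset_eq
      by (metis image_mono inj_on_image_eq_iff order_refl)
    then show ?thesis
      by (auto simp: proper_subsets_def)
  qed
  have "h' ` h ` T = T" if "T \<in> proper_subsets S" for T
    unfolding h'_def using that h
    by (intro inv_into_image_cancel) (auto simp: proper_subsets_def bij_betw_def)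
  moreover have "h ` h' ` T = T" if "T \<in> proper_subsets {..Suc k}" for T
    unfolding h'_def using that h
    by (intro image_inv_into_cancel[where A' = "{..Suc k}"])
      (auto simp: proper_subsets_def bij_betw_def)
  ultimately have "poset_space (proper_subsets S) homotopy_equivalent_space
      poset_space (proper_subsets {..Suc k})"
    using S by (intro poset_homotopy_equivalence[where f = "(`) h" and g = "(`) h'"]
        finite_proper_subsets img h h') (auto simp: mono_on_def)
  then show ?thesis
    using proper_subsets_atMost_sphere homotopy_eqv_trans by blast
qed

section \<open>Coconsistent graphs\<close>

text \<open>The condition on segments in terms of triples. Graphs are relations, so that the pointwise order on
  relations is inclusion of graphs.\<close>

definition coconsistent :: "nat \<Rightarrow> (nat \<Rightarrow> nat \<Rightarrow> bool) \<Rightarrow> bool" where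
  "coconsistent n E \<longleftrightarrow>
     (\<forall>i j. E i j \<longrightarrow> E j i \<and> i \<noteq> j \<and> 1 \<le> i \<and> i \<le> n) \<and>
     (\<forall>i c d e. c < d \<and> d < e \<and> d \<noteq> i \<and> E i c \<and> E i e \<longrightarrow> E i d) \<and>
     (\<forall>i c d e. 1 \<le> c \<and> c < d \<and> d < e \<and> e \<le> n \<and> c \<noteq> i \<and> e \<noteq> i \<and> E i d \<longrightarrow> E i c \<or> E i e)"

lemma coc_edge:
  assumes "coconsistent n E" "E i j"
  shows "E j i" "i \<noteq> j" "1 \<le> i" "i \<le> n" "1 \<le> j" "j \<le> n"
proof -
  have *: "\<forall>i j. E i j \<longrightarrow> E j i \<and> i \<noteq> j \<and> 1 \<le> i \<and> i \<le> n"
    using assms(1) unfolding coconsistent_def by (elim conjE)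
  show "E j i" "i \<noteq> j" "1 \<le> i" "i \<le> n" "1 \<le> j" "j \<le> n"
    using *[rule_format, of i j] *[rule_format, of j i] assms(2) by simp_all
qed

lemma coc_in:
  assumes "coconsistent n E" "E i c" "E i e" "c < d" "d < e" "d \<noteq> i"
  shows "E i d"
proof -
  have "\<forall>i c d e. c < d \<and> d < e \<and> d \<noteq> i \<and> E i c \<and> E i e \<longrightarrow> E i d"
    using assms(1) unfolding coconsistent_def by (elim conjE)
  from this[rule_format] show ?thesis
    using assms(2-) by metis
qed

lemma coc_out:
  assumes "coconsistent n E" "E i d" "c < d" "d < e" "c \<noteq> i" "e \<noteq> i" "1 \<le> c" "e \<le> n"
  shows "E i c \<or> E i e"
proof -
  have "\<forall>i c d e. 1 \<le> c \<and> c < d \<and> d < e \<and> e \<le> n \<and> c \<noteq> i \<and> e \<noteq> i \<and> E i d \<longrightarrow> E i c \<or> E i e"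
    using assms(1) unfolding coconsistent_def by (elim conjE)
  from this[rule_format] show ?thesis
    using assms(2-) by metis
qed

lemma coc_sym: "coconsistent n E \<Longrightarrow> E i j \<Longrightarrow> E j i"
  by (rule coc_edge)

lemma coc_irrefl: "coconsistent n E \<Longrightarrow> \<not> E i i"
  using coc_edge(2) by blast

lemma coc_ge1: "coconsistent n E \<Longrightarrow> E i j \<Longrightarrow> 1 \<le> i" "coconsistent n E \<Longrightarrow> E i j \<Longrightarrow> 1 \<le> j"
  by (fact coc_edge)+

lemma coc_le: "coconsistent n E \<Longrightarrow> E i j \<Longrightarrow> i \<le> n" "coconsistent n E \<Longrightarrow> E i j \<Longrightarrow> j \<le> n"
  by (fact coc_edge)+

text \<open>The symmetry that reverses the order of the vertices. It exchanges beginning and ending segments, and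
  preserves inclusion.\<close>

definition mirror :: "nat \<Rightarrow> (nat \<Rightarrow> nat \<Rightarrow> bool) \<Rightarrow> nat \<Rightarrow> nat \<Rightarrow> bool" where
  "mirror n E i j \<longleftrightarrow> i \<le> n \<and> j \<le> n \<and> E (n + 1 - i) (n + 1 - j)"

lemma coconsistent_mirror:
  assumes "coconsistent n E"
  shows "coconsistent n (mirror n E)"
proof -
  have "mirror n E i d" if "c < d" "d < e" "d \<noteq> i" "mirror n E i c" "mirror n E i e" for i c d e
    using that coc_in[OF assms, of "n + 1 - i" "n + 1 - e" "n + 1 - c" "n + 1 - d"]
    by (auto simp: mirror_def)
  moreover have "mirror n E i c \<or> mirror n E i e"
    if "1 \<le> c" "c < d" "d < e" "e \<le> n" "c \<noteq> i" "e \<noteq> i" "mirror n E i d" for i c d e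
    using that coc_out[OF assms, of "n + 1 - i" "n + 1 - d" "n + 1 - e" "n + 1 - c"]
    by (auto simp: mirror_def)
  moreover have "mirror n E j i \<and> i \<noteq> j \<and> 1 \<le> i \<and> i \<le> n" if "mirror n E i j" for i j
    using that coc_sym[OF assms] coc_irrefl[OF assms] coc_ge1[OF assms] coc_le[OF assms]
    by (auto simp: mirror_def) fastforce
  ultimately show ?thesis
    unfolding coconsistent_def by blast
qed

lemma mirror_mirror:
  assumes "coconsistent n E"
  shows "mirror n (mirror n E) = E"
proof (intro ext)
  fix i j
  have "i \<le> n \<and> j \<le> n \<and> Suc n - i \<le> n \<and> Suc n - j \<le> n" if "E i j"
    using coc_ge1[OF assms that] coc_le[OF assms that] by auto
  moreover have "Suc n - (Suc n - i) = i" if "i \<le> n" for i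
    using that by simp
  ultimately show "mirror n (mirror n E) i j = E i j"
    using coc_ge1[OF assms, of "Suc n - (Suc n - i)" "Suc n - (Suc n - j)"] unfolding mirror_def
    by auto
qed

definition add_edge :: "nat \<Rightarrow> nat \<Rightarrow> (nat \<Rightarrow> nat \<Rightarrow> bool) \<Rightarrow> nat \<Rightarrow> nat \<Rightarrow> bool" where
  "add_edge i j E a b \<longleftrightarrow> E a b \<or> {a, b} = {i, j}"

text \<open>The condition on the row of \<open>i\<close> alone: it stays a segment when \<open>j\<close> is added. The edge can be added if
  and only if this holds in the rows of both ends.\<close>

definition addable :: "nat \<Rightarrow> (nat \<Rightarrow> nat \<Rightarrow> bool) \<Rightarrow> nat \<Rightarrow> nat \<Rightarrow> bool" where
  "addable n E i j \<longleftrightarrow> i \<noteq> j \<and> 1 \<le> i \<and> i \<le> n \<and> 1 \<le> j \<and> j \<le> n \<and> \<not> E i j \<and>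
     (\<forall>c e. c < j \<and> j < e \<and> c \<noteq> i \<and> e \<noteq> i \<and> 1 \<le> c \<and> e \<le> n \<longrightarrow> E i c \<or> E i e) \<and>
     (\<forall>d e. j < d \<and> d < e \<and> d \<noteq> i \<and> E i e \<longrightarrow> E i d) \<and>
     (\<forall>c d. c < d \<and> d < j \<and> d \<noteq> i \<and> E i c \<longrightarrow> E i d)"

lemma addable_ne: "addable n E i j \<Longrightarrow> i \<noteq> j" "addable n E i j \<Longrightarrow> \<not> E i j"
  by (simp_all add: addable_def)

lemma addable_range:
  "addable n E i j \<Longrightarrow> 1 \<le> i" "addable n E i j \<Longrightarrow> i \<le> n"
  "addable n E i j \<Longrightarrow> 1 \<le> j" "addable n E i j \<Longrightarrow> j \<le> n"
  by (simp_all add: addable_def)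

lemma addable_mid:
  "addable n E i j \<Longrightarrow> c < j \<Longrightarrow> j < e \<Longrightarrow> c \<noteq> i \<Longrightarrow> e \<noteq> i \<Longrightarrow> 1 \<le> c \<Longrightarrow> e \<le> n \<Longrightarrow> E i c \<or> E i e"
  unfolding addable_def by blast

lemma addable_up:
  "addable n E i j \<Longrightarrow> E i e \<Longrightarrow> j < d \<Longrightarrow> d < e \<Longrightarrow> d \<noteq> i \<Longrightarrow> E i d"
  unfolding addable_def by blast

lemma addable_down:
  "addable n E i j \<Longrightarrow> E i c \<Longrightarrow> c < d \<Longrightarrow> d < j \<Longrightarrow> d \<noteq> i \<Longrightarrow> E i d"
  unfolding addable_def by blast

lemma addable_row:
  assumes E: "coconsistent n E" and ij: "addable n E i j" and "c < d" "d < e"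
  shows "\<lbrakk>d \<noteq> i; E i c \<or> c = j; E i e \<or> e = j\<rbrakk> \<Longrightarrow> E i d \<or> d = j"
    and "\<lbrakk>1 \<le> c; e \<le> n; c \<noteq> i; e \<noteq> i; E i d \<or> d = j\<rbrakk> \<Longrightarrow> E i c \<or> E i e"
proof -
  show "E i d \<or> d = j" if "d \<noteq> i" "E i c \<or> c = j" "E i e \<or> e = j"
    using that(2,3)
  proof (elim disjE)
    assume "E i c" "E i e"
    then show ?thesis
      using coc_in[OF E _ _ assms(3,4) that(1)] by blast
  next
    assume "E i c" "e = j"
    then show ?thesis
      using addable_down[OF ij _ assms(3) _ that(1)] assms(4) by blast
  next
    assume "c = j" "E i e"
    then show ?thesis
      using addable_up[OF ij _ _ assms(4) that(1)] assms(3) by blast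
  qed (use assms(3,4) in auto)
  show "E i c \<or> E i e" if "1 \<le> c" "e \<le> n" "c \<noteq> i" "e \<noteq> i" "E i d \<or> d = j"
    using that(5)
  proof
    assume "E i d"
    then show ?thesis
      by (rule coc_out[OF E _ assms(3,4) that(3,4,1,2)])
  next
    assume "d = j"
    then show ?thesis
      using addable_mid[OF ij _ _ that(3,4,1,2)] assms(3,4) by blast
  qed
qed

lemma coconsistent_add_edge:
  assumes E: "coconsistent n E" and ij: "addable n E i j" "addable n E j i"
  shows "coconsistent n (add_edge i j E)"
proof -
  note ne = addable_ne(1)[OF ij(1)]
  have row: "add_edge i j E i x \<longleftrightarrow> E i x \<or> x = j" "add_edge i j E j x \<longleftrightarrow> E j x \<or> x = i"
    "a \<noteq> i \<Longrightarrow> a \<noteq> j \<Longrightarrow> add_edge i j E a x \<longleftrightarrow> E a x" for a x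
    using ne by (auto simp: add_edge_def doubleton_eq_iff)
  have "add_edge i j E a d"
    if "c < d" "d < e" "d \<noteq> a" "add_edge i j E a c" "add_edge i j E a e" for a c d e
  proof -
    consider "a = i" | "a = j" | "a \<noteq> i" "a \<noteq> j"
      by blast
    then show ?thesis
    proof cases
      case 1
      then show ?thesis
        using that addable_row(1)[OF E ij(1) that(1,2)] by (simp only: row) blast
    next
      case 2
      then show ?thesis
        using that addable_row(1)[OF E ij(2) that(1,2)] by (simp only: row) blast
    next
      case 3
      then show ?thesis
        using that coc_in[OF E _ _ that(1-3)] unfolding row(3)[OF 3] by blast
    qed
  qed
  moreover have "add_edge i j E a c \<or> add_edge i j E a e"
    if "1 \<le> c" "c < d" "d < e" "e \<le> n" "c \<noteq> a" "e \<noteq> a" "add_edge i j E a d" for a c d e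
  proof -
    consider "a = i" | "a = j" | "a \<noteq> i" "a \<noteq> j"
      by blast
    then show ?thesis
    proof cases
      case 1
      then show ?thesis
        using that addable_row(2)[OF E ij(1) that(2,3)] by (simp only: row) blast
    next
      case 2
      then show ?thesis
        using that addable_row(2)[OF E ij(2) that(2,3)] by (simp only: row) blast
    next
      case 3
      then show ?thesis
        using that coc_out[OF E _ that(2,3,5,6,1,4)] unfolding row(3)[OF 3] by blast
    qed
  qed
  moreover have "add_edge i j E b a \<and> a \<noteq> b \<and> 1 \<le> a \<and> a \<le> n" if "add_edge i j E a b" for a b
    using that coc_edge[OF E, of a b] addable_range[OF ij(1)] ne
    by (auto simp: add_edge_def doubleton_eq_iff)
  ultimately show ?thesis
    unfolding coconsistent_def by blast
qed

text \<open>The neighbors of \<open>i\<close> in \<open>E\<close> form a beginning segment here, since \<open>c\<close> is a neighbor, \<open>j\<close> is not, and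
  \<open>c < j\<close>. The candidate is the first vertex that is missing.\<close>

lemma ex_addable_above:
  assumes E: "coconsistent n E" and F: "coconsistent n F" and sub: "\<And>i j. E i j \<Longrightarrow> F i j"
    and j: "F i j" "\<not> E i j" and c: "E i c" "c < j"
  shows "\<exists>k. F i k \<and> addable n E i k"
proof -
  define k where "k = (LEAST k. c < k \<and> k \<noteq> i \<and> \<not> E i k)"
  have ex: "c < j \<and> j \<noteq> i \<and> \<not> E i j"
    using j c coc_irrefl[OF F] by metis
  have k: "c < k" "k \<noteq> i" "\<not> E i k"
    using LeastI[where P = "\<lambda>k. c < k \<and> k \<noteq> i \<and> \<not> E i k", OF ex] by (auto simp: k_def)
  have least: "E i d" if "c < d" "d < k" "d \<noteq> i" for d
    using not_less_Least that unfolding k_def by blast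
  have "k \<le> j"
    unfolding k_def by (rule Least_le) (rule ex)
  then have Fk: "F i k"
    using coc_in[OF F sub[OF c(1)] j(1)] k j by (metis le_less)
  have "E i d" if "d < k" "d \<noteq> i" "1 \<le> d" for d
    using that least c(1) k coc_out[OF E, of i c d k] coc_le[OF F, of i k] Fk
    by (metis linorder_neqE_nat)
  moreover have "\<not> E i e" if "k < e" for e
    using coc_in[OF E c(1), of e k] k that by blast
  ultimately show ?thesis
    using Fk k coc_ge1[OF F, of i k] coc_le[OF F, of i k] coc_ge1[OF E]
    by (intro exI[of _ k]) (auto simp: addable_def)
qed

section \<open>The order on coconsistent graphs is inclusion\<close>

lemma mirror_apply: "1 \<le> i \<Longrightarrow> 1 \<le> j \<Longrightarrow> i \<le> n \<Longrightarrow> j \<le> n \<Longrightarrow> mirror n E (Suc n - i) (Suc n - j) \<longleftrightarrow> E i j"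
  by (auto simp: mirror_def)

lemma addable_mirror:
  assumes E: "coconsistent n E" and ij: "addable n E i j"
  shows "addable n (mirror n E) (Suc n - i) (Suc n - j)"
proof -
  let ?m = "\<lambda>x. Suc n - x"
  note r = addable_range[OF ij] addable_ne[OF ij]
  have i: "mirror n E (?m i) x \<longleftrightarrow> 1 \<le> x \<and> x \<le> n \<and> E i (?m x)" for x
    using r coc_edge[OF E, of i "?m x"] by (cases "x = 0") (auto simp: mirror_def)
  have "?m i \<noteq> ?m j" "1 \<le> ?m i" "?m i \<le> n" "1 \<le> ?m j" "?m j \<le> n" "\<not> mirror n E (?m i) (?m j)"
    using r by (auto simp: i)
  moreover have "mirror n E (?m i) c \<or> mirror n E (?m i) e"
    if "c < ?m j" "?m j < e" "c \<noteq> ?m i" "e \<noteq> ?m i" "1 \<le> c" "e \<le> n" for c e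
    using addable_mid[OF ij, of "?m e" "?m c"] that r by (auto simp: i)
  moreover have "mirror n E (?m i) d"
    if "?m j < d" "d < e" "d \<noteq> ?m i" "mirror n E (?m i) e" for d e
    using addable_down[OF ij, of "?m e" "?m d"] that r by (auto simp: i)
  moreover have "mirror n E (?m i) d"
    if "c < d" "d < ?m j" "d \<noteq> ?m i" "mirror n E (?m i) c" for c d
    using addable_up[OF ij, of "?m c" "?m d"] that r by (auto simp: i)
  ultimately show ?thesis
    unfolding addable_def by blast
qed

lemma addable_of_mirror:
  assumes E: "coconsistent n E" and ij: "addable n (mirror n E) i j"
  shows "addable n E (Suc n - i) (Suc n - j)"
  using addable_mirror[OF coconsistent_mirror[OF E] ij] mirror_mirror[OF E] by simp

lemma ex_addable_below:
  assumes E: "coconsistent n E" and F: "coconsistent n F" and sub: "\<And>i j. E i j \<Longrightarrow> F i j"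
    and j: "F i j" "\<not> E i j" and c: "E i c" "j < c"
  shows "\<exists>k. F i k \<and> addable n E i k"
proof -
  let ?m = "\<lambda>x. Suc n - x"
  note r = coc_edge[OF F j(1)] coc_edge[OF E c(1)]
  have "\<exists>k. mirror n F (?m i) k \<and> addable n (mirror n E) (?m i) k"
  proof (rule ex_addable_above[OF coconsistent_mirror[OF E] coconsistent_mirror[OF F]])
    show "mirror n F i j" if "mirror n E i j" for i j
      using that sub by (auto simp: mirror_def)
    show "mirror n F (?m i) (?m j)" "\<not> mirror n E (?m i) (?m j)" "mirror n E (?m i) (?m c)" "?m c < ?m j"
      using r j c by (auto simp: mirror_apply)
  qed
  then obtain k where k: "mirror n F (?m i) k" "addable n (mirror n E) (?m i) k"
    by blast
  then show ?thesis
    using addable_of_mirror[OF E k(2)] r by (intro exI[of _ "?m k"]) (auto simp: mirror_def)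
qed

lemma addable_empty_row:
  assumes "\<And>x. \<not> E i x" "i \<noteq> j" "1 \<le> i" "i \<le> n" "1 \<le> j" "j \<le> n"
    and "(\<forall>x. 1 \<le> x \<and> x < j \<longrightarrow> x = i) \<or> (\<forall>x. j < x \<and> x \<le> n \<longrightarrow> x = i)"
  shows "addable n E i j"
  using assms unfolding addable_def by blast

text \<open>If the row of \<open>i\<close> in \<open>E\<close> is empty, the first or the last vertex can be added, and one of them is a
  neighbor in \<open>F\<close>, whose row is a nonempty segment.\<close>

lemma ex_addable:
  assumes E: "coconsistent n E" and F: "coconsistent n F" and sub: "\<And>i j. E i j \<Longrightarrow> F i j"
    and j: "F i j" "\<not> E i j"
  shows "\<exists>k. F i k \<and> addable n E i k"
proof (cases "\<exists>c. E i c")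
  case True
  then show ?thesis
    using ex_addable_above[OF assms] ex_addable_below[OF assms] j(2) by (metis linorder_neqE_nat)
next
  case False
  note r = coc_edge[OF F j(1)]
  define f l where "f = (if i = 1 then 2 else (1::nat))" and "l = (if i = n then n - 1 else n)"
  have fl: "i \<noteq> f" "i \<noteq> l" "1 \<le> f" "l \<le> n" "f \<le> j" "j \<le> l"
    using r by (auto simp: f_def l_def)
  have "F i f \<or> F i l"
    using coc_out[OF F j(1), of f l] fl j(1) by (metis le_neq_implies_less)
  moreover have "addable n E i f" "addable n E i l"
    using False r fl by (auto intro!: addable_empty_row simp: f_def l_def)
  ultimately show ?thesis
    by blast
qed

text \<open>If the row of \<open>j\<close> is not empty, these are the vertices that must be added to it before \<open>i\<close> can be.\<close>

definition obstacles :: "nat \<Rightarrow> (nat \<Rightarrow> nat \<Rightarrow> bool) \<Rightarrow> nat \<Rightarrow> nat \<Rightarrow> nat set" where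
  "obstacles n E j i =
     {k \<in> {1..n}. k \<noteq> j \<and> \<not> E j k \<and> (\<exists>c. E j c \<and> (c < k \<and> k < i \<or> i < k \<and> k < c))}"

lemma addable_is_obstacle:
  assumes E: "coconsistent n E" and ij: "addable n E i j" and jk: "addable n E j k"
    and "k \<noteq> i" and c: "E j c"
  shows "k \<in> obstacles n E j i"
proof -
  note r = addable_range[OF ij] addable_ne[OF ij] addable_range[OF jk] addable_ne[OF jk]
  have ji: "\<not> E j i"
    using r coc_sym[OF E] by blast
  have "c \<noteq> k" "c \<noteq> i"
    using c ji r by blast+
  then have "c < k \<and> k < i \<or> i < k \<and> k < c"
    using coc_out[OF E c, of k i] coc_out[OF E c, of i k] addable_up[OF jk c, of i]
      addable_down[OF jk c, of i] r ji \<open>k \<noteq> i\<close> by (metis linorder_neqE_nat)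
  then show ?thesis
    using c r by (auto simp: obstacles_def)
qed

text \<open>Here the neighbors of \<open>j\<close> are exactly the vertices below \<open>k\<close>. If an obstacle \<open>x\<close> does not lie between \<open>k\<close>
  and \<open>i\<close>, some row fails to be a segment: follow the membership of \<open>i\<close> in the rows of \<open>x\<close>, of \<open>k\<close> and of the
  neighbor \<open>c0\<close> of \<open>k\<close> that makes \<open>x\<close> an obstacle.\<close>

lemma obstacles_decrease_aux:
  assumes E: "coconsistent n E" and ij: "addable n E i j" and jk: "addable n E j k"
    and c: "E j c" and ck: "c < k" "k < i" and x: "x \<in> obstacles n E k j"
  shows "k < x \<and> x < i"
proof -
  note r = addable_range[OF ij] addable_ne[OF ij] addable_range[OF jk] addable_ne[OF jk]
  have sym: "E a b \<longleftrightarrow> E b a" for a b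
    using coc_sym[OF E] by blast
  note e = coc_edge(2-6)[OF E]
  obtain c0 where c0: "E k c0" "c0 < x \<and> x < j \<or> j < x \<and> x < c0" and x: "\<not> E k x" "x \<noteq> k" "1 \<le> x" "x \<le> n"
    using x by (auto simp: obstacles_def)
  \<comment> \<open>The row of \<open>j\<close> is the beginning segment below \<open>k\<close>.\<close>
  have low: "E j a" if "a < k" "a \<noteq> j" "1 \<le> a" for a
    using addable_down[OF jk c, of a] coc_out[OF E c, of a k] that ck r c
    by (metis linorder_neqE_nat)
  have high: "\<not> E j a" if "k \<le> a" for a
    using coc_in[OF E c, of a k] that ck r by (metis le_neq_implies_less)
  have ij': "\<not> E j i" "\<not> E k j"
    using r sym by blast+
  have f1: False if "x < k" "c0 < x \<and> x < j" "j < k"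
  proof -
    have jx: "E x j" and xk: "\<not> E x k"
      using low[of x] sym[of x] that x by auto
    have "\<not> E x i"
      using coc_in[OF E jx, of i k] xk that ck x by auto
    then have "\<not> E i x"
      using sym by blast
    then have "E i k"
      using addable_mid[OF ij, of x k] that ck x r by auto
    then have "E k i"
      using sym by blast
    then show False
      using coc_in[OF E c0(1), of i x] that ck x by auto
  qed
  have f2: False if "x < k" "c0 < x \<and> x < j" "k < j"
  proof -
    have jx: "E x j" and xk: "\<not> E x k"
      using low[of x] sym[of x] that x by auto
    have c0j: "E c0 j" "E c0 k"
      using low[of c0] e(4)[OF c0(1)] sym[of c0] c0(1) that by auto
    have "\<not> E k i"
      using coc_in[OF E c0(1), of i x] that ck x by auto
    then have ik: "\<not> E i k"
      using sym by blast
    have ix: "\<not> E i x"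
      using addable_down[OF ij, of x k] ik that ck by auto
    have "\<not> E i c0"
      using addable_down[OF ij, of c0 x] ix that ck by auto
    then have c0i: "\<not> E c0 i"
      using sym by blast
    show False
    proof (cases "i < j")
      case True
      then show False
        using coc_in[OF E c0j(2,1), of i] c0i ck that by auto
    next
      case False
      have "\<not> E x i"
        using ix sym by blast
      then show False
        using coc_out[OF E jx, of k i] xk False that ck r by auto
    qed
  qed
  have f3: False if "x < k" "j < x \<and> x < c0"
  proof -
    have jx: "E x j" and xk: "\<not> E x k"
      using low[of x] sym[of x] that x by auto
    have "\<not> E x i"
      using coc_in[OF E jx, of i k] xk that ck by auto
    then have ix: "\<not> E i x"
      using sym by blast
    have above: "\<not> E i a" if "x < a" for a
      using addable_up[OF ij, of a x] that ix \<open>x < k\<close> \<open>j < x \<and> x < c0\<close> ck by auto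
    show False
    proof (cases "c0 < i")
      case True
      have "\<not> E k i"
        using above[of k] sym that by blast
      then show False
        using coc_out[OF E c0(1), of x i] True that ck x r by auto
    next
      case False
      then have "i < c0"
        using above[of k] c0 that sym[of k] by (metis linorder_neqE_nat)
      moreover have "\<not> E c0 j" "\<not> E c0 i"
        using high[of c0] above[of c0] sym \<open>i < c0\<close> ck that by auto
      ultimately show False
        using coc_out[OF E, of c0 k j i] c0(1) sym[of k c0] that ck r by auto
    qed
  qed
  have f4: False if "i \<le> x" "c0 < x \<and> x < j"
  proof -
    have *: "\<not> E a k" if a: "E j a" for a
    proof
      assume "E a k"
      have "a < k" "E a j"
        using high[of a] a sym by (metis not_le)+
      then have "E i a"
        using coc_in[OF E \<open>E a k\<close>, of j i] \<open>i \<le> x\<close> \<open>c0 < x \<and> x < j\<close> ck sym by auto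
      then have ia: "E i d" if "a < d" "d < j" "d \<noteq> i" for d
        using addable_down[OF ij _ that] by blast
      show False
      proof (cases "x = i")
        case True
        then show False
          using ia[of k] \<open>a < k\<close> \<open>c0 < x \<and> x < j\<close> ck sym x by auto
      next
        case False
        then have "E x i"
          using ia[of x] \<open>a < k\<close> \<open>c0 < x \<and> x < j\<close> \<open>i \<le> x\<close> ck sym by auto
        then show False
          using coc_out[OF E, of x i k j] high[of x] sym x False \<open>i \<le> x\<close> \<open>c0 < x \<and> x < j\<close> ck r by auto
      qed
    qed
    have "\<not> E k c"
      using * c sym by blast
    have "c0 \<noteq> c" "c0 \<noteq> k"
      using c0(1) \<open>\<not> E k c\<close> e(1) by auto
    show False
    proof (cases "c < c0")
      case True
      then show False
        using coc_out[OF E c0(1), of c x] \<open>\<not> E k c\<close> that x ck e(2)[OF c] e(4)[OF c] by auto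
    next
      case False
      then have "E j c0"
        using low[of c0] e(4)[OF c0(1)] that ck by auto
      then show False
        using * c0(1) sym by blast
    qed
  qed
  have f5: False if "i \<le> x" "j < x \<and> x < c0"
  proof -
    have c_range: "1 \<le> c" "c0 \<le> n" "c0 \<noteq> k"
      using e[OF c] e[OF c0(1)] by auto
    have kx: "\<not> E k d" if "d < x" "d \<noteq> k" for d
      using coc_in[OF E _ c0(1), of d x] that \<open>j < x \<and> x < c0\<close> x by blast
    have "\<not> E k i"
      using kx[of i] \<open>i \<le> x\<close> x ck by (cases "x = i") auto
    then have ik: "\<not> E i k"
      using sym by blast
    have "\<not> E k c"
      using kx[of c] \<open>i \<le> x\<close> ck by auto
    then have cjk: "E c j" "\<not> E c k"
      using c sym by blast+
    have c0k: "E c0 k" "\<not> E c0 j"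
      using c0(1) high[of c0] sym \<open>i \<le> x\<close> \<open>j < x \<and> x < c0\<close> ck by auto
    show False
    proof (cases "j < k")
      case True
      have "\<not> E c i"
        using coc_in[OF E cjk(1), of i k] cjk True ck by auto
      then have ic: "\<not> E i c"
        using sym by blast
      have "j < c"
        using addable_mid[OF ij, of c k] ic ik ck True c_range r e(1)[OF c]
        by (metis linorder_neqE_nat less_irrefl less_trans)
      have "\<not> E i c0"
        using addable_up[OF ij, of c0 k] ik True ck \<open>i \<le> x\<close> \<open>j < x \<and> x < c0\<close> by auto
      then have "\<not> E c0 i"
        using sym by blast
      then show False
        using coc_out[OF E c0k(1), of j i] c0k(2) True ck \<open>i \<le> x\<close> \<open>j < x \<and> x < c0\<close> r by auto
    next
      case False
      then have kj: "k < j"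
        using r by simp
      have ic: "\<not> E i c"
        using addable_down[OF ij, of c k] ik ck kj by auto
      have up: "E i d" if "j < d" "d \<noteq> i" "d \<le> n" for d
        using addable_mid[OF ij, of c d] that ic ck kj c_range by auto
      show False
      proof (cases "i < j")
        case True
        then have "E i x"
          using up[of x] \<open>j < x \<and> x < c0\<close> x by auto
        then have "E x i"
          using sym by blast
        then show False
          using coc_out[OF E, of x i k j] high[of x] sym x True ck \<open>j < x \<and> x < c0\<close> r by auto
      next
        case False
        then have "j < i"
          using r by simp
        have "E i c0"
          using up[of c0] \<open>i \<le> x\<close> \<open>j < x \<and> x < c0\<close> c_range by auto
        then have "E c0 i"
          using sym by blast
        then show False
          using coc_in[OF E c0k(1), of i j] c0k(2) kj \<open>j < i\<close> \<open>j < x \<and> x < c0\<close> by auto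
      qed
    qed
  qed
  have "\<not> x < k" "\<not> i \<le> x"
    using f1 f2 f3 f4 f5 c0(2) r by (metis linorder_neqE_nat le_neq_implies_less)+
  then show ?thesis
    using x by simp
qed

lemma obstacles_mirror:
  assumes E: "coconsistent n E" and "1 \<le> j" "j \<le> n" "1 \<le> i" "i \<le> n"
    and x: "x \<in> obstacles n E j i"
  shows "Suc n - x \<in> obstacles n (mirror n E) (Suc n - j) (Suc n - i)"
proof -
  obtain c where c: "E j c" "c < x \<and> x < i \<or> i < x \<and> x < c" and x: "\<not> E j x" "x \<noteq> j" "1 \<le> x" "x \<le> n"
    using x by (auto simp: obstacles_def)
  have "1 \<le> c" "c \<le> n"
    using coc_edge[OF E c(1)] by auto
  then have "mirror n E (Suc n - j) (Suc n - c)" "\<not> mirror n E (Suc n - j) (Suc n - x)"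
    "Suc n - c < Suc n - x \<and> Suc n - x < Suc n - i \<or> Suc n - i < Suc n - x \<and> Suc n - x < Suc n - c"
    using c x assms by (auto simp: mirror_apply)
  moreover have "Suc n - x \<in> {1..n}" "Suc n - x \<noteq> Suc n - j"
    using x assms by auto
  ultimately show ?thesis
    unfolding obstacles_def by blast
qed

text \<open>Walk from \<open>i\<close> to an addable \<open>j\<close>, and from \<open>j\<close> to an addable \<open>k\<close>. As long as the rows met on the way are not
  empty, the set of obstacles on the way back decreases.\<close>

lemma obstacles_decrease:
  assumes E: "coconsistent n E" and ij: "addable n E i j" and jk: "addable n E j k"
    and "k \<noteq> i" and c: "E j c"
  shows "obstacles n E k j \<subseteq> obstacles n E j i - {k}"
proof
  fix x assume x: "x \<in> obstacles n E k j"
  note r = addable_range[OF ij] addable_ne[OF ij] addable_range[OF jk] addable_ne[OF jk]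
  have x_range: "x \<noteq> k" "1 \<le> x" "x \<le> n"
    using x by (auto simp: obstacles_def)
  obtain c where c: "E j c" "c < k \<and> k < i \<or> i < k \<and> k < c"
    using addable_is_obstacle[OF E ij jk assms(4) c] by (auto simp: obstacles_def)
  have between: "k < x \<and> x < i \<or> i < x \<and> x < k"
    using c(2)
  proof
    assume "c < k \<and> k < i"
    then show ?thesis
      using obstacles_decrease_aux[OF E ij jk c(1) _ _ x] by blast
  next
    assume *: "i < k \<and> k < c"
    let ?m = "\<lambda>x. Suc n - x"
    have c_range: "c \<le> n"
      using coc_edge[OF E c(1)] by blast
    have "?m k < ?m x \<and> ?m x < ?m i"
    proof (rule obstacles_decrease_aux)
      show "coconsistent n (mirror n E)"
        by (rule coconsistent_mirror[OF E])
      show "addable n (mirror n E) (?m i) (?m j)" "addable n (mirror n E) (?m j) (?m k)"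
        by (fact addable_mirror[OF E ij] addable_mirror[OF E jk])+
      show "mirror n E (?m j) (?m c)" "?m c < ?m k" "?m k < ?m i"
        using * c c_range r by (auto simp: mirror_apply)
      show "?m x \<in> obstacles n (mirror n E) (?m k) (?m j)"
        using x r by (intro obstacles_mirror[OF E]) auto
    qed
    then show ?thesis
      by linarith
  qed
  have "\<not> E j x"
    using between c coc_in[OF E c(1), of x k] coc_in[OF E _ c(1), of x k] r by auto
  moreover have "x \<noteq> j"
    using x by (auto simp: obstacles_def)
  moreover have "c < x \<and> x < i \<or> i < x \<and> x < c"
    using between c(2) by linarith
  ultimately have "\<not> E j x" "x \<noteq> j" "c < x \<and> x < i \<or> i < x \<and> x < c"
    by blast+
  then show "x \<in> obstacles n E j i - {k}"
    using c(1) x_range unfolding obstacles_def by auto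
qed

text \<open>Since \<open>addable\<close> excludes the edges of \<open>E\<close>, the edge is new.\<close>

definition growable :: "nat \<Rightarrow> (nat \<Rightarrow> nat \<Rightarrow> bool) \<Rightarrow> (nat \<Rightarrow> nat \<Rightarrow> bool) \<Rightarrow> bool" where
  "growable n E F \<longleftrightarrow> (\<exists>a b. F a b \<and> addable n E a b \<and> addable n E b a)"

lemma growable_of_mirror:
  assumes E: "coconsistent n E" and "growable n (mirror n E) (mirror n F)"
  shows "growable n E F"
proof -
  obtain a b where ab: "mirror n F a b" "addable n (mirror n E) a b" "addable n (mirror n E) b a"
    using assms(2) by (auto simp: growable_def)
  then have "F (Suc n - a) (Suc n - b)"
    by (simp add: mirror_def)
  then show ?thesis
    using addable_of_mirror[OF E ab(2)] addable_of_mirror[OF E ab(3)] unfolding growable_def by blast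
qed

text \<open>The row of \<open>1\<close> contains \<open>1j\<close> in \<open>F\<close> but not in \<open>E\<close>. If it is not empty in \<open>E\<close>, let \<open>k\<close> be the vertex
  that can be added to it in the direction of \<open>j\<close>. The row of \<open>k\<close> avoids both \<open>1\<close> and \<open>j\<close>, or both \<open>1\<close> and \<open>n\<close>,
  and turns out to be empty; so \<open>1k\<close> can be added. If the row of \<open>1\<close> is empty, then \<open>12\<close>, \<open>1n\<close>, or an edge
  at \<open>n\<close> can be added for similar reasons.\<close>

lemma growable_empty_row_first:
  assumes E: "coconsistent n E" and F: "coconsistent n F" and sub: "\<And>i j. E i j \<Longrightarrow> F i j"
    and j: "\<And>x. \<not> E j x" "1 < j" and Fj: "F j 1"
  shows "growable n E F"
proof -
  have jn: "j \<le> n" "1 \<le> n"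
    using coc_edge[OF F Fj] by auto
  have F1j: "F 1 j"
    using coc_sym[OF F Fj] .
  have sym: "E a b \<longleftrightarrow> E b a" for a b
    using coc_sym[OF E] by blast
  have jout: "\<not> E a j" for a
    using j sym by blast
  have empty_row: "addable n E k 1" if "\<And>x. \<not> E k x" "k \<noteq> 1" "1 \<le> k" "k \<le> n" for k
    using that by (intro addable_empty_row) auto
  have empty: "\<not> E k x" if "\<not> E k 1" "\<not> E k n" "k \<noteq> 1" "k \<noteq> n" for k x
    using coc_out[OF E, of k x 1 n] coc_edge[OF E, of k x] that by (metis le_neq_implies_less le_refl)
  consider (below) c where "E 1 c" "c < j" | (none) "\<And>x. \<not> E 1 x" | (above) c where "E 1 c" "j < c"
    using jout by (metis linorder_neqE_nat)
  then show ?thesis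
  proof cases
    case below
    obtain k where k: "F 1 k" "addable n E 1 k"
      using ex_addable_above[OF E F sub F1j jout below] by blast
    note r = addable_range[OF k(2)] addable_ne[OF k(2)]
    have "k \<le> j"
      using addable_down[OF k(2) below] jout j(2) by (metis less_irrefl not_le)
    have k1: "\<not> E k 1"
      using r sym by blast
    have "\<not> E k x" for x
    proof
      assume x: "E k x"
      note rx = coc_edge[OF E x]
      have "k \<noteq> j"
        using x j(1) by blast
      then have kj: "k < j"
        using \<open>k \<le> j\<close> by simp
      have "x \<noteq> 1" "x \<noteq> j"
        using x k1 jout by blast+
      then have "j < x"
        using coc_out[OF E x, of 1 j] k1 jout kj rx jn r by (metis le_neq_implies_less linorder_neqE_nat order_refl)
      then have "\<not> E 1 x"
        using coc_in[OF E below(1), of x j] jout below(2) j(2) by auto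
      then have "\<not> E x 1"
        using sym by blast
      then show False
        using coc_out[OF E rx(1), of 1 j] jout kj rx jn r \<open>j < x\<close> j(2) by auto
    qed
    then have "addable n E k 1"
      using r by (intro empty_row) auto
    then show ?thesis
      using k unfolding growable_def by blast
  next
    case none
    have none': "\<not> E x 1" for x
      using none sym by blast
    show ?thesis
    proof (cases "F 1 2")
      case True
      have n2: "2 \<le> n"
        using j(2) jn by simp
      have "\<not> E 2 x" for x
      proof
        assume x: "E 2 x"
        note rx = coc_edge[OF E x]
        have "j \<noteq> 2"
          using x j(1) by blast
        then have "2 < j"
          using j(2) by simp
        have "x \<noteq> 1" "x \<noteq> j"
          using x none' jout by blast+
        have "j < x"
        proof (rule ccontr)
          assume "\<not> j < x"
          then have "1 < x" "x < j"
            using \<open>x \<noteq> 1\<close> \<open>x \<noteq> j\<close> rx by linarith+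
          then show False
            using coc_out[OF E x, of 1 j] none' jout \<open>2 < j\<close> jn by auto
        qed
        then have "E 2 n"
          using coc_out[OF E x, of j n] jout jn rx x \<open>2 < j\<close> by (cases "x = n") auto
        then show False
          using coc_out[OF E, of n 2 1 j] sym none' jout jn rx \<open>j < x\<close> \<open>2 < j\<close> by auto
      qed
      then have "addable n E 2 1"
        using n2 by (intro empty_row) auto
      moreover have "addable n E 1 2"
        using none n2 by (intro addable_empty_row) auto
      ultimately show ?thesis
        using True unfolding growable_def by blast
    next
      case False
      have "j \<noteq> 2"
        using F1j False by blast
      then have j2: "2 < j"
        using j(2) by simp
      then have F1n: "F 1 n"
        using coc_out[OF F F1j, of 2 n] F1j False jn by (cases "j = n") auto
      have a1n: "addable n E 1 n"
        using none jn j2 by (intro addable_empty_row) auto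
      show ?thesis
      proof (cases "\<exists>x. E n x")
        case False
        then have "addable n E n 1"
          using jn j2 by (intro empty_row) auto
        then show ?thesis
          using a1n F1n unfolding growable_def by blast
      next
        case True
        then obtain x where x: "E n x"
          by blast
        note rx = coc_edge[OF E x]
        have "j \<noteq> n"
          using x j(1) by blast
        then have "j < n"
          using jn by simp
        have "x \<noteq> 1" "x \<noteq> j"
          using x none' jout by blast+
        then have "j < x"
          using coc_out[OF E x, of 1 j] none' jout \<open>j < n\<close> rx jn j2
          by (metis le_neq_implies_less linorder_neqE_nat less_irrefl order_refl not_less)
        obtain l where l: "F n l" "addable n E n l"
          using ex_addable[OF E F sub coc_sym[OF F F1n] none'] by blast
        note r = addable_range[OF l(2)] addable_ne[OF l(2)]
        have "j \<le> l"
          using addable_up[OF l(2) x, of j] jout \<open>j < x\<close> \<open>j < n\<close> by (metis less_irrefl not_le)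
        have "\<not> E l n"
          using r sym by blast
        then have "\<not> E l x" for x
          using empty[of l] none' r \<open>j \<le> l\<close> j2 by auto
        then have "addable n E l n"
          using r by (intro addable_empty_row) auto
        then show ?thesis
          using l unfolding growable_def by blast
      qed
    qed
  next
    case above
    note rc = coc_edge[OF E above(1)]
    obtain k where k: "F 1 k" "addable n E 1 k"
      using ex_addable_below[OF E F sub F1j jout above] by blast
    note r = addable_range[OF k(2)] addable_ne[OF k(2)]
    have "j \<le> k"
      using addable_up[OF k(2) above(1), of j] jout j(2) above(2) by (metis less_irrefl not_le)
    have "E 1 n"
      using coc_out[OF E above(1), of j n] jout j(2) jn above rc by (cases "c = n") auto
    then have "E n 1" "k \<noteq> n"
      using sym r by blast+
    have "\<not> E k x" for x
    proof (cases "k = j")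
      case False
      then have "j < k"
        using \<open>j \<le> k\<close> by simp
      then have "\<not> E n k"
        using coc_in[OF E \<open>E n 1\<close>, of k j] jout j(2) r \<open>k \<noteq> n\<close> by auto
      then show ?thesis
        using empty[of k x] r \<open>k \<noteq> n\<close> sym by blast
    qed (use j in auto)
    then have "addable n E k 1"
      using r by (intro empty_row) auto
    then show ?thesis
      using k unfolding growable_def by blast
  qed
qed

lemma growable_empty_row_last:
  assumes E: "coconsistent n E" and F: "coconsistent n F" and sub: "\<And>i j. E i j \<Longrightarrow> F i j"
    and j: "\<And>x. \<not> E j x" "j < n" and Fj: "F j n"
  shows "growable n E F"
proof (rule growable_of_mirror[OF E], rule growable_empty_row_first[where j = "Suc n - j"])
  note r = coc_edge[OF F Fj]
  show "mirror n F i j" if "mirror n E i j" for i j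
    using that sub by (auto simp: mirror_def)
  show "\<not> mirror n E (Suc n - j) x" for x
    using j r by (auto simp: mirror_def)
  show "1 < Suc n - j"
    using j by simp
  show "mirror n F (Suc n - j) 1"
    using r Fj by (auto simp: mirror_def)
qed (fact coconsistent_mirror[OF E] coconsistent_mirror[OF F])+

text \<open>This is the case that the previous two lemmas leave: the empty row is that of \<open>1\<close>, and \<open>1n\<close> need not be an
  edge of \<open>F\<close>. If \<open>1\<close> is addable in the row of \<open>x\<close>, then either this row is empty, and \<open>growable_empty_row_first\<close>
  applies to \<open>x\<close>; or \<open>x = 2\<close>, and the edge \<open>12\<close> can be added; or the row contains \<open>2\<close>, so that the row of \<open>2\<close> is
  not empty, and \<open>2\<close> is addable in the row of \<open>1\<close>.\<close>

lemma step_into_empty_first_row: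
  assumes E: "coconsistent n E" and F: "coconsistent n F" and sub: "\<And>i j. E i j \<Longrightarrow> F i j"
    and one: "\<And>x. \<not> E 1 x" and F12: "F 1 2" and x: "F x 1" "addable n E x 1"
  shows "growable n E F \<or> (\<exists>i j c. F i j \<and> addable n E i j \<and> E j c)"
proof (cases "\<exists>c. E x c")
  case False
  note rx = coc_edge[OF F x(1)]
  then show ?thesis
    using growable_empty_row_first[OF E F sub, of x] False x(1) by auto
next
  case True
  then obtain c where c: "E x c"
    by blast
  note rc = coc_edge[OF E c]
  have a12: "addable n E 1 2"
    using one coc_edge[OF F F12] by (intro addable_empty_row) auto
  show ?thesis
  proof (cases "x = 2")
    case True
    then show ?thesis
      using a12 x F12 unfolding growable_def by blast
  next
    case False
    have "c \<noteq> 1"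
      using c addable_ne[OF x(2)] by blast
    then have "E x 2"
      using addable_up[OF x(2) c, of 2] False c rc by (cases "c = 2") auto
    then have "E 2 x"
      by (rule coc_sym[OF E])
    then show ?thesis
      using a12 F12 by blast
  qed
qed

lemma step_into_empty_last_row:
  assumes E: "coconsistent n E" and F: "coconsistent n F" and sub: "\<And>i j. E i j \<Longrightarrow> F i j"
    and last: "\<And>x. \<not> E n x" and Fn: "F n (n - 1)" and x: "F x n" "addable n E x n"
  shows "growable n E F \<or> (\<exists>i j c. F i j \<and> addable n E i j \<and> E j c)"
proof -
  note r = coc_edge[OF F Fn] coc_edge[OF F x(1)]
  have "growable n (mirror n E) (mirror n F) \<or>
    (\<exists>i j c. mirror n F i j \<and> addable n (mirror n E) i j \<and> mirror n E j c)"
  proof (rule step_into_empty_first_row[where x = "Suc n - x"])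
    show "mirror n F i j" if "mirror n E i j" for i j
      using that sub by (auto simp: mirror_def)
    show "\<not> mirror n E 1 x" for x
      using last by (auto simp: mirror_def)
    have "Suc n - 2 = n - 1"
      by simp
    then show "mirror n F 1 2"
      using r Fn by (auto simp: mirror_def)
    show "mirror n F (Suc n - x) 1"
      using r x(1) by (auto simp: mirror_def)
    show "addable n (mirror n E) (Suc n - x) 1"
      using addable_mirror[OF E x(2)] by simp
  qed (fact coconsistent_mirror[OF E] coconsistent_mirror[OF F])+
  then show ?thesis
  proof
    assume "\<exists>i j c. mirror n F i j \<and> addable n (mirror n E) i j \<and> mirror n E j c"
    then obtain i j c where "mirror n F i j" "addable n (mirror n E) i j" "mirror n E j c"
      by blast
    then have "F (Suc n - i) (Suc n - j)" "addable n E (Suc n - i) (Suc n - j)" "E (Suc n - j) (Suc n - c)"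
      using addable_of_mirror[OF E] by (auto simp: mirror_def)
    then show ?thesis
      by blast
  qed (use growable_of_mirror[OF E] in blast)
qed

text \<open>Suppose that no edge can be added. Among the pairs \<open>ij\<close> in \<open>F\<close> such that \<open>j\<close> is addable in the row of \<open>i\<close> and
  the row of \<open>j\<close> is not empty, take one with the fewest obstacles on the way back. The next step from \<open>j\<close>
  goes to some \<open>k \<noteq> i\<close>. If the row of \<open>k\<close> is not empty, there are fewer obstacles. If it is empty, then \<open>k\<close> is
  \<open>1\<close> or \<open>n\<close> by the lemmas on empty rows. But \<open>k\<close> lies strictly between \<open>i\<close> and a neighbor of \<open>j\<close>.\<close>

theorem coconsistent_growable:
  assumes E: "coconsistent n E" and F: "coconsistent n F" and sub: "\<And>i j. E i j \<Longrightarrow> F i j"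
    and ab: "F a b" "\<not> E a b"
  shows "growable n E F"
proof (rule ccontr)
  assume no: "\<not> growable n E F"
  define P where "P = (\<lambda>(i, j). F i j \<and> addable n E i j \<and> (\<exists>c. E j c))"
  \<comment> \<open>A step into an empty row ends in \<open>1\<close> or \<open>n\<close>, and then there is also a step into a row that is not empty.\<close>
  have into_empty: "(j = 1 \<or> j = n) \<and> (\<exists>p. P p)" if x: "F x j" "addable n E x j" and j: "\<And>c. \<not> E j c" for x j
  proof -
    note r = coc_edge[OF F x(1)]
    have first: "\<not> F j 1" if "1 < j"
      using growable_empty_row_first[OF E F sub j that] no by blast
    have last: "\<not> F j n" if "j < n"
      using growable_empty_row_last[OF E F sub j that] no by blast
    have ex: "1 < n"
      using r by linarith
    have "j = 1 \<or> j = n"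
      using coc_out[OF F coc_sym[OF F x(1)], of 1 n] first last r x(1) coc_sym[OF F x(1)]
      by (metis le_neq_implies_less order_refl)
    then show ?thesis
    proof
      assume j1: "j = 1"
      then have "\<not> F 1 n"
        using last ex by blast
      then have "F 1 2"
        using coc_out[OF F coc_sym[OF F x(1)], of 2 n] r coc_sym[OF F x(1)] j1
        by (cases "x = 2"; cases "x = n") auto
      then show ?thesis
        using step_into_empty_first_row[OF E F sub, of x] j x no j1 unfolding P_def by auto
    next
      assume jn: "j = n"
      then have "\<not> F n 1"
        using first ex by blast
      then have "F n (n - 1)"
        using coc_out[OF F coc_sym[OF F x(1)], of 1 "n - 1"] r coc_sym[OF F x(1)] jn
        by (cases "x = 1"; cases "x = n - 1") auto
      then show ?thesis
        using step_into_empty_last_row[OF E F sub, of x] j x no jn unfolding P_def by auto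
    qed
  qed
  have "\<exists>p. P p"
  proof -
    obtain j where j: "F a j" "addable n E a j"
      using ex_addable[OF E F sub ab] by blast
    then show ?thesis
      using into_empty[OF j] unfolding P_def by auto
  qed
  then obtain p where p: "P p" and min: "\<And>q. P q \<Longrightarrow>
      card (obstacles n E (snd p) (fst p)) \<le> card (obstacles n E (snd q) (fst q))"
    using ex_has_least_nat[of P _ "\<lambda>p. card (obstacles n E (snd p) (fst p))"] by blast
  obtain i j c where ij: "p = (i, j)" "F i j" "addable n E i j" "E j c"
    using p unfolding P_def by (cases p) auto
  have "F j i" "\<not> E j i"
    using coc_sym[OF F ij(2)] coc_sym[OF E] addable_ne[OF ij(3)] by blast+
  then obtain k where k: "F j k" "addable n E j k"
    using ex_addable[OF E F sub] by blast
  have "k \<noteq> i"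
    using k ij no unfolding growable_def by blast
  note k_obs = addable_is_obstacle[OF E ij(3) k(2) this ij(4)]
  show False
  proof (cases "\<exists>c. E k c")
    case True
    then have "P (j, k)"
      using k by (auto simp: P_def)
    then have "card (obstacles n E j i) \<le> card (obstacles n E k j)"
      using min ij(1) by fastforce
    also have "\<dots> \<le> card (obstacles n E j i - {k})"
      using obstacles_decrease[OF E ij(3) k(2) \<open>k \<noteq> i\<close> ij(4)]
      by (intro card_mono) (auto simp: obstacles_def)
    also have "\<dots> < card (obstacles n E j i)"
      using k_obs by (intro card_Diff1_less) (auto simp: obstacles_def)
    finally show False
      by simp
  next
    case False
    then have "k = 1 \<or> k = n"
      using into_empty[OF k] by blast
    moreover obtain c' where "E j c'" "c' < k \<and> k < i \<or> i < k \<and> k < c'"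
      using k_obs by (auto simp: obstacles_def)
    ultimately show False
      using coc_edge[OF E \<open>E j c'\<close>] addable_range[OF ij(3)] by auto
  qed
qed

section \<open>Graphs with two addable edges at a vertex\<close>

text \<open>Every row changes in at most one place, so each row can be checked separately.\<close>

lemma coconsistent_add_matching:
  assumes E: "coconsistent n E" and M: "\<And>i j. M i j \<Longrightarrow> M j i \<and> addable n E i j"
    and uniq: "\<And>i j k. M i j \<Longrightarrow> M i k \<Longrightarrow> j = k"
  shows "coconsistent n (\<lambda>i j. E i j \<or> M i j)"
proof -
  have row: "(\<forall>x. M i x \<longleftrightarrow> x = j) \<and> addable n E i j" if "M i j" for i j
    using that M uniq by blast
  have "E i d \<or> M i d"
    if "c < d" "d < e" "d \<noteq> i" "E i c \<or> M i c" "E i e \<or> M i e" for i c d e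
  proof (cases "\<exists>j. M i j")
    case True
    then obtain j where j: "\<And>x. M i x \<longleftrightarrow> x = j" "addable n E i j"
      using row by blast
    then show ?thesis
      using that addable_row(1)[OF E j(2) that(1,2)] by simp
  qed (use that coc_in[OF E _ _ that(1-3)] in blast)
  moreover have "(E i c \<or> M i c) \<or> (E i e \<or> M i e)"
    if "1 \<le> c" "c < d" "d < e" "e \<le> n" "c \<noteq> i" "e \<noteq> i" "E i d \<or> M i d" for i c d e
  proof (cases "\<exists>j. M i j")
    case True
    then obtain j where j: "\<And>x. M i x \<longleftrightarrow> x = j" "addable n E i j"
      using row by blast
    then show ?thesis
      using that addable_row(2)[OF E j(2) that(2,3)] by auto
  qed (use that coc_out[OF E _ that(2,3,5,6,1,4)] in blast)
  moreover have "(E j i \<or> M j i) \<and> i \<noteq> j \<and> 1 \<le> i \<and> i \<le> n" if "E i j \<or> M i j" for i j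
    using that M coc_edge[OF E] addable_ne addable_range by metis
  ultimately show ?thesis
    unfolding coconsistent_def by blast
qed

text \<open>If a segment can be extended by two different elements, it is empty, and these are the first and
  the last one.\<close>

lemma two_addable_in_row:
  assumes E: "coconsistent n E" and j: "addable n E i j" and k: "addable n E i k" and jk: "j < k"
  shows "\<not> E i x" "1 \<le> x \<Longrightarrow> x \<le> n \<Longrightarrow> x \<noteq> i \<Longrightarrow> j \<le> x \<and> x \<le> k"
proof -
  note r = addable_range[OF j] addable_ne[OF j] addable_range[OF k] addable_ne[OF k]
  have 1: "\<not> x < j" if x: "1 \<le> x" "x \<noteq> i" for x
    using addable_mid[OF j, of x k] addable_down[OF k, of x j] jk x r by auto
  have 2: "\<not> k < x" if x: "x \<le> n" "x \<noteq> i" for x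
    using addable_mid[OF k, of j x] addable_up[OF j, of x k] jk x r by auto
  show range: "1 \<le> x \<Longrightarrow> x \<le> n \<Longrightarrow> x \<noteq> i \<Longrightarrow> j \<le> x \<and> x \<le> k" for x
    using 1 2 by (meson not_le)
  show "\<not> E i x" for x
  proof
    assume x: "E i x"
    note e = coc_edge[OF E x]
    have "j < x" "x < k"
      using range[of x] e x r by (metis le_neq_implies_less)+
    then show False
      using coc_out[OF E x, of j k] r by auto
  qed
qed

definition same_side :: "nat \<Rightarrow> nat \<Rightarrow> nat \<Rightarrow> nat \<Rightarrow> bool" where
  "same_side n i a b \<longleftrightarrow> a \<noteq> b \<and> a \<in> {1..n} - {i} \<and> b \<in> {1..n} - {i} \<and> (a < i \<longleftrightarrow> b < i)"

definition opposite_sides :: "nat \<Rightarrow> nat \<Rightarrow> nat \<Rightarrow> nat \<Rightarrow> bool" where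
  "opposite_sides n i a b \<longleftrightarrow> a \<in> {1..n} - {i} \<and> b \<in> {1..n} - {i} \<and> (a < i \<longleftrightarrow> i < b)"

text \<open>One of the two forms that a graph takes if two edges can be added at \<open>i\<close>. The edges at \<open>1\<close> and \<open>n\<close> fix the
  direction of every segment in all larger graphs.\<close>

definition cliques_at :: "nat \<Rightarrow> (nat \<Rightarrow> nat \<Rightarrow> bool) \<Rightarrow> nat \<Rightarrow> bool" where
  "cliques_at n E i \<longleftrightarrow> (\<forall>a. 1 < a \<and> a < i \<longrightarrow> E a 1 \<and> E 1 a) \<and> (\<forall>b. i < b \<and> b < n \<longrightarrow> E b n \<and> E n b) \<and>
     (\<forall>a b. E a b \<longrightarrow> same_side n i a b)"

text \<open>The other form, with the opposite orientation of the line \<open>i\<close>.\<close>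

definition bipartite_at :: "nat \<Rightarrow> (nat \<Rightarrow> nat \<Rightarrow> bool) \<Rightarrow> nat \<Rightarrow> bool" where
  "bipartite_at n E i \<longleftrightarrow>
     (\<forall>a b. 1 \<le> a \<and> a < i \<and> i < b \<and> b \<le> n \<longrightarrow> E a n \<and> E b 1) \<and>
     (\<forall>a b. E a b \<longrightarrow> opposite_sides n i a b)"

text \<open>Two addable edges at the vertex \<open>i\<close>: the new line can be moved across the first and across the last
  vertex on the line \<open>i\<close>.\<close>

definition pencil_at :: "nat \<Rightarrow> (nat \<Rightarrow> nat \<Rightarrow> bool) \<Rightarrow> nat \<Rightarrow> nat \<Rightarrow> nat \<Rightarrow> bool" where
  "pencil_at n E i j k \<longleftrightarrow> addable n E i j \<and> addable n E j i \<and> addable n E i k \<and> addable n E k i \<and> j < k"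

text \<open>The pairs on opposite sides of \<open>i\<close> are the vertices on the negative side of the line \<open>i\<close> itself; with the
  opposite orientation, they are the pairs on the same side of \<open>i\<close>. The graph \<open>E\<close> lies below one of
  these two. The bit is the adjacency of \<open>1\<close> and \<open>n\<close> if \<open>1 < i < n\<close>, and of the first and the last of the other vertices
  if \<open>i\<close> is \<open>1\<close> or \<open>n\<close>.\<close>

lemma pencil_cases:
  assumes n: "n \<ge> 4" and E: "coconsistent n E" and p: "pencil_at n E i j k"
  shows "cliques_at n E i \<or> bipartite_at n E i"
proof -
  have j: "addable n E i j" "addable n E j i" and k: "addable n E i k" "addable n E k i" and jk: "j < k"
    using p by (simp_all add: pencil_at_def)
  note r = addable_range[OF j(1)] addable_ne[OF j(1)] addable_range[OF k(1)] addable_ne[OF k(1)]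
  note row = two_addable_in_row[OF E j(1) k(1) jk]
  have sym: "E a b \<longleftrightarrow> E b a" for a b
    using coc_sym[OF E] by blast
  have rng: "1 \<le> a \<and> a \<le> n \<and> 1 \<le> b \<and> b \<le> n \<and> a \<noteq> b \<and> a \<noteq> i \<and> b \<noteq> i" if "E a b" for a b
    using coc_edge[OF E that] row(1) that sym by metis
  have col: "\<not> E a i" for a
    using row(1) sym by blast
  consider "i = 1" | "i = n" | "1 < i" "i < n"
    using r by linarith
  then show ?thesis
  proof cases
    case 3
    have "j = 1" "k = n"
      using row(2)[of 1] row(2)[of n] 3 r by auto
    note j = j[unfolded \<open>j = 1\<close>] and k = k[unfolded \<open>k = n\<close>]
    show ?thesis
    proof (cases "E 1 n")
      case False
      have low: "E 1 a" if "1 < a" "a < i" for a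
        using addable_mid[OF j(2), of a n] False that 3 by auto
      have up: "E n b" if "i < b" "b < n" for b
        using addable_mid[OF k(2), of 1 b] False that 3 sym by auto
      have cross: "\<not> E a b" if "a < i" "i < b" for a b
      proof
        assume ab: "E a b"
        show False
        proof (cases "a = 1")
          case True
          then have "E b n" "E b 1"
            using up[of b] sym ab False rng[OF ab] that by (metis le_neq_implies_less)+
          then show False
            using coc_in[OF E, of b 1 n i] col 3 that by auto
        next
          case False
          then have "E a 1"
            using low[of a] rng[OF ab] sym that by auto
          then show False
            using coc_in[OF E _ ab, of 1 i] col 3 that by auto
        qed
      qed
      have "same_side n i a b" if "E a b" for a b
        using cross[of a b] cross[of b a] that sym[of a b] rng[OF that]
        by (simp add: same_side_def) (metis linorder_neqE_nat)
      then show ?thesis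
        using low up sym by (auto simp: cliques_at_def)
    next
      case True
      have nb: "E a n" if "1 \<le> a" "a < i" for a
        using addable_down[OF k(2), of 1 a] True sym that 3 by (cases "a = 1") auto
      have b1: "E b 1" if "i < b" "b \<le> n" for b
        using addable_up[OF j(2) True, of b] True sym that 3 by (cases "b = n") auto
      have "opposite_sides n i a b" if ab: "E a b" for a b
      proof -
        have False if "a < i" "b < i"
          using coc_in[OF E ab nb[of a], of i] that 3 col rng[OF ab] by auto
        moreover have False if "i < a" "i < b"
          using coc_in[OF E b1[of a] ab, of i] that 3 col rng[OF ab] by auto
        ultimately show ?thesis
          using rng[OF ab] unfolding opposite_sides_def by fastforce
      qed
      then show ?thesis
        using nb b1 by (auto simp: bipartite_at_def)
    qed
  next
    case 1
    have "j = 2" "k = n"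
      using row(2)[of 2] row(2)[of n] 1 r n by auto
    note j = j[unfolded \<open>j = 2\<close>] and k = k[unfolded \<open>k = n\<close>]
    show ?thesis
    proof (cases "E 2 n")
      case True
      have "E n b" if "1 < b" "b < n" for b
        using coc_out[OF E coc_sym[OF E True], of 1 b] col[of n] 1 True sym that n
        by (cases "b = 2") auto
      then show ?thesis
        using 1 rng sym by (auto simp: cliques_at_def same_side_def)
    next
      case False
      have 2: "\<not> E 2 y" for y
      proof
        assume y: "E 2 y"
        then have "y \<noteq> 1" "y \<noteq> n"
          using False col[of 2] 1 by metis+
        then show False
          using coc_out[OF E y, of 1 n] False col[of 2] 1 rng[OF y] n by auto
      qed
      have n': "\<not> E n y" for y
        using addable_up[OF k(2), of y 2] sym[of n 2] 2[of n] 1 rng[of n y] n sym[of y 2] 2[of y]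
        by (cases "y = 2") auto
      have "\<not> E a y" for a y
        using coc_out[OF E, of a y 1 n] col[of a] 1 rng[of a y] n'[of a] sym[of a n] n'[of y] sym[of a y]
        by (cases "a = n"; cases "y = n") auto
      then show ?thesis
        using 1 by (auto simp: bipartite_at_def)
    qed
  next
    case 2
    have n1: "1 \<noteq> n - 1" "n - 1 \<noteq> n" "1 \<le> n - 1" "n - 1 \<le> n" "1 \<noteq> n"
      using n by auto
    have "j \<le> 1" "n - 1 \<le> k" "k \<noteq> n" "j \<noteq> i" "1 \<le> j" "k \<le> n"
      using row(2)[of 1] row(2)[of "n - 1"] 2 r n1 by auto
    then have "j = 1" "k = n - 1"
      by linarith+
    note j = j[unfolded \<open>j = 1\<close>] and k = k[unfolded \<open>k = n - 1\<close>]
    show ?thesis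
    proof (cases "E 1 (n - 1)")
      case True
      have "E 1 a" if "1 < a" "a < n" for a
        using coc_out[OF E True, of a n] col[of 1] 2 True that n1
        by (cases "a = n - 1") auto
      then show ?thesis
        using 2 rng sym by (fastforce simp: cliques_at_def same_side_def)
    next
      case False
      have 1: "\<not> E 1 y" for y
      proof
        assume y: "E 1 y"
        then have "y \<noteq> n - 1" "y \<noteq> n"
          using False col[of 1] 2 by metis+
        moreover have "y < n - 1"
          using rng[OF y] calculation by linarith
        ultimately show False
          using addable_down[OF j(2) y, of "n - 1"] 2 n1 False by auto
      qed
      have "\<not> E a y" for a y
        using coc_out[OF E, of a y 1 n] col[of a] 2 rng[of a y] 1[of a] sym[of a 1] 1[of y] sym[of a y]
        by (cases "a = 1"; cases "y = 1") auto
      then show ?thesis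
        using 2 by (auto simp: bipartite_at_def)
    qed
  qed
qed

text \<open>The vertices on the negative side of a copy of the line \<open>i\<close>, in the orientation that fits \<open>E\<close>.\<close>

definition pencil_core :: "nat \<Rightarrow> (nat \<Rightarrow> nat \<Rightarrow> bool) \<Rightarrow> nat \<Rightarrow> nat \<Rightarrow> nat \<Rightarrow> bool" where
  "pencil_core n E i = (if cliques_at n E i then same_side n i else opposite_sides n i)"

definition star :: "nat \<Rightarrow> nat \<Rightarrow> nat \<Rightarrow> nat \<Rightarrow> bool" where
  "star n i a b \<longleftrightarrow> a \<noteq> b \<and> a \<in> {1..n} \<and> b \<in> {1..n} \<and> (a = i \<or> b = i)"

text \<open>In the row of a vertex below \<open>i\<close>, the added part is a beginning segment. If it is not empty, the
  hypotheses put the first element into the row, which therefore is a beginning segment, too. Above \<open>i\<close>, there are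
  ending segments. The hypotheses hold for every graph that contains a graph with \<open>cliques_at\<close>.\<close>

lemma coconsistent_union_same_side:
  assumes X: "coconsistent n X" and i: "1 \<le> i" "i \<le> n"
    and low: "\<And>a. 1 < a \<Longrightarrow> a < i \<Longrightarrow> X a 1 \<and> X 1 a"
    and up: "\<And>b. i < b \<Longrightarrow> b < n \<Longrightarrow> X b n \<and> X n b"
  shows "coconsistent n (\<lambda>a b. X a b \<or> same_side n i a b)" (is "coconsistent n ?R")
proof -
  have row: "same_side n i a x \<longleftrightarrow> a \<noteq> i \<and> (if a < i then 1 \<le> x \<and> x < i else i < x \<and> x \<le> n) \<and> x \<noteq> a"
    if "1 \<le> a" "a \<le> n" for a x
    using that i by (auto simp: same_side_def)
  \<comment> \<open>If the row of \<open>a\<close> gains anything, it contains an element on the side of \<open>a\<close>.\<close>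
  have anchor: "\<exists>z. X a z \<and> z < i \<and> z < d" if "1 \<le> a" "a < i" "1 \<le> c" "c < i" "c \<noteq> a" "i \<le> d" for a c d
    using low[of a] low[of c] that by (cases "a = 1") (auto intro: exI[of _ 1] exI[of _ c])
  have anchor': "\<exists>z. X a z \<and> i < z \<and> d < z" if "a \<le> n" "i < a" "e \<le> n" "i < e" "e \<noteq> a" "d \<le> i" for a e d
    using up[of a] up[of e] that by (cases "a = n") (auto intro: exI[of _ n] exI[of _ e])
  have "?R a d" if "c < d" "d < e" "d \<noteq> a" "?R a c" "?R a e" for a c d e
  proof -
    have a: "1 \<le> a" "a \<le> n" "1 \<le> c" "e \<le> n"
      using that coc_edge[OF X, of a c] coc_edge[OF X, of a e] by (auto simp: same_side_def)
    consider "a < i" "d < i" | "a < i" "i \<le> d" | "i < a" "d \<le> i" | "i < a" "i < d" | "a = i"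
      by linarith
    then show ?thesis
    proof cases
      case 2
      then have e: "X a e"
        using that row[OF a(1,2)] by auto
      have "\<exists>z. X a z \<and> z < d"
        using that 2 a row[OF a(1,2)] anchor[of a c d] by auto
      then show ?thesis
        using coc_in[OF X _ e] that by blast
    next
      case 3
      then have c: "X a c"
        using that row[OF a(1,2)] by auto
      have "\<exists>z. X a z \<and> d < z"
        using that 3 a row[OF a(1,2)] anchor'[of a e d] by auto
      then show ?thesis
        using coc_in[OF X c] that by blast
    next
      case 5
      then show ?thesis
        using that coc_in[OF X _ _ that(1-3)] row[OF a(1,2)] by auto
    qed (use that row[OF a(1,2)] a in auto)
  qed
  moreover have "?R a c \<or> ?R a e"
    if "1 \<le> c" "c < d" "d < e" "e \<le> n" "c \<noteq> a" "e \<noteq> a" "?R a d" for a c d e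
  proof -
    have a: "1 \<le> a" "a \<le> n"
      using that coc_edge[OF X, of a d] by (auto simp: same_side_def)
    consider "a < i" "c < i" | "a < i" "i \<le> c" | "i < a" "e \<le> i" | "i < a" "i < e" | "a = i"
      by linarith
    then show ?thesis
    proof cases
      case 2
      then have d: "X a d"
        using that row[OF a] by auto
      then show ?thesis
        using coc_out[OF X d that(2,3,5,6,1,4)] by blast
    next
      case 3
      then have d: "X a d"
        using that row[OF a] by auto
      then show ?thesis
        using coc_out[OF X d that(2,3,5,6,1,4)] by blast
    next
      case 5
      then show ?thesis
        using coc_out[OF X _ that(2,3,5,6,1,4)] that(7) row[OF a] by auto
    qed (use that row[OF a] in auto)
  qed
  moreover have "?R b a \<and> a \<noteq> b \<and> 1 \<le> a \<and> a \<le> n" if "?R a b" for a b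
    using that coc_edge[OF X, of a b] by (auto simp: same_side_def)
  ultimately show ?thesis
    unfolding coconsistent_def by blast
qed

text \<open>A vertex below \<open>i\<close> is joined to \<open>n\<close>, so that its row is an ending segment, and the added part is the
  ending segment above \<open>i\<close>. For vertices above \<open>i\<close>, both are beginning segments.\<close>

lemma coconsistent_union_opposite_sides:
  assumes X: "coconsistent n X" and "1 \<le> i" "i \<le> n"
    and ab: "\<And>a b. 1 \<le> a \<Longrightarrow> a < i \<Longrightarrow> i < b \<Longrightarrow> b \<le> n \<Longrightarrow> X a n \<and> X b 1"
  shows "coconsistent n (\<lambda>a b. X a b \<or> opposite_sides n i a b)" (is "coconsistent n ?R")
proof -
  have row: "opposite_sides n i a x \<longleftrightarrow> (if a < i then i < x \<and> x \<le> n else i < a \<and> 1 \<le> x \<and> x < i)"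
    if "1 \<le> a" "a \<le> n" for a x
    using that assms(2,3) by (auto simp: opposite_sides_def)
  have "?R a d" if "c < d" "d < e" "d \<noteq> a" "?R a c" "?R a e" for a c d e
  proof -
    have a: "1 \<le> a" "a \<le> n" "1 \<le> c" "e \<le> n"
      using that coc_edge[OF X, of a c] coc_edge[OF X, of a e] by (auto simp: opposite_sides_def)
    consider "a < i" "d \<le> i" | "a < i" "i < d" | "i \<le> a" "d < i" | "i \<le> a" "i \<le> d"
      by linarith
    then show ?thesis
    proof cases
      case 1
      then have "X a c"
        using that row[OF a(1,2)] by auto
      moreover have "X a n \<or> X a e"
        using that 1 a ab[of a e] row[OF a(1,2)] by auto
      ultimately show ?thesis
        using coc_in[OF X, of a c n d] coc_in[OF X, of a c e d] that a by auto
    next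
      case 4
      then have "X a e"
        using that row[OF a(1,2)] by auto
      moreover have "X a 1 \<or> X a c"
        using that 4 a ab[of c a] row[OF a(1,2)] by auto
      ultimately show ?thesis
        using coc_in[OF X, of a 1 e d] coc_in[OF X, of a c e d] that a by auto
    next
      case 3
      then show ?thesis
        using that coc_in[OF X _ _ that(1-3)] row[OF a(1,2)] a by (cases "a = i") auto
    qed (use that row[OF a(1,2)] a in auto)
  qed
  moreover have "?R a c \<or> ?R a e"
    if "1 \<le> c" "c < d" "d < e" "e \<le> n" "c \<noteq> a" "e \<noteq> a" "?R a d" for a c d e
  proof -
    have a: "1 \<le> a" "a \<le> n"
      using that coc_edge[OF X, of a d] by (auto simp: opposite_sides_def)
    consider "a < i" "e \<le> i" | "a < i" "i < e" | "i < a" "c < i" | "i < a" "i \<le> c" | "a = i"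
      by linarith
    then show ?thesis
    proof cases
      case 1
      then have d: "X a d"
        using that row[OF a] by auto
      show ?thesis
      proof (cases "i < n")
        case True
        then have "X a n"
          using ab[of a n] 1 a by auto
        then show ?thesis
          using coc_in[OF X d, of n e] that 1 True by auto
      next
        case False
        then show ?thesis
          using coc_out[OF X d that(2,3,5,6,1,4)] by blast
      qed
    next
      case 4
      then have d: "X a d"
        using that row[OF a] by auto
      show ?thesis
      proof (cases "1 < i")
        case True
        then have "X a 1"
          using ab[of 1 a] 4 a by auto
        then show ?thesis
          using coc_in[OF X _ d, of 1 c] that 4 True by auto
      next
        case False
        then show ?thesis
          using coc_out[OF X d that(2,3,5,6,1,4)] by blast
      qed
    next
      case 5
      then show ?thesis
        using coc_out[OF X _ that(2,3,5,6,1,4)] that(7) row[OF a] by auto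
    qed (use that row[OF a] in auto)
  qed
  moreover have "?R b a \<and> a \<noteq> b \<and> 1 \<le> a \<and> a \<le> n" if "?R a b" for a b
    using that coc_edge[OF X, of a b] by (auto simp: opposite_sides_def)
  ultimately show ?thesis
    unfolding coconsistent_def by blast
qed

lemma pencil_core_le:
  assumes n: "n \<ge> 4" and E: "coconsistent n E" and p: "pencil_at n E i j k" and "E a b"
  shows "pencil_core n E i a b"
  using pencil_cases[OF n E p] assms(4)
  by (auto simp: pencil_core_def cliques_at_def bipartite_at_def)

lemma coconsistent_union_pencil_core:
  assumes n: "n \<ge> 4" and E: "coconsistent n E" and p: "pencil_at n E i j k"
    and X: "coconsistent n X" and sub: "\<And>a b. E a b \<Longrightarrow> X a b"
  shows "coconsistent n (\<lambda>a b. X a b \<or> pencil_core n E i a b)"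
proof (cases "cliques_at n E i")
  case True
  moreover have "1 \<le> i" "i \<le> n"
    using p addable_range by (auto simp: pencil_at_def)
  ultimately show ?thesis
    using sub by (auto simp: pencil_core_def cliques_at_def intro!: coconsistent_union_same_side[OF X])
next
  case False
  then have "bipartite_at n E i"
    using pencil_cases[OF n E p] by blast
  moreover have "1 \<le> i" "i \<le> n"
    using p addable_range by (auto simp: pencil_at_def)
  ultimately show ?thesis
    using False sub
    by (auto simp: pencil_core_def bipartite_at_def intro!: coconsistent_union_opposite_sides[OF X])
qed

lemma pencil_row:
  assumes E: "coconsistent n E" and p: "pencil_at n E i j k"
    and X: "coconsistent n X" and jk: "X i j" "X i k"
    and x: "1 \<le> x" "x \<le> n" "x \<noteq> i"
  shows "X i x" "X x i"
proof -
  have "j \<le> x" "x \<le> k"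
    using two_addable_in_row(2)[OF E _ _ _ x] p by (auto simp: pencil_at_def)
  then show "X i x"
    using coc_in[OF X jk, of x] x jk by (metis le_neq_implies_less)
  then show "X x i"
    by (rule coc_sym[OF X])
qed

text \<open>The row of \<open>i\<close> in \<open>X\<close> contains its first and its last element, so it is full. The row of any \<open>a\<close> then contains
  \<open>i\<close> and an extreme vertex, hence everything between.\<close>

lemma pencil_core_forced:
  assumes n: "n \<ge> 4" and E: "coconsistent n E" and p: "pencil_at n E i j k"
    and X: "coconsistent n X" and sub: "\<And>a b. E a b \<Longrightarrow> X a b" and jk: "X i j" "X i k"
    and ab: "pencil_core n E i a b"
  shows "X a b"
proof -
  have i: "i \<le> n"
    using p addable_range by (auto simp: pencil_at_def)
  have row: "X x i" if "1 \<le> x" "x \<le> n" "x \<noteq> i" for x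
    using pencil_row(2)[OF E p X jk that] .
  show ?thesis
  proof (cases "cliques_at n E i")
    case True
    then have ab': "same_side n i a b"
      using ab by (simp add: pencil_core_def)
    note T = True[unfolded cliques_at_def]
    show ?thesis
    proof (cases "a < i")
      case True
      then have "1 \<le> a" "1 \<le> b" "b < i" "a \<noteq> b" "i \<le> n" "X a i"
        using ab' row[of a] i by (auto simp: same_side_def)
      then show ?thesis
        using coc_in[OF X, of a 1 i b] T sub True by (cases "a = 1"; cases "b = 1") auto
    next
      case False
      then have "i < a" "i < b" "b \<le> n" "a \<le> n" "a \<noteq> b" "X a i"
        using ab' row[of a] by (auto simp: same_side_def)
      then show ?thesis
        using coc_in[OF X, of a i n b] T sub by (cases "a = n"; cases "b = n") auto
    qed
  next
    case False
    then have B: "bipartite_at n E i"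
      using pencil_cases[OF n E p] by blast
    have ab': "opposite_sides n i a b"
      using ab False by (simp add: pencil_core_def)
    show ?thesis
    proof (cases "a < i")
      case True
      then have *: "1 \<le> a" "i < b" "b \<le> n" "X a i"
        using ab' row[of a] by (auto simp: opposite_sides_def)
      then have "X a n"
        using B sub True by (auto simp: bipartite_at_def)
      then show ?thesis
        using coc_in[OF X, of a i n b] * True by (cases "b = n") auto
    next
      case False
      then have *: "i < a" "a \<le> n" "b < i" "1 \<le> b" "X a i"
        using ab' row[of a] by (auto simp: opposite_sides_def)
      then have "X a 1"
        using B sub by (auto simp: bipartite_at_def)
      then show ?thesis
        using coc_in[OF X, of a 1 i b] * by (cases "b = 1") auto
    qed
  qed
qed

text \<open>In the row of \<open>a\<close>, the core consists of all elements on one side of \<open>i\<close>, so that \<open>i\<close> is the next one.\<close>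

lemma addable_pencil_core:
  assumes n: "n \<ge> 4" and E: "coconsistent n E" and p: "pencil_at n E i j k"
    and core: "\<And>a b. pencil_core n E i a b \<Longrightarrow> E a b"
    and a: "1 \<le> a" "a \<le> n" "a \<noteq> i"
  shows "addable n E a i"
proof -
  have i: "1 \<le> i" "i \<le> n"
    using p addable_range by (auto simp: pencil_at_def)
  have row: "(if cliques_at n E i then same_side n i a x else opposite_sides n i a x) \<longleftrightarrow> E a x" for x
    using core[of a x] pencil_core_le[OF n E p, of a x] by (auto simp: pencil_core_def)
  show ?thesis
  proof (cases "cliques_at n E i")
    case True
    then have "E a x \<longleftrightarrow> same_side n i a x" for x
      using row by simp
    then show ?thesis
      using a i by (auto simp: addable_def same_side_def)
  next
    case False
    then have "E a x \<longleftrightarrow> opposite_sides n i a x" for x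
      using row by simp
    then show ?thesis
      using a i by (auto simp: addable_def opposite_sides_def)
  qed
qed

text \<open>An edge that avoids \<open>i\<close> and is not in the core would leave a gap at \<open>i\<close> in the row of one of its ends, unless
  that row is empty. For \<open>n \<ge> 4\<close>, this leaves only the edges \<open>12\<close> and \<open>(n - 1)n\<close> over the empty graph.\<close>

lemma addable_at_pencil_core:
  assumes n: "n \<ge> 4" and E: "coconsistent n E" and p: "pencil_at n E i j k"
    and core: "\<And>a b. pencil_core n E i a b \<Longrightarrow> E a b"
    and ab: "addable n E a b" "addable n E b a" "a \<noteq> i" "b \<noteq> i" "a < b"
  shows "(\<forall>x y. \<not> E x y) \<and> (i = n \<and> a = 1 \<and> b = 2 \<or> i = 1 \<and> a = n - 1 \<and> b = n)"
proof -
  have i: "1 \<le> i" "i \<le> n"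
    using p addable_range by (auto simp: pencil_at_def)
  note r = addable_range[OF ab(1)] addable_ne[OF ab(1)]
  have col: "\<not> E x i" "\<not> E i x" for x
    using two_addable_in_row(1)[OF E] p coc_sym[OF E] unfolding pencil_at_def by metis+
  show ?thesis
  proof (cases "cliques_at n E i")
    case True
    then have row: "E x y \<longleftrightarrow> same_side n i x y" for x y
      using core[of x y] pencil_core_le[OF n E p, of x y] by (auto simp: pencil_core_def)
    have "a < i" "i < b"
      using row[of a b] r ab by (auto simp: same_side_def)
    have "c = a" if "1 \<le> c" "c < i" for c
      using addable_down[OF ab(1), of c i] row[of a c] col \<open>a < i\<close> \<open>i < b\<close> that r i by (auto simp: same_side_def)
    from this[of 1] this[of 2] have "i = 2"
      using \<open>a < i\<close> r by (cases "2 < i") auto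
    have "e = b" if "i < e" "e \<le> n" for e
      using addable_up[OF ab(2), of e i] row[of b e] col \<open>a < i\<close> \<open>i < b\<close> that r i by (auto simp: same_side_def)
    from this[of 3] this[of 4] show ?thesis
      using \<open>i = 2\<close> n by simp
  next
    case False
    then have row: "E x y \<longleftrightarrow> opposite_sides n i x y" for x y
      using core[of x y] pencil_core_le[OF n E p, of x y] by (auto simp: pencil_core_def)
    consider "b < i" | "i < a"
      using row[of a b] r ab by (auto simp: opposite_sides_def)
    then show ?thesis
    proof cases
      case 1
      have "i = n"
      proof (rule ccontr)
        assume "i \<noteq> n"
        then show False
          using addable_up[OF ab(1), of n i] row[of a n] col 1 ab(5) r i by (auto simp: opposite_sides_def)
      qed
      then have empty: "\<not> E x y" for x y
        using row[of x y] by (auto simp: opposite_sides_def)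
      have "c = a" if "1 \<le> c" "c < b" for c
        using addable_mid[OF ab(1), of c n] empty that 1 ab(5) \<open>i = n\<close> by auto
      from this[of 1] this[of 2] have "a = 1 \<and> b = 2"
        using r ab(5) by (cases "b = 2") auto
      then show ?thesis
        using \<open>i = n\<close> empty by blast
    next
      case 2
      have "i = 1"
      proof (rule ccontr)
        assume "i \<noteq> 1"
        then show False
          using addable_down[OF ab(2), of 1 i] row[of b 1] col 2 ab(5) r i by (auto simp: opposite_sides_def)
      qed
      then have empty: "\<not> E x y" for x y
        using row[of x y] by (auto simp: opposite_sides_def)
      have "e = b" if "a < e" "e \<le> n" for e
        using addable_mid[OF ab(2), of 1 e] empty that 2 ab(5) \<open>i = 1\<close> by auto
      from this[of n] this[of "n - 1"] have "a = n - 1 \<and> b = n"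
        using r ab(5) by (cases "a = n - 1") auto
      then show ?thesis
        using \<open>i = 1\<close> empty by blast
    qed
  qed
qed

section \<open>Consistent sets as coconsistent graphs\<close>

text \<open>A subset of a list is a beginning or an ending segment if and only if its indicator function changes at
  most once, which is a condition on triples of positions.\<close>

lemma segment_of_list_iff:
  assumes "distinct xs"
  shows "(\<exists>m. A \<inter> set xs = set (take m xs) \<or> A \<inter> set xs = set (drop m xs)) \<longleftrightarrow>
    (\<forall>a b c. a < b \<and> b < c \<and> c < length xs \<longrightarrow>
       (xs ! a \<in> A \<and> xs ! c \<in> A \<longrightarrow> xs ! b \<in> A) \<and> (xs ! b \<in> A \<longrightarrow> xs ! a \<in> A \<or> xs ! c \<in> A))"
    (is "?L \<longleftrightarrow> ?R")
proof -
  define p where "p = (\<lambda>k. xs ! k \<in> A)"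
  have in_take: "xs ! k \<in> set (take m xs) \<longleftrightarrow> k < m" if "k < length xs" for k m
    using that assms by (auto simp: in_set_conv_nth nth_eq_iff_index_eq)
  have in_drop: "xs ! k \<in> set (drop m xs) \<longleftrightarrow> m \<le> k" if "k < length xs" for k m
  proof -
    have "xs ! k \<in> set (take m xs) \<or> xs ! k \<in> set (drop m xs)"
      using that by (metis Un_iff append_take_drop_id nth_mem set_append)
    moreover have "set (take m xs) \<inter> set (drop m xs) = {}"
      using assms by (rule set_take_disj_set_drop_if_distinct) simp
    ultimately show ?thesis
      using in_take[OF that, of m] by (auto simp: not_less)
  qed
  have inter_iff: "A \<inter> set xs = B \<longleftrightarrow> (\<forall>k<length xs. p k \<longleftrightarrow> xs ! k \<in> B)" if "B \<subseteq> set xs" for B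
  proof -
    have "A \<inter> set xs = B \<longleftrightarrow> (\<forall>x\<in>set xs. x \<in> A \<longleftrightarrow> x \<in> B)"
      using that by blast
    then show ?thesis
      by (simp add: all_set_conv_all_nth p_def)
  qed
  have take_iff: "A \<inter> set xs = set (take m xs) \<longleftrightarrow> (\<forall>k<length xs. p k \<longleftrightarrow> k < m)" for m
    using inter_iff[OF set_take_subset] in_take by simp
  have drop_iff: "A \<inter> set xs = set (drop m xs) \<longleftrightarrow> (\<forall>k<length xs. p k \<longleftrightarrow> m \<le> k)" for m
    using inter_iff[OF set_drop_subset] in_drop by simp
  have "?L \<longleftrightarrow> (\<exists>m. (\<forall>k<length xs. p k \<longleftrightarrow> k < m) \<or> (\<forall>k<length xs. p k \<longleftrightarrow> m \<le> k))"
    by (simp add: take_iff drop_iff)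
  also have "\<dots> \<longleftrightarrow> (\<forall>a b c. a < b \<and> b < c \<and> c < length xs \<longrightarrow>
       (p a \<and> p c \<longrightarrow> p b) \<and> (p b \<longrightarrow> p a \<or> p c))" (is "_ \<longleftrightarrow> ?Q")
  proof
    assume ?Q
    then have Q1: "p b" if "a < b" "b < c" "c < length xs" "p a" "p c" for a b c
      using that by blast
    have Q2: "p a \<or> p c" if "a < b" "b < c" "c < length xs" "p b" for a b c
      using \<open>?Q\<close> that by blast
    show "\<exists>m. (\<forall>k<length xs. p k \<longleftrightarrow> k < m) \<or> (\<forall>k<length xs. p k \<longleftrightarrow> m \<le> k)"
    proof (cases "p 0")
      case True
      define m where "m = (LEAST k. length xs \<le> k \<or> \<not> p k)"
      have m: "length xs \<le> m \<or> \<not> p m"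
        unfolding m_def by (rule LeastI[of _ "length xs"]) simp
      have below: "p k" if "k < m" for k
        using not_less_Least that unfolding m_def by blast
      have "\<not> p k" if "m \<le> k" "k < length xs" for k
      proof
        assume "p k"
        then have "m < k" "\<not> p m" "0 < m"
          using m that True by (metis le_neq_implies_less le_trans not_less gr0I)+
        then show False
          using Q1[of 0 m k] True \<open>p k\<close> that by blast
      qed
      then have "\<forall>k<length xs. p k \<longleftrightarrow> k < m"
        using below by (meson not_less)
      then show ?thesis
        by blast
    next
      case False
      define m where "m = (LEAST k. length xs \<le> k \<or> p k)"
      have m: "length xs \<le> m \<or> p m"
        unfolding m_def by (rule LeastI[of _ "length xs"]) simp
      have below: "\<not> p k" if "k < m" for k
        using not_less_Least that unfolding m_def by blast
      have "p k" if "m \<le> k" "k < length xs" for k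
      proof (rule ccontr)
        assume "\<not> p k"
        then have "m < k" "p m" "0 < m"
          using m that False by (metis le_neq_implies_less le_trans not_less gr0I)+
        then show False
          using Q2[of 0 m k] False \<open>\<not> p k\<close> that by blast
      qed
      then have "\<forall>k<length xs. p k \<longleftrightarrow> m \<le> k"
        using below by (meson not_less)
      then show ?thesis
        by blast
    qed
  qed auto
  finally show ?thesis
    by (simp add: p_def)
qed

definition graph_of :: "nat \<Rightarrow> nat set set \<Rightarrow> nat \<Rightarrow> nat \<Rightarrow> bool" where
  "graph_of n I i j \<longleftrightarrow> i \<noteq> j \<and> i \<in> {1..n} \<and> j \<in> {1..n} \<and> {1..n} - {i, j} \<in> I"

text \<open>The packet lists the sets \<open>K - {k}\<close> by decreasing \<open>k\<close>. Reversal of the order preserves the condition on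
  triples.\<close>

lemma graph_of_row:
  assumes "i \<in> {1..n}"
  shows "(\<exists>m. I \<inter> set (packet ({1..n} - {i})) = set (take m (packet ({1..n} - {i}))) \<or>
        I \<inter> set (packet ({1..n} - {i})) = set (drop m (packet ({1..n} - {i})))) \<longleftrightarrow>
    (\<forall>c d e. c < d \<and> d < e \<and> c \<in> {1..n} - {i} \<and> d \<in> {1..n} - {i} \<and> e \<in> {1..n} - {i} \<longrightarrow>
       (graph_of n I i c \<and> graph_of n I i e \<longrightarrow> graph_of n I i d) \<and>
       (graph_of n I i d \<longrightarrow> graph_of n I i c \<or> graph_of n I i e))" (is "?L \<longleftrightarrow> ?R")
proof -
  let ?K = "{1..n} - {i}"
  define xs where "xs = rev (sorted_list_of_set ?K)"
  define ys where "ys = packet ?K"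
  have xs: "distinct xs" "set xs = ?K" "sorted_wrt (>) xs"
    by (auto simp: xs_def sorted_wrt_rev)
  have ys: "ys = map (\<lambda>k. ?K - {k}) xs"
    by (simp add: ys_def packet_def xs_def)
  have len: "length ys = length xs"
    by (simp add: ys)
  have "inj_on (\<lambda>k. ?K - {k}) ?K"
    by (auto simp: inj_on_def)
  then have "distinct ys"
    using xs by (simp add: ys distinct_map)
  have nth: "ys ! a \<in> I \<longleftrightarrow> graph_of n I i (xs ! a)" if "a < length xs" for a
  proof -
    have "xs ! a \<in> ?K"
      using xs(2) that nth_mem by blast
    moreover have "?K - {xs ! a} = {1..n} - {i, xs ! a}"
      by blast
    ultimately show ?thesis
      using that assms by (auto simp: ys graph_of_def)
  qed
  have less: "xs ! b < xs ! a \<longleftrightarrow> a < b" if "a < length xs" "b < length xs" for a b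
    using xs(3) that unfolding sorted_wrt_iff_nth_less by (metis linorder_neqE_nat less_not_sym)
  have "?L \<longleftrightarrow> (\<forall>a b c. a < b \<and> b < c \<and> c < length xs \<longrightarrow>
       (ys ! a \<in> I \<and> ys ! c \<in> I \<longrightarrow> ys ! b \<in> I) \<and> (ys ! b \<in> I \<longrightarrow> ys ! a \<in> I \<or> ys ! c \<in> I))"
    using segment_of_list_iff[OF \<open>distinct ys\<close>, of I] unfolding len unfolding ys_def .
  also have "\<dots> \<longleftrightarrow> ?R"
  proof
    assume L: "\<forall>a b c. a < b \<and> b < c \<and> c < length xs \<longrightarrow>
       (ys ! a \<in> I \<and> ys ! c \<in> I \<longrightarrow> ys ! b \<in> I) \<and> (ys ! b \<in> I \<longrightarrow> ys ! a \<in> I \<or> ys ! c \<in> I)"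
    show ?R
    proof (intro allI impI)
      fix c d e assume cde: "c < d \<and> d < e \<and> c \<in> ?K \<and> d \<in> ?K \<and> e \<in> ?K"
      have "c \<in> set xs" "d \<in> set xs" "e \<in> set xs"
        using cde xs(2) by auto
      then obtain a b k where abk: "a < length xs" "b < length xs" "k < length xs"
          "xs ! a = e" "xs ! b = d" "xs ! k = c"
        unfolding in_set_conv_nth by blast
      then have "a < b" "b < k"
        using less[of a b] less[of b k] cde by auto
      then show "(graph_of n I i c \<and> graph_of n I i e \<longrightarrow> graph_of n I i d) \<and>
          (graph_of n I i d \<longrightarrow> graph_of n I i c \<or> graph_of n I i e)"
        using L nth[OF abk(1)] nth[OF abk(2)] nth[OF abk(3)] abk(3-6) by metis
    qed
  next
    assume R: ?R
    show "\<forall>a b c. a < b \<and> b < c \<and> c < length xs \<longrightarrow>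
       (ys ! a \<in> I \<and> ys ! c \<in> I \<longrightarrow> ys ! b \<in> I) \<and> (ys ! b \<in> I \<longrightarrow> ys ! a \<in> I \<or> ys ! c \<in> I)"
    proof (intro allI impI)
      fix a b c assume abc: "a < b \<and> b < c \<and> c < length xs"
      then have len: "a < length xs" "b < length xs" "c < length xs"
        by auto
      then have "xs ! a \<in> ?K" "xs ! b \<in> ?K" "xs ! c \<in> ?K"
        using xs(2) nth_mem by blast+
      moreover have "xs ! c < xs ! b" "xs ! b < xs ! a"
        using less len abc by blast+
      ultimately show "(ys ! a \<in> I \<and> ys ! c \<in> I \<longrightarrow> ys ! b \<in> I) \<and> (ys ! b \<in> I \<longrightarrow> ys ! a \<in> I \<or> ys ! c \<in> I)"
        using R unfolding nth[OF len(1)] nth[OF len(2)] nth[OF len(3)] by blast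
    qed
  qed
  finally show ?thesis .
qed

lemma graph_of_sym: "graph_of n I i j \<longleftrightarrow> graph_of n I j i"
  by (auto simp: graph_of_def insert_commute)

lemma nsets_co_singleton:
  assumes "1 \<le> n"
  shows "nsets {1..n} (n - 1) = (\<lambda>i. {1..n} - {i}) ` {1..n::nat}"
proof (intro equalityI subsetI)
  fix K assume "K \<in> nsets {1..n} (n - 1)"
  then have K: "K \<subseteq> {1..n}" "card K = n - 1" "finite K"
    by (auto simp: nsets_def)
  then have "card ({1..n} - K) = 1"
    using assms by (simp add: card_Diff_subset)
  then obtain i where "{1..n} - K = {i}"
    by (auto simp: card_1_singleton_iff)
  then have "K = {1..n} - {i}" "i \<in> {1..n}"
    using K(1) by blast+
  then show "K \<in> (\<lambda>i. {1..n} - {i}) ` {1..n}"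
    by blast
qed (auto simp: nsets_def)

lemma nsets_co_pair:
  assumes "3 \<le> n"
  shows "A \<in> nsets {1..n} (n - 2) \<longleftrightarrow> (\<exists>i j. i \<noteq> j \<and> i \<in> {1..n} \<and> j \<in> {1..n} \<and> A = {1..n::nat} - {i, j})"
proof
  assume "A \<in> nsets {1..n} (n - 2)"
  then have A: "A \<subseteq> {1..n}" "card A = n - 2" "finite A"
    by (auto simp: nsets_def)
  then have "card ({1..n} - A) = 2"
    using assms by (simp add: card_Diff_subset)
  then obtain i j where "{1..n} - A = {i, j}" "i \<noteq> j"
    by (auto simp: card_2_iff)
  then show "\<exists>i j. i \<noteq> j \<and> i \<in> {1..n} \<and> j \<in> {1..n} \<and> A = {1..n} - {i, j}"
    using A(1) by blast
qed (auto simp: nsets_def card_Diff_subset)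

lemma higher_bruhat_iff:
  assumes n: "n \<ge> 4"
  shows "I \<in> higher_bruhat n (n - 3) \<longleftrightarrow> I \<subseteq> nsets {1..n} (n - 2) \<and> coconsistent n (graph_of n I)"
proof -
  have d: "n - 3 + 1 = n - 2" "n - 3 + 2 = n - 1"
    using n by auto
  let ?G = "graph_of n I"
  have rng: "i \<noteq> j \<and> i \<in> {1..n} \<and> j \<in> {1..n}" if "?G i j" for i j
    using that by (simp add: graph_of_def)
  have "I \<in> higher_bruhat n (n - 3) \<longleftrightarrow> I \<subseteq> nsets {1..n} (n - 2) \<and>
    (\<forall>i\<in>{1..n}. \<forall>c d e. c < d \<and> d < e \<and> c \<in> {1..n} - {i} \<and> d \<in> {1..n} - {i} \<and> e \<in> {1..n} - {i} \<longrightarrow>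
       (?G i c \<and> ?G i e \<longrightarrow> ?G i d) \<and> (?G i d \<longrightarrow> ?G i c \<or> ?G i e))"
  proof -
    have "I \<in> higher_bruhat n (n - 3) \<longleftrightarrow> I \<subseteq> nsets {1..n} (n - 2) \<and>
      (\<forall>i\<in>{1..n}. \<exists>m. I \<inter> set (packet ({1..n} - {i})) = set (take m (packet ({1..n} - {i}))) \<or>
        I \<inter> set (packet ({1..n} - {i})) = set (drop m (packet ({1..n} - {i}))))"
    proof -
      have "nsets {1..n} (n - 1) = (\<lambda>i. {1..n} - {i}) ` {1..n}"
        using n by (intro nsets_co_singleton) simp
      then show ?thesis
        unfolding higher_bruhat_def consistent_def d by simp
    qed
    then show ?thesis
      using graph_of_row[of _ n I] by simp
  qed
  also have "\<dots> \<longleftrightarrow> I \<subseteq> nsets {1..n} (n - 2) \<and> coconsistent n ?G"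
  proof -
    have "(\<forall>i\<in>{1..n}. \<forall>c d e. c < d \<and> d < e \<and> c \<in> {1..n} - {i} \<and> d \<in> {1..n} - {i} \<and> e \<in> {1..n} - {i} \<longrightarrow>
       (?G i c \<and> ?G i e \<longrightarrow> ?G i d) \<and> (?G i d \<longrightarrow> ?G i c \<or> ?G i e)) \<longleftrightarrow> coconsistent n ?G" (is "?A \<longleftrightarrow> ?B")
    proof
      assume A: ?A
      have "?G i d" if "c < d" "d < e" "d \<noteq> i" "?G i c" "?G i e" for i c d e
      proof -
        have "i \<in> {1..n}" "c \<in> {1..n} - {i}" "d \<in> {1..n} - {i}" "e \<in> {1..n} - {i}"
          using rng[OF that(4)] rng[OF that(5)] that(1-3) by auto
        then show ?thesis
          using A that by blast
      qed
      moreover have "?G i c \<or> ?G i e"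
        if "1 \<le> c" "c < d" "d < e" "e \<le> n" "c \<noteq> i" "e \<noteq> i" "?G i d" for i c d e
      proof -
        have "i \<in> {1..n}" "c \<in> {1..n} - {i}" "d \<in> {1..n} - {i}" "e \<in> {1..n} - {i}"
          using rng[OF that(7)] that(1-6) by auto
        then show ?thesis
          using A that by blast
      qed
      moreover have "?G j i \<and> i \<noteq> j \<and> 1 \<le> i \<and> i \<le> n" if "?G i j" for i j
        using rng[OF that] that graph_of_sym by simp
      ultimately show ?B
        unfolding coconsistent_def by blast
    next
      assume B: ?B
      show ?A
      proof (intro ballI allI impI)
        fix i c d e assume i: "i \<in> {1..n}" and cde: "c < d \<and> d < e \<and> c \<in> {1..n} - {i} \<and> d \<in> {1..n} - {i} \<and> e \<in> {1..n} - {i}"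
        show "(?G i c \<and> ?G i e \<longrightarrow> ?G i d) \<and> (?G i d \<longrightarrow> ?G i c \<or> ?G i e)"
          using coc_in[OF B, of i c e d] coc_out[OF B, of i d c e] cde by auto
      qed
    qed
    then show ?thesis
      by simp
  qed
  finally show ?thesis .
qed

definition set_of :: "nat \<Rightarrow> (nat \<Rightarrow> nat \<Rightarrow> bool) \<Rightarrow> nat set set" where
  "set_of n E = {{1..n} - {i, j} | i j. E i j}"

lemma co_pair_eq_iff:
  assumes "i \<in> {1..n}" "j \<in> {1..n}" "a \<in> {1..n}" "b \<in> {1..n::nat}"
  shows "{1..n} - {i, j} = {1..n} - {a, b} \<longleftrightarrow> {i, j} = {a, b}"
  using assms by blast

lemma graph_of_set_of:
  assumes E: "coconsistent n E"
  shows "graph_of n (set_of n E) = E"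
proof (intro ext)
  fix i j
  have rng: "a \<noteq> b \<and> a \<in> {1..n} \<and> b \<in> {1..n}" if "E a b" for a b
    using coc_edge[OF E that] by simp
  show "graph_of n (set_of n E) i j \<longleftrightarrow> E i j"
  proof
    assume "graph_of n (set_of n E) i j"
    then obtain a b where ab: "E a b" "{1..n} - {i, j} = {1..n} - {a, b}" "i \<in> {1..n}" "j \<in> {1..n}"
      by (auto simp: graph_of_def set_of_def)
    then have "{i, j} = {a, b}"
      using co_pair_eq_iff[of i n j a b] rng[OF ab(1)] by blast
    then show "E i j"
      using ab(1) coc_sym[OF E ab(1)] by (auto simp: doubleton_eq_iff)
  next
    assume "E i j"
    then show "graph_of n (set_of n E) i j"
      using rng by (auto simp: graph_of_def set_of_def)
  qed
qed

lemma set_of_graph_of: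
  assumes n: "n \<ge> 4" and "I \<in> higher_bruhat n (n - 3)"
  shows "set_of n (graph_of n I) = I"
proof -
  have "I \<subseteq> nsets {1..n} (n - 2)"
    using assms higher_bruhat_iff by blast
  have "A \<in> set_of n (graph_of n I)" if "A \<in> I" for A
  proof -
    have "A \<in> nsets {1..n} (n - 2)"
      using that \<open>I \<subseteq> nsets {1..n} (n - 2)\<close> by blast
    then obtain i j where ij: "i \<noteq> j" "i \<in> {1..n}" "j \<in> {1..n}" "A = {1..n} - {i, j}"
      using nsets_co_pair[of n A] n by auto
    then have "graph_of n I i j"
      using that by (simp add: graph_of_def)
    then show ?thesis
      using ij(4) unfolding set_of_def by blast
  qed
  then show ?thesis
    by (auto simp: set_of_def graph_of_def)
qed

lemma set_of_in_higher_bruhat: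
  assumes n: "n \<ge> 4" and E: "coconsistent n E"
  shows "set_of n E \<in> higher_bruhat n (n - 3)"
proof -
  have "{1..n} - {i, j} \<in> nsets {1..n} (n - 2)" if "E i j" for i j
    using nsets_co_pair[of n "{1..n} - {i, j}"] n coc_edge[OF E that] by auto
  then have "set_of n E \<subseteq> nsets {1..n} (n - 2)"
    by (auto simp: set_of_def)
  then show ?thesis
    using E n by (simp add: higher_bruhat_iff graph_of_set_of)
qed

lemma graph_of_mono: "I \<subseteq> J \<Longrightarrow> graph_of n I \<le> graph_of n J"
  by (auto simp: graph_of_def le_fun_def)

lemma set_of_mono: "E \<le> F \<Longrightarrow> set_of n E \<subseteq> set_of n F"
  unfolding set_of_def le_fun_def le_bool_def by blast

lemma graph_of_le_iff:
  assumes "n \<ge> 4" "I \<in> higher_bruhat n (n - 3)" "J \<in> higher_bruhat n (n - 3)"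
  shows "graph_of n I \<le> graph_of n J \<longleftrightarrow> I \<subseteq> J"
  using set_of_mono[of "graph_of n I" "graph_of n J" n] graph_of_mono[of I J n] assms set_of_graph_of
  by auto

lemma graph_of_less_iff:
  assumes "n \<ge> 4" "I \<in> higher_bruhat n (n - 3)" "J \<in> higher_bruhat n (n - 3)"
  shows "graph_of n I < graph_of n J \<longleftrightarrow> I \<subset> J"
  using graph_of_le_iff[OF assms(1,2,3)] graph_of_le_iff[OF assms(1,3,2)]
  by (simp only: less_le_not_le)

lemma bruhat_le_imp_subset: "bruhat_le n d I J \<Longrightarrow> I \<subseteq> J"
  unfolding bruhat_le_def by (induction rule: rtranclp_induct) (auto simp: bruhat_step_def)

lemma finite_higher_bruhat: "finite (higher_bruhat n d)" "I \<in> higher_bruhat n d \<Longrightarrow> finite I"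
proof -
  have sub: "higher_bruhat n d \<subseteq> Pow (nsets {1..n} (d + 1))"
    by (auto simp: higher_bruhat_def consistent_def)
  have fin: "finite (nsets {1..n} (d + 1))"
    by (simp add: finite_imp_finite_nsets)
  show "finite (higher_bruhat n d)"
    using sub fin by (meson finite_Pow_iff finite_subset)
  show "finite I" if "I \<in> higher_bruhat n d"
    using sub that fin by (meson PowD finite_subset in_mono)
qed

text \<open>Add one edge at a time.\<close>

lemma subset_imp_bruhat_le:
  assumes n: "n \<ge> 4" and I: "I \<in> higher_bruhat n (n - 3)" and J: "J \<in> higher_bruhat n (n - 3)"
    and "I \<subseteq> J"
  shows "bruhat_le n (n - 3) I J"
  using I \<open>I \<subseteq> J\<close>
proof (induction "card (J - I)" arbitrary: I rule: less_induct)
  case less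
  show ?case
  proof (cases "I = J")
    case True
    then show ?thesis
      by (simp add: bruhat_le_def)
  next
    case False
    let ?E = "graph_of n I" and ?F = "graph_of n J"
    have E: "coconsistent n ?E" and F: "coconsistent n ?F"
      using less.prems J n higher_bruhat_iff by blast+
    have le: "?E \<le> ?F"
      by (rule graph_of_mono) (rule less.prems)
    have "\<not> ?F \<le> ?E"
      using graph_of_le_iff[OF n J less.prems(1)] less.prems(2) False by blast
    then obtain a b where "?F a b" "\<not> ?E a b"
      by (auto simp: le_fun_def)
    then have "growable n ?E ?F"
      using le by (intro coconsistent_growable[OF E F]) (auto simp: le_fun_def)
    then obtain a b where ab: "?F a b" "addable n ?E a b" "addable n ?E b a"
      by (auto simp: growable_def)
    define A where "A = {1..n} - {a, b}"
    define I' where "I' = insert A I"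
    have A: "A \<in> J" "A \<notin> I"
      using ab(1) addable_ne[OF ab(2)] by (auto simp: A_def graph_of_def)
    have "I' = set_of n (add_edge a b ?E)"
    proof -
      have "set_of n (add_edge a b ?E) = insert A (set_of n ?E)"
        unfolding set_of_def add_edge_def A_def by (auto simp: insert_commute doubleton_eq_iff)
      then show ?thesis
        using set_of_graph_of[OF n less.prems(1)] by (simp add: I'_def)
    qed
    then have I': "I' \<in> higher_bruhat n (n - 3)"
      using set_of_in_higher_bruhat[OF n coconsistent_add_edge[OF E ab(2,3)]] by simp
    have "bruhat_step n (n - 3) I I'"
      using less.prems I' A by (auto simp: bruhat_step_def I'_def)
    moreover have "bruhat_le n (n - 3) I' J"
    proof (rule less.hyps[OF _ I'])
      have "J - I' \<subset> J - I"
        using A by (auto simp: I'_def)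
      then show "card (J - I') < card (J - I)"
        using finite_higher_bruhat(2)[OF J] by (intro psubset_card_mono) auto
      show "I' \<subseteq> J"
        using A less.prems by (simp add: I'_def)
    qed
    ultimately show ?thesis
      unfolding bruhat_le_def by (rule converse_rtranclp_into_rtranclp)
  qed
qed

lemma bruhat_le_iff:
  assumes "n \<ge> 4" "I \<in> higher_bruhat n (n - 3)" "J \<in> higher_bruhat n (n - 3)"
  shows "bruhat_le n (n - 3) I J \<longleftrightarrow> I \<subseteq> J"
  using subset_imp_bruhat_le[OF assms] bruhat_le_imp_subset by blast

definition graphs_between :: "nat \<Rightarrow> (nat \<Rightarrow> nat \<Rightarrow> bool) \<Rightarrow> (nat \<Rightarrow> nat \<Rightarrow> bool) \<Rightarrow> (nat \<Rightarrow> nat \<Rightarrow> bool) set" where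
  "graphs_between n E F = {X. coconsistent n X \<and> E < X \<and> X < F}"

lemma finite_graphs_between:
  assumes "n \<ge> 4"
  shows "finite (graphs_between n E F)"
proof (rule inj_on_finite)
  show "inj_on (set_of n) (graphs_between n E F)"
    by (rule inj_on_inverseI[where g = "graph_of n"]) (simp add: graphs_between_def graph_of_set_of)
  show "set_of n ` graphs_between n E F \<subseteq> higher_bruhat n (n - 3)"
    using set_of_in_higher_bruhat[OF assms] by (auto simp: graphs_between_def)
qed (rule finite_higher_bruhat)

text \<open>The isomorphism between consistent sets and graphs moves the problem to graphs with the pointwise
  order.\<close>

lemma interval_space_homotopy_equivalent:
  assumes n: "n \<ge> 4" and I: "I \<in> higher_bruhat n (n - 3)" and J: "J \<in> higher_bruhat n (n - 3)"
  shows "interval_space n (n - 3) I J homotopy_equivalent_space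
    poset_space (graphs_between n (graph_of n I) (graph_of n J))"
proof -
  let ?P = "open_interval n (n - 3) I J" and ?Q = "graphs_between n (graph_of n I) (graph_of n J)"
  have P: "X \<in> ?P \<longleftrightarrow> X \<in> higher_bruhat n (n - 3) \<and> I \<subset> X \<and> X \<subset> J" for X
    using bruhat_le_iff[OF n] I J by (auto simp: open_interval_def bruhat_less_def)
  have "order_complex (bruhat_le n (n - 3)) ?P = order_complex (\<subseteq>) ?P"
  proof -
    have "bruhat_le n (n - 3) X Y \<longleftrightarrow> X \<subseteq> Y" if "X \<in> ?P" "Y \<in> ?P" for X Y
      using that bruhat_le_iff[OF n, of X Y] unfolding P by simp
    then show ?thesis
      unfolding order_complex_def
      by (intro Collect_cong conj_cong ball_cong refl) (simp add: subset_iff)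
  qed
  then have "interval_space n (n - 3) I J = poset_space ?P"
    by (simp add: interval_space_def poset_space_def)
  moreover have "poset_space ?P homotopy_equivalent_space poset_space ?Q"
  proof (rule poset_homotopy_equivalence[where f = "graph_of n" and g = "set_of n"])
    show "finite ?P"
      by (rule finite_subset[OF _ finite_higher_bruhat(1)]) (auto simp: open_interval_def)
    show "finite ?Q"
      by (rule finite_graphs_between[OF n])
    show "graph_of n ` ?P \<subseteq> ?Q"
    proof
      fix E assume "E \<in> graph_of n ` ?P"
      then obtain X where X: "E = graph_of n X" "X \<in> higher_bruhat n (n - 3)" "I \<subset> X" "X \<subset> J"
        using P by blast
      then have "coconsistent n E"
        using higher_bruhat_iff[OF n] by blast
      then show "E \<in> ?Q"
        using X graph_of_less_iff[OF n I X(2)] graph_of_less_iff[OF n X(2) J]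
        by (simp add: graphs_between_def)
    qed
    show "set_of n ` ?Q \<subseteq> ?P"
    proof
      fix X assume "X \<in> set_of n ` ?Q"
      then obtain E where E: "coconsistent n E" "graph_of n I < E" "E < graph_of n J" "X = set_of n E"
        by (auto simp: graphs_between_def)
      then have X: "X \<in> higher_bruhat n (n - 3)" "graph_of n X = E"
        using set_of_in_higher_bruhat[OF n] graph_of_set_of by simp_all
      then show "X \<in> ?P"
        using P[of X] graph_of_less_iff[OF n I X(1)] graph_of_less_iff[OF n X(1) J] E by simp
    qed
    show "set_of n (graph_of n X) \<le> X" if "X \<in> ?P" for X
      using that P set_of_graph_of[OF n] by simp
    show "graph_of n (set_of n E) = E" if "E \<in> ?Q" for E
      using that graph_of_set_of by (simp add: graphs_between_def)
  qed (use graph_of_mono set_of_mono in \<open>auto simp: mono_on_def\<close>)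
  ultimately show ?thesis
    by simp
qed

section \<open>The localization theorem for the cyclic arrangement\<close>

text \<open>The condition on the three products in a Grassmann-Pluecker relation. In the row of a line it is
  applied to \<open>\<sigma> c, - \<sigma> d, \<sigma> e\<close> with \<open>c < d < e\<close>; there it says that the signs are all zero, or change exactly
  as in one of the sequences of the localization theorem.\<close>

definition sign_balanced :: "int \<Rightarrow> int \<Rightarrow> int \<Rightarrow> bool" where
  "sign_balanced x y z \<longleftrightarrow> {x, y, z} = {0} \<or> {-1, 1} \<subseteq> {x, y, z}"

lemma sign_balanced_iff:
  "sign_balanced x y z \<longleftrightarrow>
    x = 0 \<and> y = 0 \<and> z = 0 \<or> (x = 1 \<or> y = 1 \<or> z = 1) \<and> (x = -1 \<or> y = -1 \<or> z = -1)"
  by (auto simp: sign_balanced_def)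

lemma sign_balanced_swap: "sign_balanced x y z \<longleftrightarrow> sign_balanced y x z" "sign_balanced x y z \<longleftrightarrow> sign_balanced x z y"
  by (auto simp: sign_balanced_iff)

lemma sign_balanced_uminus: "sign_balanced (- x) (- y) (- z) \<longleftrightarrow> sign_balanced x y z"
  by (auto simp: sign_balanced_iff)

lemma sign_balanced_scale:
  assumes "u \<in> {-1, 1}"
  shows "sign_balanced (u * x) (u * y) (u * z) \<longleftrightarrow> sign_balanced x y z"
  using assms sign_balanced_uminus by auto

text \<open>The Grassmann-Pluecker relation of the new line with four old ones follows from the row conditions of the
  four lines. There are \<open>3 ^ 6\<close> patterns of signs at the six vertices.\<close>

lemma four_lines:
  assumes "a \<in> {-1, 0, 1}" "b \<in> {-1, 0, 1}" "c \<in> {-1, 0, 1}" "d \<in> {-1, 0, 1}" "e \<in> {-1, 0, 1}" "f \<in> {-1, 0, 1}"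
    and "sign_balanced a (- b) c" "sign_balanced a (- d) e" "sign_balanced b (- d) f" "sign_balanced c (- e) f"
  shows "sign_balanced (a * f) (- (b * e)) (c * d)"
  using assms unfolding sign_balanced_iff by (elim insertE emptyE) simp_all

definition localized :: "nat \<Rightarrow> (nat set \<Rightarrow> int) \<Rightarrow> bool" where
  "localized n \<sigma> \<longleftrightarrow> (\<forall>e \<in> nsets {1..n} 2. \<sigma> e \<in> {-1, 0, 1}) \<and>
     (\<forall>i c d e. i \<in> {1..n} \<and> 1 \<le> c \<and> c < d \<and> d < e \<and> e \<le> n \<and> i \<noteq> c \<and> i \<noteq> d \<and> i \<noteq> e \<longrightarrow>
       sign_balanced (\<sigma> {i, c}) (- \<sigma> {i, d}) (\<sigma> {i, e}))"

text \<open>The factor between \<open>\<sigma> {i, j}\<close>, which is read off with \<open>i < j\<close>, and the chirotope at \<open>i\<close>, \<open>j\<close> in this order.\<close>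

definition dir :: "nat \<Rightarrow> nat \<Rightarrow> int" where
  "dir i j = sgn (int j - int i)"

lemma dir_swap: "dir j i = - dir i j"
  by (simp add: dir_def sgn_if)

lemma dir_sign: "i \<noteq> j \<Longrightarrow> dir i j \<in> {-1, 1}"
  by (auto simp: dir_def sgn_if)

lemma dir_less: "i < j \<Longrightarrow> dir i j = 1"
  by (simp add: dir_def)

definition cyclic_sign :: "nat \<Rightarrow> nat \<Rightarrow> nat \<Rightarrow> int" where
  "cyclic_sign i j k = dir i j * dir i k * dir j k"

lemma arrangement_chirotope_eq:
  assumes t: "strict_mono_on {1..n} t" and ijk: "i \<in> {1..n}" "j \<in> {1..n}" "k \<in> {1..n}"
  shows "arrangement_chirotope t i j k = of_int (cyclic_sign i j k)"
proof -
  have sgn: "sgn (t b - t a) = of_int (dir a b)" if "a \<in> {1..n}" "b \<in> {1..n}" for a b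
  proof -
    consider "a < b" | "a = b" | "b < a"
      by linarith
    then show ?thesis
      using strict_mono_onD[OF t, of a b] strict_mono_onD[OF t, of b a] that
      by cases (auto simp: dir_def sgn_if)
  qed
  have "det (vector [line_vec (t i), line_vec (t j), line_vec (t k)] :: real^3^3) =
      (t j - t i) * (t k - t i) * (t k - t j)"
    by (simp add: det_3 line_vec_def vector_3 power2_eq_square algebra_simps)
  then show ?thesis
    using ijk by (simp add: arrangement_chirotope_def cyclic_sign_def sgn_mult sgn)
qed

lemma pair_in_nsets: "i \<in> {1..n} \<Longrightarrow> j \<in> {1..n} \<Longrightarrow> i \<noteq> j \<Longrightarrow> {i, j} \<in> nsets {1..n::nat} 2"
  by (auto simp: nsets_def)

lemma pair_nsetsE:
  assumes "e \<in> nsets {1..n::nat} 2"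
  obtains i j where "e = {i, j}" "i < j" "i \<in> {1..n}" "j \<in> {1..n}"
proof -
  obtain i j where "e = {i, j}" "i \<noteq> j" "i \<in> {1..n}" "j \<in> {1..n}"
    using assms by (auto simp: nsets_def card_2_iff)
  then show thesis
    using that[of i j] that[of j i] by (cases "i < j") (auto simp: insert_commute)
qed

text \<open>The relation with the old line \<open>i\<close> as common element, the new line, and three more old lines is the row
  condition, up to the common factor \<open>dir i c * dir i d * dir i e\<close>.\<close>

lemma extension_imp_localized:
  assumes t: "strict_mono_on {1..n} t" and "extension_labeling n t \<sigma>"
  shows "localized n \<sigma>"
proof -
  let ?p = "Suc n"
  obtain chi where chi: "chirotope3 {1..?p} chi"
    and old: "\<And>i j k. i \<in> {1..n} \<Longrightarrow> j \<in> {1..n} \<Longrightarrow> k \<in> {1..n} \<Longrightarrow>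
      of_int (chi i j k) = arrangement_chirotope t i j k"
    and new: "\<And>i j. i \<in> {1..n} \<Longrightarrow> j \<in> {1..n} \<Longrightarrow> i < j \<Longrightarrow> \<sigma> {i, j} = chi i j ?p"
    using assms(2) unfolding extension_labeling_def by blast
  have alt: "chi a b c \<in> {-1, 0, 1} \<and> chi b a c = - chi a b c \<and> chi a c b = - chi a b c"
    if "a \<in> {1..?p}" "b \<in> {1..?p}" "c \<in> {1..?p}" for a b c
    using chi that unfolding chirotope3_def by blast
  have gp: "sign_balanced (chi a b c * chi a d e) (- (chi a b d * chi a c e)) (chi a b e * chi a c d)"
    if "a \<in> {1..?p}" "b \<in> {1..?p}" "c \<in> {1..?p}" "d \<in> {1..?p}" "e \<in> {1..?p}" for a b c d e
  proof -
    have "\<forall>a\<in>{1..?p}. \<forall>b\<in>{1..?p}. \<forall>c\<in>{1..?p}. \<forall>d\<in>{1..?p}. \<forall>e\<in>{1..?p}.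
        (let T = {chi a b c * chi a d e, - (chi a b d * chi a c e), chi a b e * chi a c d}
        in T = {0} \<or> {-1, 1} \<subseteq> T)"
      using chi unfolding chirotope3_def by (elim conjE)
    then show ?thesis
      using that unfolding sign_balanced_def Let_def by blast
  qed
  have old': "chi i j k = cyclic_sign i j k" if "i \<in> {1..n}" "j \<in> {1..n}" "k \<in> {1..n}" for i j k
    using old[OF that] arrangement_chirotope_eq[OF t that] by simp
  have \<sigma>: "chi i c ?p = dir i c * \<sigma> {i, c}" if "i \<in> {1..n}" "c \<in> {1..n}" "i \<noteq> c" for i c
  proof (cases "i < c")
    case True
    then show ?thesis
      using new[OF that(1,2)] by (simp add: dir_less)
  next
    case False
    then have "c < i"
      using that by simp
    then show ?thesis
      using new[OF that(2,1)] alt[of c i ?p] that dir_less[of c i] dir_swap[of c i]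
      by (simp add: insert_commute)
  qed
  have "sign_balanced (\<sigma> {i, c}) (- \<sigma> {i, d}) (\<sigma> {i, e})"
    if h: "i \<in> {1..n}" "1 \<le> c" "c < d" "d < e" "e \<le> n" "i \<noteq> c" "i \<noteq> d" "i \<noteq> e" for i c d e
  proof -
    have cde: "c \<in> {1..n}" "d \<in> {1..n}" "e \<in> {1..n}"
      using h by auto
    have p: "chi i ?p x = - (dir i x * \<sigma> {i, x})" if "x \<in> {1..n}" "i \<noteq> x" for x
      using \<sigma>[OF h(1) that] alt[of i x ?p] h(1) that by auto
    define u where "u = - (dir i c * dir i d * dir i e)"
    have u: "u \<in> {-1, 1}"
      using dir_sign[of i c] dir_sign[of i d] dir_sign[of i e] h by (auto simp: u_def)
    have "sign_balanced (chi i ?p c * chi i d e) (- (chi i ?p d * chi i c e)) (chi i ?p e * chi i c d)"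
      using h cde by (intro gp) auto
    then have "sign_balanced (u * \<sigma> {i, c}) (u * - \<sigma> {i, d}) (u * \<sigma> {i, e})"
      using h cde by (simp add: p old' cyclic_sign_def dir_less u_def algebra_simps)
    then show ?thesis
      using sign_balanced_scale[OF u] by blast
  qed
  moreover have "\<sigma> e \<in> {-1, 0, 1}" if "e \<in> nsets {1..n} 2" for e
  proof -
    note e = that
    obtain i j where "e = {i, j}" "i < j" "i \<in> {1..n}" "j \<in> {1..n}"
      by (rule pair_nsetsE[OF e])
    then show ?thesis
      using new[of i j] alt[of i j ?p] by auto
  qed
  ultimately show ?thesis
    unfolding localized_def by blast
qed

text \<open>Sorting by adjacent transpositions.\<close>

lemma symmetric_in_four:
  fixes Q :: "nat \<Rightarrow> nat \<Rightarrow> nat \<Rightarrow> nat \<Rightarrow> bool"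
  assumes swap: "\<And>b c d e. Q b c d e \<Longrightarrow> Q c b d e" "\<And>b c d e. Q b c d e \<Longrightarrow> Q b d c e"
      "\<And>b c d e. Q b c d e \<Longrightarrow> Q b c e d"
    and sorted: "\<And>b c d e. {b, c, d, e} \<subseteq> A \<Longrightarrow> b < c \<Longrightarrow> c < d \<Longrightarrow> d < e \<Longrightarrow> Q b c d e"
    and A: "{b, c, d, e} \<subseteq> A" and ne: "b \<noteq> c" "b \<noteq> d" "b \<noteq> e" "c \<noteq> d" "c \<noteq> e" "d \<noteq> e"
  shows "Q b c d e"
proof -
  have insert_last: "Q b c d e" if "{b, c, d, e} \<subseteq> A" "c < d" "d < e" "b \<notin> {c, d, e}" for b c d e
  proof -
    note h = that
    consider "b < c" | "c < b" "b < d" | "d < b" "b < e" | "e < b"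
      using h(4) by force
    then show ?thesis
    proof cases
      case 1
      then show ?thesis
        using sorted that by blast
    next
      case 2
      then show ?thesis
        using swap(1)[OF sorted[of c b d e]] that by auto
    next
      case 3
      then show ?thesis
        using swap(1)[OF swap(2)[OF sorted[of c d b e]]] that by auto
    next
      case 4
      then show ?thesis
        using swap(1)[OF swap(2)[OF swap(3)[OF sorted[of c d e b]]]] that by auto
    qed
  qed
  have 2: "Q b c d e" if "{b, c, d, e} \<subseteq> A" "d < e" "b \<notin> {c, d, e}" "c \<notin> {d, e}" for b c d e
  proof -
    note h = that
    consider "c < d" | "d < c" "c < e" | "e < c"
      using h(4) by force
    then show ?thesis
    proof cases
      case 1
      then show ?thesis
        using insert_last that by blast
    next
      case 2
      then show ?thesis
        using swap(2)[OF insert_last[of b d c e]] that by auto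
    next
      case 3
      then show ?thesis
        using swap(2)[OF swap(3)[OF insert_last[of b d e c]]] that by auto
    qed
  qed
  show ?thesis
    using 2[of b c d e] swap(3)[OF 2[of b c e d]] A ne by (cases "d < e") auto
qed

text \<open>Transpositions of \<open>b, c, d, e\<close> permute the three products up to a common sign, and repeated elements make
  one product vanish and the other two opposite, or all three vanish. So increasing \<open>b, c, d, e\<close>
  suffice.\<close>

lemma grassmann_pluecker_sorted:
  fixes chi :: "nat \<Rightarrow> nat \<Rightarrow> nat \<Rightarrow> int"
  assumes alt: "\<And>a b c. a \<in> A \<Longrightarrow> b \<in> A \<Longrightarrow> c \<in> A \<Longrightarrow>
      chi a b c \<in> {-1, 0, 1} \<and> chi b a c = - chi a b c \<and> chi a c b = - chi a b c"
    and sorted: "\<And>a b c d e. {a, b, c, d, e} \<subseteq> A \<Longrightarrow> b < c \<Longrightarrow> c < d \<Longrightarrow> d < e \<Longrightarrow> a \<notin> {b, c, d, e} \<Longrightarrow>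
      sign_balanced (chi a b c * chi a d e) (- (chi a b d * chi a c e)) (chi a b e * chi a c d)"
    and A: "{a, b, c, d, e} \<subseteq> A"
  shows "sign_balanced (chi a b c * chi a d e) (- (chi a b d * chi a c e)) (chi a b e * chi a c d)"
proof -
  define Q where "Q = (\<lambda>b c d e. sign_balanced (chi a b c * chi a d e) (- (chi a b d * chi a c e)) (chi a b e * chi a c d))"
  have a: "a \<in> A"
    using A by simp
  have sw: "chi a y x = - chi a x y" if "x \<in> A" "y \<in> A" for x y
    using alt[OF a that] by blast
  have zero: "chi x y z = 0" if "x \<in> A" "y \<in> A" "z \<in> A" "x = y \<or> y = z \<or> x = z" for x y z
    using alt[of x y z] alt[of y x z] alt[of x z y] that by force
  have val: "chi a x y * chi a z w \<in> {-1, 0, 1}" if "x \<in> A" "y \<in> A" "z \<in> A" "w \<in> A" for x y z w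
  proof -
    have "chi a x y \<in> {-1, 0, 1}" "chi a z w \<in> {-1, 0, 1}"
      using alt a that by blast+
    then show ?thesis
      by auto
  qed
  have degenerate: "sign_balanced x y z" if "x = 0 \<and> z = - y \<or> y = 0 \<and> z = - x \<or> z = 0 \<and> y = - x" "x \<in> {-1, 0, 1}" "y \<in> {-1, 0, 1}" for x y z
    using that by (auto simp: sign_balanced_iff)
  consider "a \<in> {b, c, d, e}" | "b = c \<or> b = d \<or> b = e \<or> c = d \<or> c = e \<or> d = e"
    | "a \<notin> {b, c, d, e}" "b \<noteq> c" "b \<noteq> d" "b \<noteq> e" "c \<noteq> d" "c \<noteq> e" "d \<noteq> e"
    by blast
  then show ?thesis
  proof cases
    case 1
    then have "chi a b c * chi a d e = 0 \<and> chi a b d * chi a c e = 0 \<and> chi a b e * chi a c d = 0"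
      using zero A by auto
    then show ?thesis
      by (simp add: sign_balanced_iff)
  next
    case 2
    show ?thesis
    proof (rule degenerate)
      show "chi a b c * chi a d e = 0 \<and> chi a b e * chi a c d = - (- (chi a b d * chi a c e)) \<or>
        - (chi a b d * chi a c e) = 0 \<and> chi a b e * chi a c d = - (chi a b c * chi a d e) \<or>
        chi a b e * chi a c d = 0 \<and> - (chi a b d * chi a c e) = - (chi a b c * chi a d e)"
        using 2
      proof (elim disjE)
        assume "b = c"
        then show ?thesis
          using zero[of a b b] A by simp
      next
        assume "b = d"
        then show ?thesis
          using zero[of a b b] sw[of b c] A by simp
      next
        assume "b = e"
        then show ?thesis
          using zero[of a b b] sw[of b c] sw[of b d] A by simp
      next
        assume "c = d"
        then show ?thesis
          using zero[of a c c] A by simp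
      next
        assume "c = e"
        then show ?thesis
          using zero[of a c c] sw[of c d] A by simp
      next
        assume "d = e"
        then show ?thesis
          using zero[of a d d] A by simp
      qed
      show "chi a b c * chi a d e \<in> {-1, 0, 1}"
        using val A by auto
      show "- (chi a b d * chi a c e) \<in> {-1, 0, 1}"
        using val[of b d c e] A by auto
    qed
  next
    case 3
    have "Q b c d e"
    proof (rule symmetric_in_four[where A = "A - {a}" and Q = "\<lambda>b c d e. {b, c, d, e} \<subseteq> A \<longrightarrow> Q b c d e", THEN mp])
      show "{b, c, d, e} \<subseteq> A \<longrightarrow> Q b c d e"
        if "{b, c, d, e} \<subseteq> A - {a}" "b < c" "c < d" "d < e" for b c d e
        unfolding Q_def using sorted[of a b c d e] that a by auto
      show "{c, b, d, e} \<subseteq> A \<longrightarrow> Q c b d e" if "{b, c, d, e} \<subseteq> A \<longrightarrow> Q b c d e" for b c d e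
      proof
        assume "{c, b, d, e} \<subseteq> A"
        then have "sign_balanced (chi a b c * chi a d e) (- (chi a b d * chi a c e)) (chi a b e * chi a c d)"
          using that by (auto simp: Q_def)
        moreover have "chi a c b = - chi a b c"
          using sw[of b c] \<open>{c, b, d, e} \<subseteq> A\<close> by simp
        ultimately show "Q c b d e"
          using sign_balanced_uminus[of "chi a b c * chi a d e" "chi a b e * chi a c d" "- (chi a b d * chi a c e)"]
            sign_balanced_swap[of "chi a b c * chi a d e" "- (chi a b d * chi a c e)" "chi a b e * chi a c d"]
          by (simp add: Q_def mult.commute)
      qed
      show "{b, d, c, e} \<subseteq> A \<longrightarrow> Q b d c e" if "{b, c, d, e} \<subseteq> A \<longrightarrow> Q b c d e" for b c d e
      proof
        assume "{b, d, c, e} \<subseteq> A"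
        then have "sign_balanced (chi a b c * chi a d e) (- (chi a b d * chi a c e)) (chi a b e * chi a c d)"
          using that by (auto simp: Q_def)
        moreover have "chi a d c = - chi a c d"
          using sw[of c d] \<open>{b, d, c, e} \<subseteq> A\<close> by simp
        ultimately show "Q b d c e"
          using sign_balanced_uminus[of "- (chi a b d * chi a c e)" "chi a b c * chi a d e" "chi a b e * chi a c d"]
            sign_balanced_swap[of "chi a b c * chi a d e" "- (chi a b d * chi a c e)" "chi a b e * chi a c d"]
          by (simp add: Q_def mult.commute)
      qed
      show "{b, c, e, d} \<subseteq> A \<longrightarrow> Q b c e d" if "{b, c, d, e} \<subseteq> A \<longrightarrow> Q b c d e" for b c d e
      proof
        assume "{b, c, e, d} \<subseteq> A"
        then have "sign_balanced (chi a b c * chi a d e) (- (chi a b d * chi a c e)) (chi a b e * chi a c d)"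
          using that by (auto simp: Q_def)
        moreover have "chi a e d = - chi a d e"
          using sw[of d e] \<open>{b, c, e, d} \<subseteq> A\<close> by simp
        ultimately show "Q b c e d"
          using sign_balanced_uminus[of "chi a b c * chi a d e" "chi a b e * chi a c d" "- (chi a b d * chi a c e)"]
            sign_balanced_swap[of "chi a b c * chi a d e" "- (chi a b d * chi a c e)" "chi a b e * chi a c d"]
          by (simp add: Q_def mult.commute)
      qed
    qed (use 3 A in auto)
    then show ?thesis
      by (simp add: Q_def)
  qed
qed

text \<open>The new line is \<open>p\<close>. The sign of a triple that contains it once is \<open>dir x y * \<sigma> {x, y}\<close>, up to the sign of
  the permutation that moves \<open>p\<close> to the end.\<close>

definition extension_chirotope :: "nat \<Rightarrow> (nat set \<Rightarrow> int) \<Rightarrow> nat \<Rightarrow> nat \<Rightarrow> nat \<Rightarrow> int" where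
  "extension_chirotope p \<sigma> a b c =
    (let \<tau> = \<lambda>x y. if x = p \<or> y = p then 0 else dir x y * \<sigma> {x, y} in
     if c = p then \<tau> a b else if b = p then - \<tau> a c else if a = p then \<tau> b c else cyclic_sign a b c)"

text \<open>The chirotope is prescribed by \<open>\<sigma>\<close>. Since the new line has the largest label, it is the common
  element, or the last of the other four, or absent, once these are sorted. The first case is that of four
  lines, the second is the row condition, and the last is the alternating chirotope. For the
  exchange property, it is enough that for independent \<open>a\<close>, \<open>b\<close>, \<open>c\<close> at most one further element is dependent on
  \<open>b\<close> and \<open>c\<close>: a row with a nonzero sign has at most one zero.\<close>

lemma localized_imp_extension:
  assumes n: "n \<ge> 4" and t: "strict_mono_on {1..n} t" and loc: "localized n \<sigma>"
  shows "extension_labeling n t \<sigma>"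
proof -
  let ?p = "Suc n"
  let ?A = "{1..?p}"
  define chi where "chi = extension_chirotope ?p \<sigma>"
  have row: "sign_balanced (\<sigma> {i, c}) (- \<sigma> {i, d}) (\<sigma> {i, e})"
    if "i \<in> {1..n}" "1 \<le> c" "c < d" "d < e" "e \<le> n" "i \<noteq> c" "i \<noteq> d" "i \<noteq> e" for i c d e
    using loc that unfolding localized_def by blast
  have val: "\<sigma> {i, j} \<in> {-1, 0, 1}" if "i \<in> {1..n}" "j \<in> {1..n}" "i \<noteq> j" for i j
    using loc pair_in_nsets[OF that] unfolding localized_def by blast
  have old: "chi i j k = cyclic_sign i j k" if "i \<in> {1..n}" "j \<in> {1..n}" "k \<in> {1..n}" for i j k
    using that by (auto simp: chi_def extension_chirotope_def)
  have new: "chi i j ?p = dir i j * \<sigma> {i, j}" "chi i ?p j = - (dir i j * \<sigma> {i, j})" "chi ?p i j = dir i j * \<sigma> {i, j}"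
    if "i \<in> {1..n}" "j \<in> {1..n}" for i j
    using that by (auto simp: chi_def extension_chirotope_def)
  have new0: "chi x ?p ?p = 0" "chi ?p x ?p = 0" "chi ?p ?p x = 0" for x
    by (auto simp: chi_def extension_chirotope_def)
  have A: "x \<in> ?A \<longleftrightarrow> x = ?p \<or> x \<in> {1..n}" for x
    by auto
  have cyc: "cyclic_sign a b c \<in> {-1, 0, 1} \<and> cyclic_sign b a c = - cyclic_sign a b c \<and> cyclic_sign a c b = - cyclic_sign a b c" for a b c
    by (auto simp: cyclic_sign_def dir_def sgn_if)
  have dv: "dir x y * \<sigma> {x, y} \<in> {-1, 0, 1}" "- (dir x y * \<sigma> {x, y}) \<in> {-1, 0, 1}" "dir y x * \<sigma> {y, x} = - (dir x y * \<sigma> {x, y})"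
    if "x \<in> {1..n}" "y \<in> {1..n}" for x y
  proof -
    have "dir x y * \<sigma> {x, y} \<in> {-1, 0, 1} \<and> - (dir x y * \<sigma> {x, y}) \<in> {-1, 0, 1}"
    proof (cases "x = y")
      case True
      then show "dir x y * \<sigma> {x, y} \<in> {-1, 0, 1} \<and> - (dir x y * \<sigma> {x, y}) \<in> {-1, 0, 1}"
        by (simp add: dir_def)
    next
      case False
      then show "dir x y * \<sigma> {x, y} \<in> {-1, 0, 1} \<and> - (dir x y * \<sigma> {x, y}) \<in> {-1, 0, 1}"
        using val[OF that] dir_sign[of x y] by auto
    qed
    then show "dir x y * \<sigma> {x, y} \<in> {-1, 0, 1}" "- (dir x y * \<sigma> {x, y}) \<in> {-1, 0, 1}"
      by blast+
    show "dir y x * \<sigma> {y, x} = - (dir x y * \<sigma> {x, y})"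
      by (simp add: dir_swap[of x y] insert_commute)
  qed
  have alt: "chi a b c \<in> {-1, 0, 1} \<and> chi b a c = - chi a b c \<and> chi a c b = - chi a b c"
    if "a \<in> ?A" "b \<in> ?A" "c \<in> ?A" for a b c
    using that dv[of a b] dv[of a c] dv[of b c] cyc[of a b c] unfolding A
    by (elim disjE) (simp_all add: new new0 old)
  have gp_sorted: "sign_balanced (chi a b c * chi a d e) (- (chi a b d * chi a c e)) (chi a b e * chi a c d)"
    if h: "{a, b, c, d, e} \<subseteq> ?A" "b < c" "c < d" "d < e" "a \<notin> {b, c, d, e}" for a b c d e
  proof -
    have bcd: "b \<in> {1..n}" "c \<in> {1..n}" "d \<in> {1..n}" "e = ?p \<or> e \<in> {1..n}" "a = ?p \<or> a \<in> {1..n}"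
      using h by auto
    define u where "u = dir a b * dir a c * dir a d"
    have u: "u \<in> {-1, 1}"
      using h(5) dir_sign[of a b] dir_sign[of a c] dir_sign[of a d] by (auto simp: u_def)
    consider "a = ?p" "e \<in> {1..n}" | "a \<in> {1..n}" "e = ?p" | "a \<in> {1..n}" "e \<in> {1..n}"
      using bcd h(5) by auto
    then show ?thesis
    proof cases
      case 1
      have "sign_balanced (\<sigma> {b, c} * \<sigma> {d, e}) (- (\<sigma> {b, d} * \<sigma> {c, e})) (\<sigma> {b, e} * \<sigma> {c, d})"
      proof (rule four_lines)
        show "sign_balanced (\<sigma> {b, c}) (- \<sigma> {b, d}) (\<sigma> {b, e})"
          using h 1 bcd by (intro row) auto
        show "sign_balanced (\<sigma> {b, c}) (- \<sigma> {c, d}) (\<sigma> {c, e})"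
          using h 1 bcd row[of c b d e] by (auto simp: insert_commute)
        show "sign_balanced (\<sigma> {b, d}) (- \<sigma> {c, d}) (\<sigma> {d, e})"
          using h 1 bcd row[of d b c e] by (auto simp: insert_commute)
        show "sign_balanced (\<sigma> {b, e}) (- \<sigma> {c, e}) (\<sigma> {d, e})"
          using h 1 bcd row[of e b c d] by (auto simp: insert_commute)
      qed (rule val; use h 1 bcd in auto)+
      then show ?thesis
        using h 1 bcd by (simp add: new dir_less)
    next
      case 2
      have "sign_balanced (\<sigma> {a, b}) (- \<sigma> {a, c}) (\<sigma> {a, d})"
        using h 2 bcd by (intro row) auto
      then have "sign_balanced (u * \<sigma> {a, d}) (u * - \<sigma> {a, c}) (u * \<sigma> {a, b})"
        unfolding sign_balanced_scale[OF u] using sign_balanced_swap by blast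
      moreover have "chi a b c * chi a d e = u * \<sigma> {a, d}"
        "chi a b d * chi a c e = u * \<sigma> {a, c}" "chi a b e * chi a c d = u * \<sigma> {a, b}"
        using h(2-4) 2 bcd by (simp_all add: new old cyclic_sign_def dir_less u_def ac_simps)
      ultimately show ?thesis
        by simp
    next
      case 3
      have "u * dir a e \<in> {-1, 1}"
        using u dir_sign[of a e] h(5) by auto
      then have "sign_balanced (u * dir a e) (- (u * dir a e)) (u * dir a e)"
        by (auto simp: sign_balanced_iff)
      moreover have "chi a b c * chi a d e = u * dir a e"
        "chi a b d * chi a c e = u * dir a e" "chi a b e * chi a c d = u * dir a e"
        using h(2-4) 3 bcd by (simp_all add: old cyclic_sign_def dir_less u_def ac_simps)
      ultimately show ?thesis
        by simp
    qed
  qed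
  have gp: "let T = {chi a b c * chi a d e, - (chi a b d * chi a c e), chi a b e * chi a c d}
        in T = {0} \<or> {-1, 1} \<subseteq> T"
    if "a \<in> ?A" "b \<in> ?A" "c \<in> ?A" "d \<in> ?A" "e \<in> ?A" for a b c d e
  proof -
    have "sign_balanced (chi a b c * chi a d e) (- (chi a b d * chi a c e)) (chi a b e * chi a c d)"
      by (rule grassmann_pluecker_sorted[OF alt gp_sorted]) (use that in blast)+
    then show ?thesis
      unfolding sign_balanced_def Let_def .
  qed
  have basis: "\<exists>a\<in>?A. \<exists>b\<in>?A. \<exists>c\<in>?A. chi a b c \<noteq> 0"
  proof -
    have "chi 1 2 3 \<noteq> 0"
      using n by (simp add: old cyclic_sign_def dir_less)
    then show ?thesis
      using n by (intro bexI[of _ 1] bexI[of _ 2] bexI[of _ 3]) auto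
  qed
  have distinct: "x \<noteq> y \<and> y \<noteq> z \<and> x \<noteq> z" if "chi x y z \<noteq> 0" "x \<in> ?A" "y \<in> ?A" "z \<in> ?A" for x y z
    using that alt[of x y z] alt[of y x z] alt[of x z y] by force
  have one_zero: "x = y" if h: "\<sigma> {c, x} = 0" "\<sigma> {c, y} = 0" "\<sigma> {c, a} \<noteq> 0" "{a, c, x, y} \<subseteq> {1..n}" "x \<noteq> c" "y \<noteq> c" "a \<noteq> c" for x y c a
  proof (rule ccontr)
    assume "x \<noteq> y"
    have "\<sigma> {c, a} = 0" if "\<sigma> {c, x} = 0" "\<sigma> {c, y} = 0" "x < y" "{a, c, x, y} \<subseteq> {1..n}" "x \<noteq> c" "y \<noteq> c" for x y
    proof -
      consider "a = x \<or> a = y" | "a < x" | "x < a" "a < y" | "y < a"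
        using that by linarith
      then show ?thesis
      proof cases
        case 2
        then show ?thesis
          using row[of c a x y] that h(7) by (auto simp: sign_balanced_iff)
      next
        case 3
        then show ?thesis
          using row[of c x a y] that h(7) by (auto simp: sign_balanced_iff)
      next
        case 4
        then show ?thesis
          using row[of c x y a] that h(7) by (auto simp: sign_balanced_iff)
      qed (use that in auto)
    qed
    from this[of x y] this[of y x] show False
      using h \<open>x \<noteq> y\<close> by (cases "x < y") auto
  qed
  have exchange: "\<exists>w\<in>{x, y, z}. chi w b c \<noteq> 0"
    if abc: "a \<in> ?A" "b \<in> ?A" "c \<in> ?A" "x \<in> ?A" "y \<in> ?A" "z \<in> ?A" "chi a b c \<noteq> 0" "chi x y z \<noteq> 0" for a b c x y z
  proof (rule ccontr)
    assume "\<not> ?thesis"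
    then have w: "chi w b c = 0" if "w \<in> {x, y, z}" for w
      using that by blast
    have xyz: "x \<noteq> y" "y \<noteq> z" "x \<noteq> z" and bc: "a \<noteq> b" "b \<noteq> c" "a \<noteq> c"
      using distinct abc by blast+
    \<comment> \<open>At most one element outside \<open>{b, c}\<close> is dependent on them.\<close>
    have "\<exists>v. \<forall>w\<in>{x, y, z}. w = b \<or> w = c \<or> w = v"
    proof -
      consider "b \<in> {1..n}" "c \<in> {1..n}" | "b = ?p" "c \<in> {1..n}" | "b \<in> {1..n}" "c = ?p"
        using abc(2,3) bc(2) A[of b] A[of c] by blast
      then show ?thesis
      proof cases
        case 1
        have "w = b \<or> w = c \<or> w = ?p" if "w \<in> {x, y, z}" for w
        proof (rule ccontr)
          assume "\<not> ?thesis"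
          then have "cyclic_sign w b c = 0" "w \<noteq> b" "w \<noteq> c"
            using w[OF that] 1 that abc old[of w b c] by auto
          then show False
            using bc dir_sign[of w b] dir_sign[of w c] dir_sign[of b c] by (auto simp: cyclic_sign_def)
        qed
        then show ?thesis
          by blast
      next
        case 2
        have a: "a \<in> {1..n}" "\<sigma> {c, a} \<noteq> 0"
          using abc bc 2 new(2)[of a c] by (auto simp: insert_commute)
        have *: "w \<in> {1..n} \<and> \<sigma> {c, w} = 0" if "w \<in> {x, y, z}" "w \<noteq> b" "w \<noteq> c" for w
          using w[OF that(1)] that abc 2 new(2)[of w c] dir_sign[of w c] by (auto simp: insert_commute)
        show ?thesis
        proof (cases "\<exists>v\<in>{x, y, z}. v \<noteq> b \<and> v \<noteq> c")
          case True
          then obtain v where v: "v \<in> {x, y, z}" "v \<noteq> b" "v \<noteq> c"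
            by blast
          have "w = v" if "w \<in> {x, y, z}" "w \<noteq> b" "w \<noteq> c" for w
            using one_zero[of c w v a] *[OF that] *[OF v] that v a bc 2 by simp
          then show ?thesis
            by blast
        qed blast
      next
        case 3
        have a: "a \<in> {1..n}" "\<sigma> {b, a} \<noteq> 0"
          using abc bc 3 new(1)[of a b] by (auto simp: insert_commute)
        have *: "w \<in> {1..n} \<and> \<sigma> {b, w} = 0" if "w \<in> {x, y, z}" "w \<noteq> b" "w \<noteq> c" for w
          using w[OF that(1)] that abc 3 new(1)[of w b] dir_sign[of w b] by (auto simp: insert_commute)
        show ?thesis
        proof (cases "\<exists>v\<in>{x, y, z}. v \<noteq> b \<and> v \<noteq> c")
          case True
          then obtain v where v: "v \<in> {x, y, z}" "v \<noteq> b" "v \<noteq> c"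
            by blast
          have "w = v" if "w \<in> {x, y, z}" "w \<noteq> b" "w \<noteq> c" for w
            using one_zero[of b w v a] *[OF that] *[OF v] that v a bc 3 by simp
          then show ?thesis
            by blast
        qed blast
      qed
    qed
    then obtain v where v: "\<forall>w\<in>{x, y, z}. w = b \<or> w = c \<or> w = v"
      by blast
    then have "{b, c} \<subseteq> {x, y, z}" "v \<in> {x, y, z}" "v \<noteq> b" "v \<noteq> c"
      using xyz by auto
    then have "{x, y, z} = {v, b, c}"
      using v by auto
    moreover have "chi v b c = 0"
      using w \<open>v \<in> {x, y, z}\<close> by blast
    moreover have "chi x y z = chi v b c \<or> chi x y z = - chi v b c" if "{x, y, z} = {v, b, c}"
    proof -
      have vA: "v \<in> ?A"
        using \<open>v \<in> {x, y, z}\<close> abc by blast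
      have "(x, y, z) \<in> {(v, b, c), (v, c, b), (b, v, c), (b, c, v), (c, v, b), (c, b, v)}"
      proof -
        have "x \<in> {v, b, c}" "y \<in> {v, b, c}" "z \<in> {v, b, c}"
          using that by blast+
        then show ?thesis
          using xyz by (elim insertE emptyE) simp_all
      qed
      moreover have "chi b v c = - chi v b c" "chi v c b = - chi v b c"
          "chi b c v = chi v b c" "chi c v b = chi v b c" "chi c b v = - chi v b c"
        using alt[OF vA abc(2,3)] alt[OF abc(2) vA abc(3)] alt[OF vA abc(3,2)] alt[OF abc(3) vA abc(2)]
        by linarith+
      ultimately show ?thesis
        by auto
    qed
    ultimately show False
      using abc by auto
  qed
  have "chirotope3 ?A chi"
    unfolding chirotope3_def
  proof (intro conjI)
    show "\<forall>a\<in>?A. \<forall>b\<in>?A. \<forall>c\<in>?A.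
        chi a b c \<in> {-1, 0, 1} \<and> chi b a c = - chi a b c \<and> chi a c b = - chi a b c"
      using alt by blast
    show "\<exists>a\<in>?A. \<exists>b\<in>?A. \<exists>c\<in>?A. chi a b c \<noteq> 0"
      by (rule basis)
    show "\<forall>a\<in>?A. \<forall>b\<in>?A. \<forall>c\<in>?A. \<forall>x\<in>?A. \<forall>y\<in>?A. \<forall>z\<in>?A.
        chi a b c \<noteq> 0 \<and> chi x y z \<noteq> 0 \<longrightarrow> (\<exists>w\<in>{x, y, z}. chi w b c \<noteq> 0)"
      using exchange by blast
    show "\<forall>a\<in>?A. \<forall>b\<in>?A. \<forall>c\<in>?A. \<forall>d\<in>?A. \<forall>e\<in>?A.
        (let T = {chi a b c * chi a d e, - (chi a b d * chi a c e), chi a b e * chi a c d}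
        in T = {0} \<or> {-1, 1} \<subseteq> T)"
      using gp by blast
  qed
  moreover have "of_int (chi i j k) = arrangement_chirotope t i j k" if "i \<in> {1..n}" "j \<in> {1..n}" "k \<in> {1..n}" for i j k
    using old[OF that] arrangement_chirotope_eq[OF t that] by simp
  moreover have "\<sigma> {i, j} = chi i j ?p" if "i \<in> {1..n}" "j \<in> {1..n}" "i < j" for i j
    using new(1)[OF that(1,2)] that by (simp add: dir_less)
  ultimately show ?thesis
    unfolding extension_labeling_def by blast
qed

section \<open>Facial intervals\<close>

text \<open>The three-term condition for the labeling with \<open>-\<close> on \<open>E\<close>, \<open>0\<close> on \<open>F - E\<close> and \<open>+\<close> outside \<open>F\<close>, for \<open>E\<close>
  contained in \<open>F\<close>. Either all three signs are zero, or \<open>+\<close> and \<open>-\<close> both occur among the first sign, the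
  negated second and the third.\<close>

definition localized_pair :: "nat \<Rightarrow> (nat \<Rightarrow> nat \<Rightarrow> bool) \<Rightarrow> (nat \<Rightarrow> nat \<Rightarrow> bool) \<Rightarrow> bool" where
  "localized_pair n E F \<longleftrightarrow> (\<forall>i c d e. 1 \<le> i \<and> i \<le> n \<and> 1 \<le> c \<and> c < d \<and> d < e \<and> e \<le> n \<and> i \<noteq> c \<and> i \<noteq> d \<and> i \<noteq> e \<longrightarrow>
     (F i c \<and> F i d \<and> F i e \<and> \<not> E i c \<and> \<not> E i d \<and> \<not> E i e) \<or>
     ((\<not> F i c \<or> E i d \<or> \<not> F i e) \<and> (E i c \<or> \<not> F i d \<or> E i e)))"

definition label_graph :: "nat \<Rightarrow> (nat set \<Rightarrow> int) \<Rightarrow> int set \<Rightarrow> nat \<Rightarrow> nat \<Rightarrow> bool" where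
  "label_graph n \<sigma> S i j \<longleftrightarrow> i \<noteq> j \<and> i \<in> {1..n} \<and> j \<in> {1..n} \<and> \<sigma> {i, j} \<in> S"

definition pair_labeling :: "nat \<Rightarrow> nat set set \<Rightarrow> nat set set \<Rightarrow> nat set \<Rightarrow> int" where
  "pair_labeling n I J e = (if {1..n} - e \<in> I then -1 else if {1..n} - e \<in> J then 0 else 1)"

text \<open>Replacing all zeros by \<open>+\<close>, or all by \<open>-\<close>, preserves the row condition: a violation would require that
  the first sign, the negated second and the third are weakly of one sign and not all zero.\<close>

lemma coconsistent_label_graph:
  assumes loc: "localized n \<sigma>" and S: "S = {-1} \<or> S = {-1, 0}"
  shows "coconsistent n (label_graph n \<sigma> S)"
proof -
  let ?G = "label_graph n \<sigma> S"
  have row: "sign_balanced (\<sigma> {i, c}) (- \<sigma> {i, d}) (\<sigma> {i, e})"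
    if "i \<in> {1..n}" "1 \<le> c" "c < d" "d < e" "e \<le> n" "i \<noteq> c" "i \<noteq> d" "i \<noteq> e" for i c d e
    using loc that unfolding localized_def by blast
  have val: "\<sigma> {i, j} \<in> {-1, 0, 1}" if "i \<in> {1..n}" "j \<in> {1..n}" "i \<noteq> j" for i j
    using loc pair_in_nsets[OF that] unfolding localized_def by blast
  have "?G i d" if "c < d" "d < e" "d \<noteq> i" "?G i c" "?G i e" for i c d e
  proof -
    have r: "i \<in> {1..n}" "1 \<le> c" "e \<le> n" "i \<noteq> c" "i \<noteq> e" "i \<noteq> d" "d \<in> {1..n}"
      using that by (auto simp: label_graph_def)
    show ?thesis
      using row[of i c d e] val[of i d] that r S by (auto simp: label_graph_def sign_balanced_iff)
  qed
  moreover have "?G i c \<or> ?G i e"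
    if "1 \<le> c" "c < d" "d < e" "e \<le> n" "c \<noteq> i" "e \<noteq> i" "?G i d" for i c d e
  proof -
    have r: "i \<in> {1..n}" "i \<noteq> d" "c \<in> {1..n}" "e \<in> {1..n}"
      using that by (auto simp: label_graph_def)
    show ?thesis
      using row[of i c d e] val[of i c] val[of i e] that r S by (auto simp: label_graph_def sign_balanced_iff)
  qed
  moreover have "?G j i \<and> i \<noteq> j \<and> 1 \<le> i \<and> i \<le> n" if "?G i j" for i j
    using that by (auto simp: label_graph_def insert_commute)
  ultimately show ?thesis
    unfolding coconsistent_def by blast
qed

lemma consistent_of_labeling_eq: "consistent_of_labeling n \<sigma> = set_of n (label_graph n \<sigma> {-1})"
proof
  show "consistent_of_labeling n \<sigma> \<subseteq> set_of n (label_graph n \<sigma> {-1})"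
  proof
    fix A assume "A \<in> consistent_of_labeling n \<sigma>"
    then obtain e where e: "e \<in> nsets {1..n} 2" "\<sigma> e = -1" "A = {1..n} - e"
      by (auto simp: consistent_of_labeling_def)
    obtain i j where "e = {i, j}" "i < j" "i \<in> {1..n}" "j \<in> {1..n}"
      by (rule pair_nsetsE[OF e(1)])
    then have "label_graph n \<sigma> {-1} i j" "A = {1..n} - {i, j}"
      using e by (simp_all add: label_graph_def)
    then show "A \<in> set_of n (label_graph n \<sigma> {-1})"
      unfolding set_of_def by blast
  qed
  show "set_of n (label_graph n \<sigma> {-1}) \<subseteq> consistent_of_labeling n \<sigma>"
  proof
    fix A assume "A \<in> set_of n (label_graph n \<sigma> {-1})"
    then obtain i j where ij: "label_graph n \<sigma> {-1} i j" "A = {1..n} - {i, j}"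
      unfolding set_of_def by blast
    then have "{i, j} \<in> nsets {1..n} 2" "\<sigma> {i, j} = -1"
      using pair_in_nsets[of i n j] by (simp_all add: label_graph_def)
    then show "A \<in> consistent_of_labeling n \<sigma>"
      unfolding consistent_of_labeling_def using ij(2) by blast
  qed
qed

lemma pair_labeling_pair:
  assumes "i \<in> {1..n}" "j \<in> {1..n}" "i \<noteq> j"
  shows "pair_labeling n I J {i, j} = (if graph_of n I i j then -1 else if graph_of n J i j then 0 else 1)"
  using assms by (simp add: pair_labeling_def graph_of_def)

lemma localized_pair_labeling_iff:
  assumes "I \<subseteq> J"
  shows "localized n (pair_labeling n I J) \<longleftrightarrow> localized_pair n (graph_of n I) (graph_of n J)"
proof -
  let ?E = "graph_of n I" and ?F = "graph_of n J"
  have le: "?F i j" if "?E i j" for i j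
    using graph_of_mono[OF assms, of n] that by (auto simp: le_fun_def)
  have "sign_balanced (pair_labeling n I J {i, c}) (- pair_labeling n I J {i, d}) (pair_labeling n I J {i, e}) \<longleftrightarrow>
     (?F i c \<and> ?F i d \<and> ?F i e \<and> \<not> ?E i c \<and> \<not> ?E i d \<and> \<not> ?E i e) \<or>
     ((\<not> ?F i c \<or> ?E i d \<or> \<not> ?F i e) \<and> (?E i c \<or> \<not> ?F i d \<or> ?E i e))"
    if "1 \<le> i \<and> i \<le> n \<and> 1 \<le> c \<and> c < d \<and> d < e \<and> e \<le> n \<and> i \<noteq> c \<and> i \<noteq> d \<and> i \<noteq> e" for i c d e
    using that le[of i c] le[of i d] le[of i e]
    by (simp add: pair_labeling_pair sign_balanced_iff)
  moreover have "pair_labeling n I J e \<in> {-1, 0, 1}" for e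
    by (simp add: pair_labeling_def)
  ultimately show ?thesis
    unfolding localized_def localized_pair_def by (simp only: atLeastAtMost_iff conj_assoc) blast
qed

lemma closed_interval_eq:
  assumes "n \<ge> 4" "I \<in> higher_bruhat n (n - 3)" "J \<in> higher_bruhat n (n - 3)"
  shows "closed_interval n (n - 3) I J = {X \<in> higher_bruhat n (n - 3). I \<subseteq> X \<and> X \<subseteq> J}"
  unfolding closed_interval_def using bruhat_le_iff[OF assms(1)] assms(2,3) by (intro Collect_cong) metis

text \<open>A uniform labeling is given by its negative pairs, and it refines \<open>\<sigma>\<close> if they include the pairs with \<open>-\<close> and
  exclude those with \<open>+\<close>. Both bounds are consistent, so this is a closed interval.\<close>

lemma uniform_refinements_eq:
  assumes n: "n \<ge> 4" and t: "strict_mono_on {1..n} t" and \<sigma>: "localized n \<sigma>"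
  shows "{consistent_of_labeling n \<sigma>' | \<sigma>'. extension_labeling n t \<sigma>' \<and> uniform_labeling n \<sigma>' \<and> refines n \<sigma>' \<sigma>} =
    {X \<in> higher_bruhat n (n - 3).
       set_of n (label_graph n \<sigma> {-1}) \<subseteq> X \<and> X \<subseteq> set_of n (label_graph n \<sigma> {-1, 0})}" (is "?L = ?R")
proof
  have ext: "extension_labeling n t \<rho> \<longleftrightarrow> localized n \<rho>" for \<rho>
    using extension_imp_localized[OF t] localized_imp_extension[OF n t] by blast
  show "?L \<subseteq> ?R"
  proof
    fix X assume "X \<in> ?L"
    then obtain \<rho> where \<rho>: "localized n \<rho>" "uniform_labeling n \<rho>" "refines n \<rho> \<sigma>" "X = set_of n (label_graph n \<rho> {-1})"
      unfolding ext consistent_of_labeling_eq by blast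
    have "label_graph n \<rho> {-1} i j" if "label_graph n \<sigma> {-1} i j" for i j
      using that \<rho>(3) pair_in_nsets[of i n j] by (auto simp: label_graph_def refines_def)
    moreover have "label_graph n \<sigma> {-1, 0} i j" if "label_graph n \<rho> {-1} i j" for i j
      using that \<rho>(3) pair_in_nsets[of i n j] by (force simp: label_graph_def refines_def)
    ultimately have "label_graph n \<sigma> {-1} \<le> label_graph n \<rho> {-1}"
        "label_graph n \<rho> {-1} \<le> label_graph n \<sigma> {-1, 0}"
      by (simp_all only: le_fun_def le_bool_def) blast+
    then have "set_of n (label_graph n \<sigma> {-1}) \<subseteq> X" "X \<subseteq> set_of n (label_graph n \<sigma> {-1, 0})"
      unfolding \<rho>(4) by (simp_all only: set_of_mono)
    moreover have "X \<in> higher_bruhat n (n - 3)"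
      unfolding \<rho>(4) by (intro set_of_in_higher_bruhat[OF n] coconsistent_label_graph[OF \<rho>(1)]) simp
    ultimately show "X \<in> ?R"
      by blast
  qed
  show "?R \<subseteq> ?L"
  proof
    fix X assume X: "X \<in> ?R"
    let ?\<rho> = "pair_labeling n X X"
    have co: "coconsistent n (graph_of n X)"
      using X higher_bruhat_iff[OF n] by blast
    have "localized_pair n (graph_of n X) (graph_of n X)"
      unfolding localized_pair_def
    proof (intro allI impI)
      fix i c d e assume h: "1 \<le> i \<and> i \<le> n \<and> 1 \<le> c \<and> c < d \<and> d < e \<and> e \<le> n \<and> i \<noteq> c \<and> i \<noteq> d \<and> i \<noteq> e"
      then show "graph_of n X i c \<and> graph_of n X i d \<and> graph_of n X i e \<and> \<not> graph_of n X i c \<and> \<not> graph_of n X i d \<and> \<not> graph_of n X i e \<or>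
        (\<not> graph_of n X i c \<or> graph_of n X i d \<or> \<not> graph_of n X i e) \<and> (graph_of n X i c \<or> \<not> graph_of n X i d \<or> graph_of n X i e)"
        using coc_in[OF co, of i c e d] coc_out[OF co, of i d c e] by auto
    qed
    then have loc: "localized n ?\<rho>"
      by (simp add: localized_pair_labeling_iff)
    have uni: "uniform_labeling n ?\<rho>"
      by (simp add: uniform_labeling_def pair_labeling_def)
    have graph: "label_graph n ?\<rho> {-1} = graph_of n X"
      by (auto simp: fun_eq_iff label_graph_def pair_labeling_def graph_of_def)
    have "graph_of n (set_of n (label_graph n \<sigma> S)) = label_graph n \<sigma> S" if "S = {-1} \<or> S = {-1, 0}" for S
      using that by (intro graph_of_set_of coconsistent_label_graph[OF \<sigma>])
    then have low: "label_graph n \<sigma> {-1} \<le> graph_of n X" and up: "graph_of n X \<le> label_graph n \<sigma> {-1, 0}"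
      using X graph_of_mono[of "set_of n (label_graph n \<sigma> {-1})" X n]
        graph_of_mono[of X "set_of n (label_graph n \<sigma> {-1, 0})" n] by simp_all
    have "refines n ?\<rho> \<sigma>"
      unfolding refines_def
    proof (intro ballI impI)
      fix e assume e: "e \<in> nsets {1..n} 2" "\<sigma> e \<noteq> 0"
      obtain i j where ij: "e = {i, j}" "i < j" "i \<in> {1..n}" "j \<in> {1..n}"
        by (rule pair_nsetsE[OF e(1)])
      have "\<sigma> e \<in> {-1, 0, 1}"
        using \<sigma> e(1) unfolding localized_def by blast
      then show "?\<rho> e = \<sigma> e"
      proof -
        have lg: "label_graph n \<sigma> S i j \<longleftrightarrow> \<sigma> e \<in> S" for S
          using ij by (simp add: label_graph_def)
        have "\<sigma> e = -1 \<Longrightarrow> graph_of n X i j" "graph_of n X i j \<Longrightarrow> \<sigma> e = -1"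
          using le_funD[OF le_funD[OF low], of i j] le_funD[OF le_funD[OF up], of i j] e(2)
          unfolding lg le_bool_def by blast+
        moreover have "?\<rho> e = (if graph_of n X i j then -1 else 1)"
          using pair_labeling_pair[OF ij(3,4), of X X] ij(1,2) by simp
        ultimately show ?thesis
          using \<open>\<sigma> e \<in> {-1, 0, 1}\<close> e(2) by auto
      qed
    qed
    moreover have "consistent_of_labeling n ?\<rho> = X"
      using X set_of_graph_of[OF n] by (simp add: consistent_of_labeling_eq graph)
    ultimately show "X \<in> ?L"
      using loc uni unfolding ext by blast
  qed
qed

text \<open>A facial interval determines its ends, hence its labeling: the bounds in \<open>uniform_refinements_eq\<close> are
  themselves elements.\<close>

lemma facial_interval_iff:
  assumes n: "n \<ge> 4" and t: "strict_mono_on {1..n} t"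
    and I: "I \<in> higher_bruhat n (n - 3)" and J: "J \<in> higher_bruhat n (n - 3)" and IJ: "I \<subset> J"
  shows "facial_interval n t I J \<longleftrightarrow> localized_pair n (graph_of n I) (graph_of n J)"
proof
  have ext: "extension_labeling n t \<rho> \<longleftrightarrow> localized n \<rho>" for \<rho>
    using extension_imp_localized[OF t] localized_imp_extension[OF n t] by blast
  note closed = closed_interval_eq[OF n I J]
  show "localized_pair n (graph_of n I) (graph_of n J)" if "facial_interval n t I J"
  proof -
    obtain \<sigma> where \<sigma>: "localized n \<sigma>" and eq: "closed_interval n (n - 3) I J =
        {consistent_of_labeling n \<sigma>' | \<sigma>'. extension_labeling n t \<sigma>' \<and> uniform_labeling n \<sigma>' \<and> refines n \<sigma>' \<sigma>}"
      using \<open>facial_interval n t I J\<close> unfolding facial_interval_def ext by blast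
    let ?E = "label_graph n \<sigma> {-1}" and ?F = "label_graph n \<sigma> {-1, 0}"
    have E: "coconsistent n ?E" and F: "coconsistent n ?F"
      by (rule coconsistent_label_graph[OF \<sigma>]; simp)+
    have "?E \<le> ?F"
      by (auto simp: label_graph_def)
    then have "set_of n ?E \<subseteq> set_of n ?F"
      by (rule set_of_mono)
    moreover note set_of_in_higher_bruhat[OF n E] set_of_in_higher_bruhat[OF n F]
    ultimately have "I = set_of n ?E" "J = set_of n ?F"
      using eq IJ I J unfolding closed uniform_refinements_eq[OF n t \<sigma>] by blast+
    then have graphs: "graph_of n I = ?E" "graph_of n J = ?F"
      using graph_of_set_of E F by simp_all
    have val: "\<sigma> {i, j} \<in> {-1, 0, 1}" if "i \<in> {1..n}" "j \<in> {1..n}" "i \<noteq> j" for i j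
      using \<sigma> pair_in_nsets[OF that] unfolding localized_def by blast
    have "pair_labeling n I J e = \<sigma> e" if "e \<in> nsets {1..n} 2" for e
    proof -
      note e = that
      obtain i j where ij: "e = {i, j}" "i < j" "i \<in> {1..n}" "j \<in> {1..n}"
        by (rule pair_nsetsE[OF e])
      then show ?thesis
        using val[of i j] by (auto simp: pair_labeling_pair graphs label_graph_def)
    qed
    then have "localized n (pair_labeling n I J)"
      using \<sigma> pair_in_nsets unfolding localized_def by simp
    then show ?thesis
      using localized_pair_labeling_iff IJ by blast
  qed
  show "facial_interval n t I J" if "localized_pair n (graph_of n I) (graph_of n J)"
  proof -
    let ?\<sigma> = "pair_labeling n I J"
    have \<sigma>: "localized n ?\<sigma>"
      using that localized_pair_labeling_iff IJ by blast
    have "graph_of n I i j \<Longrightarrow> graph_of n J i j" for i j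
      using graph_of_mono[of I J n] IJ by (auto simp: le_fun_def)
    then have "label_graph n ?\<sigma> {-1} = graph_of n I" "label_graph n ?\<sigma> {-1, 0} = graph_of n J"
      by (auto simp: fun_eq_iff label_graph_def pair_labeling_def graph_of_def)
    then have "closed_interval n (n - 3) I J =
        {consistent_of_labeling n \<sigma>' | \<sigma>'. extension_labeling n t \<sigma>' \<and> uniform_labeling n \<sigma>' \<and> refines n \<sigma>' ?\<sigma>}"
      unfolding uniform_refinements_eq[OF n t \<sigma>] closed using set_of_graph_of[OF n] I J by simp
    moreover have "\<not> uniform_labeling n ?\<sigma>"
    proof -
      obtain A where A: "A \<in> J" "A \<notin> I"
        using IJ by blast
      then have "A \<in> set_of n (graph_of n J)"
        using set_of_graph_of[OF n J] by simp
      then obtain i j where ij: "graph_of n J i j" "A = {1..n} - {i, j}"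
        by (auto simp: set_of_def)
      then have "?\<sigma> {i, j} = 0" "{i, j} \<in> nsets {1..n} 2"
        using A pair_in_nsets by (auto simp: pair_labeling_def graph_of_def)
      then show ?thesis
        unfolding uniform_labeling_def by blast
    qed
    ultimately show ?thesis
      unfolding facial_interval_def ext using \<sigma> by blast
  qed
qed

section \<open>Spheres in the facial case\<close>

text \<open>The set \<open>S\<close> stands for the atoms. If there is only one, the open interval is empty.\<close>

lemma sphere_or_empty:
  fixes f :: "'a::order \<Rightarrow> 'b set"
  assumes fin: "finite P" "finite S" and "S \<noteq> {}"
    and f: "f ` P \<subseteq> proper_subsets S" "mono_on P f"
    and g: "g ` proper_subsets S \<subseteq> P" "mono_on (proper_subsets S) g"
    and gf: "\<And>p. p \<in> P \<Longrightarrow> g (f p) \<le> p"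
    and fg: "\<And>T. T \<in> proper_subsets S \<Longrightarrow> f (g T) = T"
  shows "P = {} \<or> (\<exists>k. poset_space P homotopy_equivalent_space nsphere k)"
proof (cases "card S = 1")
  case True
  then obtain s where "S = {s}"
    by (auto simp: card_1_singleton_iff)
  then have "proper_subsets S = {}"
    by (auto simp: proper_subsets_def)
  then show ?thesis
    using f(1) by auto
next
  case False
  have "card S \<noteq> 0"
    using fin(2) \<open>S \<noteq> {}\<close> by simp
  then have "card S = (card S - 2) + 2"
    using False by simp
  then have "poset_space (proper_subsets S) homotopy_equivalent_space nsphere (card S - 2)"
    by (rule proper_subsets_sphere)
  then show ?thesis
    using poset_homotopy_equivalence[OF fin(1) finite_proper_subsets[OF fin(2)] f g gf fg]
      homotopy_eqv_trans by blast
qed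

lemma less_rel_iff: "E < F \<longleftrightarrow> (\<forall>i j. E i j \<longrightarrow> F i j) \<and> (\<exists>i j. F i j \<and> \<not> E i j)"
  for E F :: "'a \<Rightarrow> 'b \<Rightarrow> bool"
  by (auto simp: less_le_not_le le_fun_def)

lemma in_graphs_between:
  "X \<in> graphs_between n E F \<longleftrightarrow> coconsistent n X \<and> (\<forall>i j. E i j \<longrightarrow> X i j) \<and> (\<exists>i j. X i j \<and> \<not> E i j) \<and>
     (\<forall>i j. X i j \<longrightarrow> F i j) \<and> (\<exists>i j. F i j \<and> \<not> X i j)"
  by (auto simp: graphs_between_def less_rel_iff)

text \<open>The zeros of the labeling.\<close>

definition gap :: "(nat \<Rightarrow> nat \<Rightarrow> bool) \<Rightarrow> (nat \<Rightarrow> nat \<Rightarrow> bool) \<Rightarrow> nat \<Rightarrow> nat \<Rightarrow> bool" where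
  "gap E F i j \<longleftrightarrow> F i j \<and> \<not> E i j"

lemma localized_pairD:
  assumes "localized_pair n E F" "1 \<le> i" "i \<le> n" "1 \<le> c" "c < d" "d < e" "e \<le> n" "i \<noteq> c" "i \<noteq> d" "i \<noteq> e"
  shows "gap E F i c \<and> gap E F i d \<and> gap E F i e \<or>
     (\<not> F i c \<or> E i d \<or> \<not> F i e) \<and> (E i c \<or> \<not> F i d \<or> E i e)"
  using assms unfolding localized_pair_def gap_def by blast

lemma localized_addable:
  assumes loc: "localized_pair n E F" and F: "coconsistent n F" and sub: "\<And>i j. E i j \<Longrightarrow> F i j"
    and j: "gap E F i j" and uniq: "\<And>k. gap E F i k \<Longrightarrow> k = j"
  shows "addable n E i j"
proof -
  have Fj: "F i j" and Ej: "\<not> E i j"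
    using j by (auto simp: gap_def)
  note r = coc_edge[OF F Fj]
  have rng: "1 \<le> x" "x \<le> n" if "E i x" for x
    using coc_edge[OF F sub[OF that]] by auto
  have iff: "F i x \<longleftrightarrow> E i x" if "x \<noteq> j" for x
    using uniq[of x] sub[of i x] that by (auto simp: gap_def)
  have "E i c \<or> E i e" if "c < j" "j < e" "c \<noteq> i" "e \<noteq> i" "1 \<le> c" "e \<le> n" for c e
    using localized_pairD[OF loc, of i c j e] that r Fj Ej uniq[of c] by auto
  moreover have "E i d" if "j < d" "d < e" "d \<noteq> i" "E i e" for d e
    using localized_pairD[OF loc, of i j d e] that r Fj Ej rng[of e] iff[of e] coc_edge[OF F sub[OF that(4)]] by (auto simp: gap_def)
  moreover have "E i d" if "c < d" "d < j" "d \<noteq> i" "E i c" for c d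
    using localized_pairD[OF loc, of i c d j] that r Fj Ej rng[of c] iff[of c] coc_edge[OF F sub[OF that(4)]] by (auto simp: gap_def)
  ultimately show ?thesis
    unfolding addable_def using r Ej by blast
qed

text \<open>Two zeros in a row force all others in the row to be zero.\<close>

lemma localized_gap_row:
  assumes loc: "localized_pair n E F" and F: "coconsistent n F" and sub: "\<And>i j. E i j \<Longrightarrow> F i j"
    and jk: "gap E F i j" "gap E F i k" "j \<noteq> k" and x: "1 \<le> x" "x \<le> n" "x \<noteq> i"
  shows "gap E F i x"
proof -
  have r: "1 \<le> i" "i \<le> n" "1 \<le> j" "j \<le> n" "i \<noteq> j" "1 \<le> k" "k \<le> n" "i \<noteq> k"
    using jk coc_edge[OF F, of i j] coc_edge[OF F, of i k] by (auto simp: gap_def)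
  have third: "gap E F i c \<and> gap E F i d \<and> gap E F i e"
    if "1 \<le> c" "c < d" "d < e" "e \<le> n" "i \<noteq> c" "i \<noteq> d" "i \<noteq> e"
      "gap E F i c \<and> gap E F i d \<or> gap E F i c \<and> gap E F i e \<or> gap E F i d \<and> gap E F i e" for c d e
    using localized_pairD[OF loc r(1,2) that(1-7)] that(8) sub[of i c] sub[of i d] sub[of i e]
    unfolding gap_def by blast
  have *: "gap E F i x" if "j < k" "gap E F i j" "gap E F i k" "1 \<le> j" "k \<le> n" "i \<noteq> j" "i \<noteq> k" for j k
  proof -
    consider "x = j \<or> x = k" | "x < j" | "j < x" "x < k" | "k < x"
      by linarith
    then show ?thesis
    proof cases
      case 2
      then show ?thesis
        using third[of x j k] that x by auto
    next
      case 3
      then show ?thesis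
        using third[of j x k] that x by auto
    next
      case 4
      then show ?thesis
        using third[of j k x] that x by auto
    qed (use that in auto)
  qed
  show ?thesis
    using *[of j k] *[of k j] jk r by (cases "j < k") auto
qed

text \<open>If the zeros form a matching, each of them can be added to \<open>E\<close> independently of the others, and the
  interval is a Boolean lattice.\<close>

lemma localized_matching_sphere:
  assumes n: "n \<ge> 4" and E: "coconsistent n E" and F: "coconsistent n F" and EF: "E < F"
    and loc: "localized_pair n E F" and matching: "\<And>i j k. gap E F i j \<Longrightarrow> gap E F i k \<Longrightarrow> j = k"
  shows "graphs_between n E F = {} \<or>
    (\<exists>k. poset_space (graphs_between n E F) homotopy_equivalent_space nsphere k)"
proof -
  have sub: "E i j \<Longrightarrow> F i j" for i j
    using EF by (auto simp: less_rel_iff)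
  define S where "S = {{i, j} | i j. gap E F i j}"
  define f where "f = (\<lambda>X. {{i, j} | i j. gap E F i j \<and> X i j})"
  define g where "g = (\<lambda>T i j. E i j \<or> {i, j} \<in> T)"
  have gap_sym: "gap E F i j \<Longrightarrow> gap E F j i" for i j
    using coc_sym[OF E] coc_sym[OF F] by (auto simp: gap_def)
  have gapS: "{i, j} \<in> S \<longleftrightarrow> gap E F i j" for i j
    using gap_sym by (auto simp: S_def doubleton_eq_iff)
  have f_iff: "{i, j} \<in> f X \<longleftrightarrow> gap E F i j \<and> X i j" if "coconsistent n X" for X i j
    using gap_sym coc_sym[OF that] by (auto simp: f_def doubleton_eq_iff)
  have SE: "\<exists>i j. e = {i, j} \<and> gap E F i j" if "e \<in> S" for e
    using that by (auto simp: S_def)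
  show ?thesis
  proof (rule sphere_or_empty[where f = f and g = g])
    show "finite (graphs_between n E F)"
      by (rule finite_graphs_between[OF n])
    have "S \<subseteq> Pow {1..n}"
      using coc_edge[OF F] by (fastforce simp: S_def gap_def)
    then show "finite S"
      by (rule finite_subset) simp
    show "S \<noteq> {}"
      using EF gapS by (auto simp: less_rel_iff gap_def)
    show "f ` graphs_between n E F \<subseteq> proper_subsets S"
    proof
      fix T assume "T \<in> f ` graphs_between n E F"
      then obtain X where X: "T = f X" "X \<in> graphs_between n E F"
        by blast
      note X' = X(2)[unfolded in_graphs_between]
      have "f X \<subseteq> S"
        by (auto simp: f_def S_def)
      moreover obtain a b where "X a b" "\<not> E a b"
        using X' by blast
      then have "{a, b} \<in> f X"
        using X' f_iff[of X a b] by (auto simp: gap_def)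
      moreover obtain c d where "F c d" "\<not> X c d"
        using X' by blast
      then have "{c, d} \<in> S" "{c, d} \<notin> f X"
        using X' f_iff[of X c d] gapS by (auto simp: gap_def)
      ultimately show "T \<in> proper_subsets S"
        unfolding proper_subsets_def X(1) by blast
    qed
    show "mono_on (graphs_between n E F) f"
      unfolding mono_on_def f_def le_fun_def le_bool_def by blast
    have g_in: "g T \<in> graphs_between n E F" if "T \<in> proper_subsets S" for T
    proof -
      have T: "T \<subseteq> S" "T \<noteq> {}" "T \<noteq> S"
        using that by (auto simp: proper_subsets_def)
      have "coconsistent n (g T)"
        unfolding g_def
      proof (rule coconsistent_add_matching[OF E])
        fix i j assume "{i, j} \<in> T"
        then have "gap E F i j"
          using T gapS by blast
        then show "{j, i} \<in> T \<and> addable n E i j"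
          using \<open>{i, j} \<in> T\<close> localized_addable[OF loc F sub] matching by (auto simp: insert_commute)
      next
        fix i j k assume "{i, j} \<in> T" "{i, k} \<in> T"
        then show "j = k"
          using T gapS matching by blast
      qed
      moreover obtain e where "e \<in> T"
        using T by blast
      then obtain a b where "e = {a, b}" "gap E F a b"
        using T SE by blast
      moreover obtain e' where "e' \<in> S" "e' \<notin> T"
        using T by blast
      then obtain c d where "e' = {c, d}" "gap E F c d"
        using SE by blast
      ultimately show ?thesis
        using T \<open>e \<in> T\<close> \<open>e' \<notin> T\<close> gapS sub unfolding in_graphs_between g_def gap_def by blast
    qed
    then show "g ` proper_subsets S \<subseteq> graphs_between n E F"
      by blast
    show "mono_on (proper_subsets S) g"
      unfolding mono_on_def g_def le_fun_def le_bool_def by blast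
    show "g (f X) \<le> X" if "X \<in> graphs_between n E F" for X
      using that f_iff unfolding in_graphs_between g_def le_fun_def le_bool_def by blast
    show "f (g T) = T" if "T \<in> proper_subsets S" for T
    proof -
      have T: "T \<subseteq> S"
        using that by (auto simp: proper_subsets_def)
      have "{i, j} \<in> T \<Longrightarrow> gap E F i j" for i j
        using T gapS by blast
      then have "f (g T) \<subseteq> T"
        unfolding f_def g_def gap_def by auto
      moreover have "T \<subseteq> f (g T)"
        using T SE unfolding f_def g_def by blast
      ultimately show ?thesis
        by blast
    qed
  qed
qed

text \<open>If the zeros are the pairs at \<open>i\<close>, the elements between \<open>E\<close> and \<open>F\<close> are given by a segment of the row of \<open>i\<close>.
  They form two chains, one for beginning and one for ending segments, and each chain starts at one of the two
  atoms.\<close>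

lemma localized_star_sphere:
  assumes n: "n \<ge> 4" and E: "coconsistent n E" and F: "coconsistent n F" and EF: "E < F"
    and loc: "localized_pair n E F" and i: "1 \<le> i" "i \<le> n"
    and row: "\<And>x. 1 \<le> x \<Longrightarrow> x \<le> n \<Longrightarrow> x \<noteq> i \<Longrightarrow> gap E F i x"
    and only: "\<And>a b. gap E F a b \<Longrightarrow> a = i \<or> b = i"
  shows "graphs_between n E F = {} \<or>
    (\<exists>k. poset_space (graphs_between n E F) homotopy_equivalent_space nsphere k)"
proof -
  have sub: "E i j \<Longrightarrow> F i j" for i j
    using EF by (auto simp: less_rel_iff)
  have sym: "E a b \<Longrightarrow> E b a" "F a b \<Longrightarrow> F b a" for a b
    using coc_sym[OF E] coc_sym[OF F] by blast+
  define l where "l = (if i = 1 then 2 else (1::nat))"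
  define u where "u = (if i = n then n - 1 else n)"
  have lu: "1 \<le> l" "l < u" "u \<le> n" "l \<noteq> i" "u \<noteq> i"
    and lu_ext: "\<And>x. 1 \<le> x \<Longrightarrow> x \<le> n \<Longrightarrow> x \<noteq> i \<Longrightarrow> l \<le> x \<and> x \<le> u"
    using n i by (auto simp: l_def u_def)
  define f where "f = (\<lambda>X. {x \<in> {l, u}. X i x})"
  define g where "g = (\<lambda>T a b. E a b \<or> a = i \<and> b \<in> T \<or> b = i \<and> a \<in> T)"
  have empty: "\<not> E i x" for x
    using row[of x] coc_edge[OF E, of i x] by (auto simp: gap_def)
  have full: "X i l \<Longrightarrow> X i u \<Longrightarrow> 1 \<le> x \<Longrightarrow> x \<le> n \<Longrightarrow> x \<noteq> i \<Longrightarrow> X i x" if "coconsistent n X" for X x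
    using coc_in[OF that, of i l u x] lu_ext[of x] by (metis le_neq_implies_less)
  have part: "X i x \<Longrightarrow> X i l \<or> X i u" if "coconsistent n X" for X x
    using coc_out[OF that, of i x l u] lu_ext[of x] coc_edge[OF that, of i x] lu
    by (metis le_neq_implies_less)
  have add: "addable n E x i" if "x = l \<or> x = u" for x
  proof (rule localized_addable[OF loc F sub])
    have x: "1 \<le> x" "x \<le> n" "x \<noteq> i"
      using that lu by auto
    show "gap E F x i"
      using row[OF x] sym by (auto simp: gap_def)
    show "k = i" if "gap E F x k" for k
      using only[OF that] x by blast
  qed
  have add': "addable n E i x" if "x = l \<or> x = u" for x
    using that empty lu i lu_ext
    by (intro addable_empty_row) (auto, (metis leD less_le_trans less_imp_le le_trans)+)
  show ?thesis
  proof (rule sphere_or_empty[where f = f and g = g and S = "{l, u}"])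
    show "finite (graphs_between n E F)"
      by (rule finite_graphs_between[OF n])
    have proper: "T \<in> proper_subsets {l, u} \<longleftrightarrow> T = {l} \<or> T = {u}" for T
      using lu by (auto simp: proper_subsets_def)
    show "f ` graphs_between n E F \<subseteq> proper_subsets {l, u}"
    proof
      fix T assume "T \<in> f ` graphs_between n E F"
      then obtain X where X: "T = f X" "X \<in> graphs_between n E F"
        by blast
      note X' = X(2)[unfolded in_graphs_between]
      have co: "coconsistent n X"
        using X' by blast
      obtain a b where "X a b" "\<not> E a b"
        using X' by blast
      then have "a = i \<or> b = i"
        using only[of a b] X' by (auto simp: gap_def)
      then have "X i l \<or> X i u"
        using part[OF co] \<open>X a b\<close> coc_sym[OF co] by blast
      moreover obtain c d where "F c d" "\<not> X c d"
        using X' by blast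
      then have "gap E F c d" "1 \<le> c" "c \<le> n" "1 \<le> d" "d \<le> n" "c \<noteq> d"
        using X' coc_edge[OF F] by (auto simp: gap_def)
      then have "\<not> (X i l \<and> X i u)"
        using only[of c d] full[OF co] \<open>\<not> X c d\<close> coc_sym[OF co] by metis
      ultimately show "T \<in> proper_subsets {l, u}"
        unfolding proper X(1) f_def by auto
    qed
    show "mono_on (graphs_between n E F) f"
      unfolding mono_on_def f_def le_fun_def le_bool_def by blast
    have g_in: "g {x} \<in> graphs_between n E F" if "x = l \<or> x = u" for x
    proof -
      have "g {x} = add_edge i x E"
        by (intro ext) (auto simp: g_def add_edge_def doubleton_eq_iff)
      then have "coconsistent n (g {x})"
        using coconsistent_add_edge[OF E add'[OF that] add[OF that]] by simp
      moreover have "F i l" "F i u" "\<not> E i x"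
        using row[of l] row[of u] lu empty by (auto simp: gap_def)
      moreover have "\<not> g {x} i l \<or> \<not> g {x} i u"
        using that lu empty by (auto simp: g_def)
      ultimately show ?thesis
        using that sub sym lu unfolding in_graphs_between g_def by (auto; metis)
    qed
    then show "g ` proper_subsets {l, u} \<subseteq> graphs_between n E F"
      using proper by auto
    show "mono_on (proper_subsets {l, u}) g"
      unfolding mono_on_def g_def le_fun_def le_bool_def by blast
    show "g (f X) \<le> X" if "X \<in> graphs_between n E F" for X
      using that coc_sym[of n X] unfolding in_graphs_between g_def f_def le_fun_def le_bool_def by auto
    show "f (g T) = T" if "T \<in> proper_subsets {l, u}" for T
      using that lu empty unfolding proper f_def g_def by auto
  qed auto
qed

text \<open>The whole poset has the three atoms \<open>12\<close>, \<open>1n\<close> and \<open>(n - 1)n\<close>. The join of the first two consists of the edges at \<open>1\<close>,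
  that of the last two of the edges at \<open>n\<close>, the other two atoms are disjoint, and all three atoms
  together generate the complete graph.\<close>

lemma whole_sphere:
  assumes n: "n \<ge> 4" and E: "\<And>a b. \<not> E a b" and F: "\<And>a b. F a b \<longleftrightarrow> a \<noteq> b \<and> a \<in> {1..n} \<and> b \<in> {1..n}"
  shows "graphs_between n E F = {} \<or>
    (\<exists>k. poset_space (graphs_between n E F) homotopy_equivalent_space nsphere k)"
proof -
  define S where "S = {{1, 2}, {1, n}, {n - 1, n}}"
  define f where "f = (\<lambda>X. {{i, j} | i j. {i, j} \<in> S \<and> X i j})"
  \<comment> \<open>The join of the atoms in \<open>T\<close>.\<close>
  define g where "g = (\<lambda>T i j. {i, j} \<in> T \<or>
    {1, 2} \<in> T \<and> {1, n} \<in> T \<and> star n 1 i j \<or> {1, n} \<in> T \<and> {n - 1, n} \<in> T \<and> star n n i j)"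
  have ne: "{1, 2} \<noteq> {1, n}" "{1, n} \<noteq> {n - 1, n}" "{1, 2} \<noteq> {n - 1, n}"
    using n by (auto simp: doubleton_eq_iff)
  have f_iff: "{i, j} \<in> f X \<longleftrightarrow> {i, j} \<in> S \<and> X i j" if "coconsistent n X" for X i j
    using coc_sym[OF that] by (auto simp: f_def doubleton_eq_iff insert_commute)
  have star_co: "coconsistent n (star n v)" if "v = 1 \<or> v = n" for v
    using that n unfolding coconsistent_def star_def by auto
  have star1: "X a b" if X: "coconsistent n X" "X 1 2" "X 1 n" "star n 1 a b" for X a b
  proof -
    have "X 1 x" if "2 \<le> x" "x \<le> n" for x
      using coc_in[OF X(1-3), of x] that X by (cases "x = 2"; cases "x = n") auto
    then show ?thesis
      using X(4) coc_sym[OF X(1)] by (auto simp: star_def)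
  qed
  have starn: "X a b" if X: "coconsistent n X" "X n 1" "X n (n - 1)" "star n n a b" for X a b
  proof -
    have "X n x" if "1 \<le> x" "x < n" for x
      using coc_in[OF X(1-3), of x] that X by (cases "x = 1"; cases "x = n - 1") auto
    then show ?thesis
      using X(4) coc_sym[OF X(1)] by (auto simp: star_def)
  qed
  have SF: "\<exists>i j. e = {i, j} \<and> F i j" if "e \<in> S" for e
  proof -
    have "F 1 2" "F 1 n" "F (n - 1) n"
      using n by (auto simp: F)
    then show ?thesis
      using that unfolding S_def by blast
  qed
  have g_atom: "{i, j} \<in> T" if "T \<subseteq> S" "{i, j} \<in> S" "g T i j" for T i j
  proof -
    have n1: "n - 1 \<noteq> 1" "n \<noteq> 1" "n - 1 \<noteq> n" "n \<noteq> 2"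
      using n by auto
    have edge: "{i, j} = {1, 2} \<or> {i, j} = {1, n} \<or> {i, j} = {n - 1, n}"
      using that(2) by (simp add: S_def)
    note g = that(3)
    consider "{i, j} \<in> T" | "{1, 2} \<in> T" "{1, n} \<in> T" "star n 1 i j"
      | "{1, n} \<in> T" "{n - 1, n} \<in> T" "star n n i j"
      using g unfolding g_def by blast
    then show ?thesis
    proof cases
      case 2
      then have "{i, j} \<noteq> {n - 1, n}"
        using n1 by (auto simp: star_def doubleton_eq_iff)
      then show ?thesis
        using edge 2(1,2) by (elim disjE) simp_all
    next
      case 3
      then have "{i, j} \<noteq> {1, 2}"
        using n1 by (auto simp: star_def doubleton_eq_iff)
      then show ?thesis
        using edge 3(1,2) by (elim disjE) simp_all
    qed
  qed
  have empty_co: "coconsistent n (\<lambda>_ _. False)"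
    by (simp add: coconsistent_def)
  show ?thesis
  proof (rule sphere_or_empty[where f = f and g = g])
    show "finite (graphs_between n E F)"
      by (rule finite_graphs_between[OF n])
    show "f ` graphs_between n E F \<subseteq> proper_subsets S"
    proof
      fix T assume "T \<in> f ` graphs_between n E F"
      then obtain X where X: "T = f X" "X \<in> graphs_between n E F"
        by blast
      note X' = X(2)[unfolded in_graphs_between]
      have co: "coconsistent n X"
        using X' by blast
      note sym = coc_sym[OF co]
      have "f X \<subseteq> S"
        by (auto simp: f_def)
      moreover have "f X \<noteq> {}"
      proof
        assume "f X = {}"
        then have no: "\<not> X 1 2" "\<not> X 1 n" "\<not> X (n - 1) n" "\<not> X n 1"
          using f_iff[OF co] sym by (auto simp: S_def)
        have 1: "\<not> X 1 x" for x
        proof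
          assume x: "X 1 x"
          then have "x \<noteq> 2" "x \<noteq> n"
            using no by blast+
          then show False
            using coc_out[OF co x, of 2 n] coc_edge[OF co x] no n by auto
        qed
        have n': "\<not> X n x" for x
        proof
          assume x: "X n x"
          then have "x \<noteq> 1" "x \<noteq> n - 1"
            using no sym by blast+
          moreover have "x < n"
            using coc_edge[OF co x] by linarith
          ultimately have "1 < x" "x < n - 1"
            using coc_edge[OF co x] by linarith+
          then show False
            using coc_out[OF co x, of 1 "n - 1"] no sym[of n "n - 1"] n by auto
        qed
        have "\<not> X a b" for a b
        proof
          assume ab: "X a b"
          then have ends: "b \<noteq> 1" "b \<noteq> n" "a \<noteq> 1" "a \<noteq> n" "\<not> X a 1" "\<not> X a n"
            using 1 n' sym by blast+
          then show False
            using coc_out[OF co ab, of 1 n] coc_edge[OF co ab] by auto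
        qed
        then show False
          using X' by blast
      qed
      moreover have "f X \<noteq> S"
      proof
        assume "f X = S"
        then have "X 1 2" "X 1 n" "X (n - 1) n"
          using f_iff[OF co] by (auto simp: S_def)
        then have 1: "X a b" if "star n 1 a b \<or> star n n a b" for a b
          using that star1[OF co] starn[OF co] sym by blast
        have "X a b" if "a \<noteq> b" "a \<in> {1..n}" "b \<in> {1..n}" for a b
        proof (cases "a = 1 \<or> a = n \<or> b = 1 \<or> b = n")
          case True
          then show ?thesis
            using 1[of a b] that n by (auto simp: star_def)
        next
          case False
          then have "X a 1" "X a n"
            using 1[of a 1] 1[of a n] that n by (auto simp: star_def)
          then show ?thesis
            using coc_in[OF co, of a 1 n b] that False by auto
        qed
        then show False
          using X' F by blast
      qed
      ultimately show "T \<in> proper_subsets S"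
        unfolding proper_subsets_def X(1) by blast
    qed
    show "mono_on (graphs_between n E F) f"
      unfolding mono_on_def f_def le_fun_def le_bool_def by blast
    have g_in: "g T \<in> graphs_between n E F" if T: "T \<in> proper_subsets S" for T
    proof -
      have TS: "T \<subseteq> S" "T \<noteq> {}" "T \<noteq> S"
        using T by (auto simp: proper_subsets_def)
      consider (star1) "{1, 2} \<in> T" "{1, n} \<in> T" "{n - 1, n} \<notin> T"
        | (starn) "{1, 2} \<notin> T" "{1, n} \<in> T" "{n - 1, n} \<in> T"
        | (matching) "\<not> ({1, 2} \<in> T \<and> {1, n} \<in> T)" "\<not> ({1, n} \<in> T \<and> {n - 1, n} \<in> T)"
        using TS unfolding S_def by blast
      then have "coconsistent n (g T)"
      proof cases
        case star1
        then have "T = {{1, 2}, {1, n}}"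
          using TS ne unfolding S_def by blast
        then have "g T = star n 1"
          using star1 n by (intro ext) (auto simp: g_def star_def doubleton_eq_iff)
        then show ?thesis
          using star_co by simp
      next
        case starn
        then have "T = {{1, n}, {n - 1, n}}"
          using TS ne unfolding S_def by blast
        then have "g T = star n n"
          using starn n by (intro ext) (auto simp: g_def star_def doubleton_eq_iff)
        then show ?thesis
          using star_co by simp
      next
        case matching
        then have "g T = (\<lambda>i j. False \<or> {i, j} \<in> T)"
          by (intro ext) (auto simp: g_def)
        moreover have "coconsistent n (\<lambda>i j. False \<or> {i, j} \<in> T)"
        proof (rule coconsistent_add_matching[OF empty_co])
          fix i j assume ij: "{i, j} \<in> T"
          then have "{i, j} \<in> S"
            using TS by blast
          then show "{j, i} \<in> T \<and> addable n (\<lambda>_ _. False) i j"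
            using ij n by (auto simp: S_def doubleton_eq_iff insert_commute intro!: addable_empty_row)
        next
          fix i j k assume T2: "{i, j} \<in> T" "{i, k} \<in> T"
          show "j = k"
          proof (rule ccontr)
            assume "j \<noteq> k"
            then have "{i, j} \<noteq> {i, k}"
              by (auto simp: doubleton_eq_iff)
            moreover have "{i, j} \<in> S" "{i, k} \<in> S"
              using T2 TS by blast+
            ultimately have "{i, j} = {1, 2} \<and> {i, k} = {n - 1, n} \<or> {i, j} = {n - 1, n} \<and> {i, k} = {1, 2}"
              using matching T2 unfolding S_def by (elim insertE emptyE) simp_all
            then have "i \<in> {1, 2}" "i \<in> {n - 1, n}"
              by blast+
            then show False
              using n by auto
          qed
        qed
        ultimately show ?thesis
          by simp
      qed
      moreover have "\<exists>i j. g T i j"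
      proof -
        obtain e where "e \<in> T" "e \<in> S"
          using TS by blast
        then show ?thesis
          unfolding S_def g_def by blast
      qed
      moreover have "\<exists>i j. F i j \<and> \<not> g T i j"
      proof -
        obtain e where "e \<in> S" "e \<notin> T"
          using TS by blast
        then obtain i j where "e = {i, j}" "F i j"
          using SF by blast
        then show ?thesis
          using g_atom[OF TS(1), of i j] \<open>e \<in> S\<close> \<open>e \<notin> T\<close> by blast
      qed
      moreover have "F i j" if "g T i j" for i j
        using coc_edge[OF \<open>coconsistent n (g T)\<close> that] by (auto simp: F)
      ultimately show ?thesis
        using E unfolding in_graphs_between by blast
    qed
    then show "g ` proper_subsets S \<subseteq> graphs_between n E F"
      by blast
    show "mono_on (proper_subsets S) g"
      unfolding mono_on_def g_def le_fun_def le_bool_def by blast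
    show "g (f X) \<le> X" if X: "X \<in> graphs_between n E F" for X
    proof -
      have co: "coconsistent n X"
        using X by (simp add: in_graphs_between)
      have "X i j" if "g (f X) i j" for i j
        using that star1[OF co, of i j] starn[OF co, of i j] f_iff[OF co] coc_sym[OF co] unfolding g_def by blast
      then show ?thesis
        by (auto simp: le_fun_def)
    qed
    show "f (g T) = T" if T: "T \<in> proper_subsets S" for T
    proof -
      have TS: "T \<subseteq> S" "T \<noteq> S"
        using T by (auto simp: proper_subsets_def)
      have co: "coconsistent n (g T)"
        using g_in[OF T] by (simp add: in_graphs_between)
      have "f (g T) \<subseteq> T"
        using g_atom[OF TS(1)] by (auto simp: f_def)
      moreover have "e \<in> f (g T)" if "e \<in> T" for e
      proof -
        have "e \<in> S"
          using that TS by blast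
        then obtain i j where "e = {i, j}"
          unfolding S_def by blast
        then show ?thesis
          using that \<open>e \<in> S\<close> f_iff[OF co] by (auto simp: g_def)
      qed
      ultimately show ?thesis
        by blast
    qed
  qed (auto simp: S_def)
qed

text \<open>A zero row \<open>i\<close> together with a zero \<open>ab\<close> away from \<open>i\<close> gives two zeros in the row of \<open>a\<close>, so that \<open>a\<close> has a zero
  row too. Then every row has two zeros, and all labels are zero.\<close>

lemma localized_sphere:
  assumes n: "n \<ge> 4" and E: "coconsistent n E" and F: "coconsistent n F" and EF: "E < F"
    and loc: "localized_pair n E F"
  shows "graphs_between n E F = {} \<or>
    (\<exists>k. poset_space (graphs_between n E F) homotopy_equivalent_space nsphere k)"
proof -
  have sub: "E i j \<Longrightarrow> F i j" for i j
    using EF by (auto simp: less_rel_iff)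
  note row = localized_gap_row[OF loc F sub]
  have gap_sym: "gap E F i j \<Longrightarrow> gap E F j i" for i j
    using coc_sym[OF E] coc_sym[OF F] by (auto simp: gap_def)
  have r: "gap E F i j \<Longrightarrow> i \<noteq> j \<and> 1 \<le> i \<and> i \<le> n \<and> 1 \<le> j \<and> j \<le> n" for i j
    using coc_edge[OF F, of i j] by (auto simp: gap_def)
  consider (matching) "\<And>i j k. gap E F i j \<Longrightarrow> gap E F i k \<Longrightarrow> j = k"
    | (row) i j k where "gap E F i j" "gap E F i k" "j \<noteq> k"
    by blast
  then show ?thesis
  proof cases
    case matching
    then show ?thesis
      by (rule localized_matching_sphere[OF n E F EF loc])
  next
    case row
    then have i: "gap E F i x" if "1 \<le> x" "x \<le> n" "x \<noteq> i" for x
      using localized_gap_row[OF loc F sub] that by blast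
    show ?thesis
    proof (cases "\<exists>a b. gap E F a b \<and> a \<noteq> i \<and> b \<noteq> i")
      case False
      then show ?thesis
        using localized_star_sphere[OF n E F EF loc _ _ i] r[OF row(1)] by blast
    next
      case True
      then obtain a b where ab: "gap E F a b" "a \<noteq> i" "b \<noteq> i"
        by blast
      note rab = r[OF ab(1)]
      have "gap E F a i"
        using i[of a] ab rab gap_sym by blast
      then have a: "gap E F a x" if "1 \<le> x" "x \<le> n" "x \<noteq> a" for x
        using localized_gap_row[OF loc F sub _ ab(1), of i x] ab that by blast
      have all: "gap E F c x" if "1 \<le> c" "c \<le> n" "1 \<le> x" "x \<le> n" "x \<noteq> c" for c x
      proof (cases "c = i \<or> c = a")
        case True
        then show ?thesis
          using a i that by blast
      next
        case False
        then have "gap E F c i" "gap E F c a"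
          using i[of c] a[of c] that gap_sym by blast+
        then show ?thesis
          using localized_gap_row[OF loc F sub, of c i a x] ab(2) that by blast
      qed
      show ?thesis
      proof (rule whole_sphere[OF n])
        show "\<not> E c x" for c x
          using all[of c x] coc_edge[OF E, of c x] by (auto simp: gap_def)
        show "F c x \<longleftrightarrow> c \<noteq> x \<and> c \<in> {1..n} \<and> x \<in> {1..n}" for c x
          using all[of c x] coc_edge[OF F, of c x] by (auto simp: gap_def)
      qed
    qed
  qed
qed

section \<open>Contractibility in all other cases\<close>

text \<open>If the join of disjoint atoms is \<open>F\<close>, then the interval is facial.\<close>

lemma matching_localized:
  assumes E: "coconsistent n E" and M: "\<And>i j. M i j \<Longrightarrow> addable n E i j"
    and uniq: "\<And>i j k. M i j \<Longrightarrow> M i k \<Longrightarrow> j = k"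
  shows "localized_pair n E (\<lambda>i j. E i j \<or> M i j)"
  unfolding localized_pair_def
proof (intro allI impI)
  fix i c d e assume h: "1 \<le> i \<and> i \<le> n \<and> 1 \<le> c \<and> c < d \<and> d < e \<and> e \<le> n \<and> i \<noteq> c \<and> i \<noteq> d \<and> i \<noteq> e"
  let ?F = "\<lambda>i j. E i j \<or> M i j"
  have *: "(\<not> ?F i c \<or> E i d \<or> \<not> ?F i e) \<and> (E i c \<or> \<not> ?F i d \<or> E i e)"
  proof (cases "\<exists>j. M i j")
    case True
    then obtain j where "M i j"
      by blast
    then have j: "\<And>x. M i x \<longleftrightarrow> x = j" "addable n E i j"
      using uniq M by blast+
    have ce: "c < d" "d < e" "d \<noteq> i" "1 \<le> c" "e \<le> n" "c \<noteq> i" "e \<noteq> i"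
      using h by auto
    note r = addable_row[OF E j(2) ce(1,2)]
    have "E i d" if "E i c \<or> c = j" "E i e \<or> e = j"
      using r(1)[OF ce(3) that] coc_in[OF E _ _ ce(1-3)] that ce by auto
    moreover have "E i c \<or> E i e" if "E i d \<or> d = j"
      by (rule r(2)[OF ce(4-7) that])
    ultimately show ?thesis
      using j(1) by blast
  next
    case False
    then show ?thesis
      using coc_in[OF E, of i c e d] coc_out[OF E, of i d c e] h by auto
  qed
  then show "?F i c \<and> ?F i d \<and> ?F i e \<and> \<not> E i c \<and> \<not> E i d \<and> \<not> E i e \<or>
     (\<not> ?F i c \<or> E i d \<or> \<not> ?F i e) \<and> (E i c \<or> \<not> ?F i d \<or> E i e)"
    by blast
qed

definition atom :: "nat \<Rightarrow> (nat \<Rightarrow> nat \<Rightarrow> bool) \<Rightarrow> (nat \<Rightarrow> nat \<Rightarrow> bool) \<Rightarrow> nat \<Rightarrow> nat \<Rightarrow> bool" where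
  "atom n E F i j \<longleftrightarrow> F i j \<and> addable n E i j \<and> addable n E j i"

lemma atom_below:
  assumes E: "coconsistent n E" and X: "X \<in> graphs_between n E F"
  obtains a b where "X a b" "atom n E F a b"
proof -
  note X' = X[unfolded in_graphs_between]
  obtain a b where ab: "X a b" "\<not> E a b"
    using X' by blast
  have "growable n E X"
  proof (rule coconsistent_growable[OF E])
    show "coconsistent n X" "X a b" "\<not> E a b"
      using X' ab by blast+
    show "X i j" if "E i j" for i j
      using X' that by blast
  qed
  then obtain c d where "X c d" "addable n E c d" "addable n E d c"
    unfolding growable_def by blast
  moreover have "F c d"
    using X' \<open>X c d\<close> by blast
  ultimately show thesis
    using that[of c d] by (simp add: atom_def)
qed

text \<open>The join \<open>U\<close> of the atoms belongs to the open interval, because \<open>U = F\<close> would make the interval facial.\<close>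

lemma matching_contractible:
  assumes n: "n \<ge> 4" and E: "coconsistent n E" and F: "coconsistent n F" and EF: "E < F"
    and nloc: "\<not> localized_pair n E F"
    and uniq: "\<And>i j k. atom n E F i j \<Longrightarrow> atom n E F i k \<Longrightarrow> j = k"
  shows "graphs_between n E F \<noteq> {} \<and> contractible_space (poset_space (graphs_between n E F))"
proof -
  let ?P = "graphs_between n E F"
  let ?A = "atom n E F"
  have sub: "E i j \<Longrightarrow> F i j" for i j
    using EF by (auto simp: less_rel_iff)
  have A: "?A i j \<Longrightarrow> ?A j i \<and> addable n E i j \<and> F i j \<and> \<not> E i j" for i j
    using coc_sym[OF F] addable_ne(2)[of n E i j] by (simp add: atom_def)
  define U where "U = (\<lambda>i j. E i j \<or> ?A i j)"
  define f where "f = (\<lambda>X i j. E i j \<or> (?A i j \<and> X i j))"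
  have "localized_pair n E U"
    unfolding U_def using A uniq by (intro matching_localized[OF E]) blast+
  then have "U \<noteq> F"
    using nloc by blast
  have "U \<le> F"
    using sub A by (auto simp: U_def)
  then obtain c d where cd: "F c d" "\<not> U c d"
    using \<open>U \<noteq> F\<close> by (auto simp: fun_eq_iff le_fun_def)
  obtain x y where "F x y" "\<not> E x y"
    using EF by (auto simp: less_rel_iff)
  then have "growable n E F"
    using coconsistent_growable[OF E F sub] by blast
  then obtain a b where ab: "?A a b"
    by (auto simp: growable_def atom_def)
  have co: "coconsistent n (f X)" if "coconsistent n X" for X
    unfolding f_def using A uniq coc_sym[OF that] by (intro coconsistent_add_matching[OF E]) blast+
  have U: "U \<in> ?P"
  proof -
    have "coconsistent n U"
      unfolding U_def using A uniq by (intro coconsistent_add_matching[OF E]) blast+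
    then show ?thesis
      using ab A cd sub unfolding in_graphs_between U_def by blast
  qed
  have "contractible_space (poset_space ?P)"
  proof (rule contractible_poset_space[OF finite_graphs_between[OF n] U, where f = f])
    show "f ` ?P \<subseteq> ?P"
    proof
      fix Y assume "Y \<in> f ` ?P"
      then obtain X where X: "Y = f X" "X \<in> ?P"
        by blast
      obtain a b where "X a b" "?A a b"
        by (rule atom_below[OF E X(2)])
      then have "f X a b" "\<not> E a b"
        using A by (auto simp: f_def)
      then show "Y \<in> ?P"
        using X co[of X] sub A unfolding in_graphs_between f_def by blast
    qed
    show "mono_on ?P f"
      unfolding mono_on_def f_def le_fun_def le_bool_def by blast
    show "(\<forall>p\<in>?P. f p \<le> p \<and> f p \<le> U) \<or> (\<forall>p\<in>?P. p \<le> f p \<and> U \<le> f p)"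
    proof (intro disjI1 ballI)
      fix X assume "X \<in> ?P"
      then show "f X \<le> X \<and> f X \<le> U"
        unfolding in_graphs_between f_def U_def le_fun_def le_bool_def by blast
    qed
  qed
  then show ?thesis
    using U by blast
qed

text \<open>The graph \<open>K\<close> is the core of the pencil, and \<open>W\<close> is the join of the two atoms if \<open>K = E\<close>.\<close>

lemma pencil_contractible:
  assumes n: "n \<ge> 4" and E: "coconsistent n E" and F: "coconsistent n F" and EF: "E < F"
    and nloc: "\<not> localized_pair n E F"
    and p: "pencil_at n E i j k" and Fjk: "F i j" "F i k"
  shows "graphs_between n E F \<noteq> {} \<and> contractible_space (poset_space (graphs_between n E F))"
proof -
  let ?P = "graphs_between n E F"
  define K where "K = pencil_core n E i"
  define W where "W = (\<lambda>a b. K a b \<or> star n i a b)"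
  have sub: "E a b \<Longrightarrow> F a b" for a b
    using EF by (auto simp: less_rel_iff)
  have p': "addable n E i j" "addable n E j i" "addable n E i k" "addable n E k i" "j < k"
    using p by (auto simp: pencil_at_def)
  have i: "1 \<le> i" "i \<le> n" "i \<noteq> j" "i \<noteq> k"
    using addable_range[OF p'(1)] addable_ne[OF p'(1)] addable_ne[OF p'(3)] by auto
  have empty: "\<not> E i x" "\<not> E x i" for x
    using two_addable_in_row(1)[OF E p'(1,3,5)] coc_sym[OF E] by blast+
  have K_row: "\<not> K i x" "\<not> K x i" for x
    by (auto simp: K_def pencil_core_def same_side_def opposite_sides_def)
  have EK: "E a b \<Longrightarrow> K a b" for a b
    unfolding K_def by (rule pencil_core_le[OF n E p])
  have union: "coconsistent n (\<lambda>a b. X a b \<or> K a b)" if "coconsistent n X" "\<And>a b. E a b \<Longrightarrow> X a b" for X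
    unfolding K_def by (rule coconsistent_union_pencil_core[OF n E p that])
  have K: "coconsistent n K"
  proof -
    have "(\<lambda>a b. E a b \<or> K a b) = K"
      using EK by (intro ext) blast
    then show ?thesis
      using union[OF E] by simp
  qed
  have forced: "X a b" if "coconsistent n X" "\<And>a b. E a b \<Longrightarrow> X a b" "X i j" "X i k" "W a b" for X a b
    using that(5) pencil_core_forced[OF n E p that(1-4), of a b]
      pencil_row[OF E p that(1,3,4), of a] pencil_row[OF E p that(1,3,4), of b]
    by (auto simp: W_def K_def star_def)
  have WF: "W a b \<Longrightarrow> F a b" for a b
    using forced[OF F sub Fjk] .
  show ?thesis
  proof (cases "K = E")
    \<comment> \<open>The map \<open>X \<mapsto> X \<union> K\<close> stays below \<open>F\<close>: if \<open>X \<union> K = F\<close>, then \<open>X\<close> contains both atoms and hence \<open>K\<close>.\<close>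
    case False
    then obtain a b where ab: "K a b" "\<not> E a b"
      using EK by (auto simp: fun_eq_iff)
    have KP: "K \<in> ?P"
      using K EK ab WF Fjk K_row unfolding in_graphs_between W_def by blast
    have "contractible_space (poset_space ?P)"
    proof (rule contractible_poset_space[OF finite_graphs_between[OF n] KP, where f = "\<lambda>X a b. X a b \<or> K a b"])
      show "(\<lambda>X a b. X a b \<or> K a b) ` ?P \<subseteq> ?P"
      proof
        fix Y assume "Y \<in> (\<lambda>X a b. X a b \<or> K a b) ` ?P"
        then obtain X where X: "Y = (\<lambda>a b. X a b \<or> K a b)" "X \<in> ?P"
          by blast
        note X' = X(2)[unfolded in_graphs_between]
        have "\<exists>a b. F a b \<and> \<not> (X a b \<or> K a b)"
        proof (rule ccontr)
          assume "\<not> ?thesis"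
          then have all: "X a b \<or> K a b" if "F a b" for a b
            using that by blast
          then have jk: "X i j" "X i k"
            using Fjk K_row by blast+
          have "X a b" if "K a b" for a b
            using forced[of X] X' jk that unfolding W_def by blast
          then show False
            using all X' by blast
        qed
        moreover have "coconsistent n Y"
          using union[of X] X' X(1) by blast
        ultimately show "Y \<in> ?P"
          using X' WF unfolding X(1) in_graphs_between W_def by blast
      qed
      show "mono_on ?P (\<lambda>X a b. X a b \<or> K a b)"
        unfolding mono_on_def le_fun_def le_bool_def by blast
    qed (auto simp: le_fun_def)
    then show ?thesis
      using KP by blast
  next
    case True
    have add: "addable n E a i" if "1 \<le> a" "a \<le> n" "a \<noteq> i" for a
      using addable_pencil_core[OF n E p _ that] True unfolding K_def by metis
    have W_row: "W a x \<longleftrightarrow> E a x \<or> x = i" if "1 \<le> a" "a \<le> n" "a \<noteq> i" for a x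
      using that i True by (auto simp: W_def star_def)
    have W_i: "W i x \<longleftrightarrow> x \<noteq> i \<and> 1 \<le> x \<and> x \<le> n" for x
      using i K_row by (auto simp: W_def star_def)
    \<comment> \<open>The interval from \<open>E\<close> to \<open>W\<close> is facial, so \<open>W\<close> is not \<open>F\<close>.\<close>
    have locW: "localized_pair n E W"
      unfolding localized_pair_def
    proof (intro allI impI)
      fix a c d e assume h: "1 \<le> a \<and> a \<le> n \<and> 1 \<le> c \<and> c < d \<and> d < e \<and> e \<le> n \<and> a \<noteq> c \<and> a \<noteq> d \<and> a \<noteq> e"
      show "W a c \<and> W a d \<and> W a e \<and> \<not> E a c \<and> \<not> E a d \<and> \<not> E a e \<or>
        (\<not> W a c \<or> E a d \<or> \<not> W a e) \<and> (E a c \<or> \<not> W a d \<or> E a e)"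
      proof (cases "a = i")
        case True
        then show ?thesis
          using h empty by (auto simp: W_i)
      next
        case False
        then have ai: "addable n E a i" and W: "\<And>x. W a x \<longleftrightarrow> E a x \<or> x = i"
          using add W_row h by blast+
        have ce: "c < d" "d < e" "d \<noteq> a" "1 \<le> c" "e \<le> n" "c \<noteq> a" "e \<noteq> a"
          using h by auto
        note r = addable_row[OF E ai ce(1,2)]
        have "E a d" if "E a c \<or> c = i" "E a e \<or> e = i"
          using r(1)[OF ce(3) that] coc_in[OF E _ _ ce(1-3)] that ce by auto
        moreover have "E a c \<or> E a e" if "E a d \<or> d = i"
          by (rule r(2)[OF ce(4-7) that])
        ultimately show ?thesis
          unfolding W by blast
      qed
    qed
    then have "W \<noteq> F"
      using nloc by blast
    then obtain u v where uv: "F u v" "\<not> W u v"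
      using WF by (auto simp: fun_eq_iff)
    have coW: "coconsistent n W"
      unfolding coconsistent_def
    proof (intro conjI allI impI)
      fix a b assume ab: "W a b"
      show "W b a"
        using ab coc_sym[OF K] by (auto simp: W_def star_def)
      show "a \<noteq> b" "1 \<le> a" "a \<le> n"
        using ab coc_edge[OF K, of a b] by (auto simp: W_def star_def)
    next
      fix a c d e assume h: "c < d \<and> d < e \<and> d \<noteq> a \<and> W a c \<and> W a e"
      then have r: "1 \<le> a" "a \<le> n" "1 \<le> c" "e \<le> n"
        using coc_edge[OF K, of a c] coc_edge[OF K, of a e] by (auto simp: W_def star_def)
      show "W a d"
      proof (cases "a = i")
        case True
        then show ?thesis
          using h r by (simp add: W_i)
      next
        case False
        then show ?thesis
          using addable_row(1)[OF E add[OF r(1,2) False], of c d e] h W_row[OF r(1,2) False] by blast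
      qed
    next
      fix a c d e assume h: "1 \<le> c \<and> c < d \<and> d < e \<and> e \<le> n \<and> c \<noteq> a \<and> e \<noteq> a \<and> W a d"
      then have r: "1 \<le> a" "a \<le> n"
        using coc_edge[OF K, of a d] by (auto simp: W_def star_def)
      show "W a c \<or> W a e"
      proof (cases "a = i")
        case True
        then show ?thesis
          using h by (simp add: W_i)
      next
        case False
        then show ?thesis
          using addable_row(2)[OF E add[OF r(1,2) False], of c d e] h W_row[OF r(1,2) False] by blast
      qed
    qed
    have W_in: "W \<in> ?P"
    proof -
      have "W i j"
        using addable_range[OF p'(1)] i by (simp add: W_i)
      then show ?thesis
        using coW EK WF uv empty unfolding in_graphs_between W_def by blast
    qed
    \<comment> \<open>Every other atom would force \<open>E\<close> to be empty and \<open>F\<close> to be complete.\<close>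
    have atoms: "{a, b} = {i, j} \<or> {a, b} = {i, k}" if ab: "atom n E F a b" for a b
    proof (cases "a = i \<or> b = i")
      case True
      have *: "x = j \<or> x = k" if "addable n E i x" for x
        using addable_mid[OF that, of j k] empty two_addable_in_row(2)[OF E p'(1,3,5), of x]
          addable_range[OF that] addable_ne[OF that] addable_range[OF p'(1)] addable_range[OF p'(3)] i
        by (cases "x = j"; cases "x = k") auto
      then show ?thesis
        using True ab by (auto simp: atom_def insert_commute)
    next
      case False
      have all_gaps: "localized_pair n E F" if "addable n E a b" "addable n E b a" "a < b" "F a b" "a \<noteq> i" "b \<noteq> i" for a b
      proof -
        have "(\<forall>x y. \<not> E x y) \<and> (i = n \<and> a = 1 \<and> b = 2 \<or> i = 1 \<and> a = n - 1 \<and> b = n)"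
          using addable_at_pencil_core[OF n E p _ that(1,2,5,6,3)] True unfolding K_def by metis
        then have E0: "\<And>x y. \<not> E x y" and cases: "i = n \<and> a = 1 \<and> b = 2 \<or> i = 1 \<and> a = n - 1 \<and> b = n"
          by blast+
        have Fi: "F i x" "F x i" if "1 \<le> x" "x \<le> n" "x \<noteq> i" for x
          using WF[of i x] coc_sym[OF F] that by (auto simp: W_i)
        have row: "F 1 x \<and> F n x" if "1 < x" "x < n" for x
          using cases
        proof
          assume c: "i = n \<and> a = 1 \<and> b = 2"
          then have "F 1 n" "F 1 2"
            using Fi(2)[of 1] that \<open>F a b\<close> by auto
          then show ?thesis
            using coc_in[OF F, of 1 2 n x] Fi(1)[of x] c that by (cases "x = 2") auto
        next
          assume c: "i = 1 \<and> a = n - 1 \<and> b = n"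
          then have "F n 1" "F n (n - 1)"
            using Fi(2)[of n] that \<open>F a b\<close> coc_sym[OF F] by auto
          then show ?thesis
            using coc_in[OF F, of n 1 "n - 1" x] Fi(1)[of x] c that by (cases "x = n - 1") auto
        qed
        have all: "F x y" if "1 \<le> x" "x \<le> n" "1 \<le> y" "y \<le> n" "x \<noteq> y" for x y
        proof -
          have "F 1 n" "F n 1"
            using Fi[of 1] Fi[of n] cases n by auto
          moreover have "F 1 y" "F n y" if "1 < y" "y < n"
            using row[OF that] by blast+
          moreover have "F x y" if x: "1 < x" "x < n"
          proof -
            have "F x 1" "F x n"
              using row[OF x] coc_sym[OF F] by blast+
            moreover have "F x y" if "1 < y" "y < n"
              by (rule coc_in[OF F \<open>F x 1\<close> \<open>F x n\<close> that]) (use \<open>x \<noteq> y\<close> in simp)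
            moreover have "y = 1 \<or> y = n \<or> 1 < y \<and> y < n"
              using \<open>1 \<le> y\<close> \<open>y \<le> n\<close> by linarith
            ultimately show ?thesis
              by metis
          qed
          moreover have "x = 1 \<or> x = n \<or> 1 < x \<and> x < n" "y = 1 \<or> y = n \<or> 1 < y \<and> y < n"
            using that by linarith+
          ultimately show ?thesis
            using \<open>x \<noteq> y\<close> by metis
        qed
        show ?thesis
          unfolding localized_pair_def using E0 all by auto
      qed
      then show ?thesis
      proof -
        have ab': "addable n E a b" "addable n E b a" "F a b" "F b a" "a \<noteq> b" "a \<noteq> i" "b \<noteq> i"
          using ab False coc_sym[OF F] addable_ne(1)[of n E a b] by (simp_all add: atom_def)
        then have "localized_pair n E F"
          using all_gaps[of a b] all_gaps[of b a] by (cases "a < b") simp_all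
        then show ?thesis
          using nloc by blast
      qed
    qed
    \<comment> \<open>The join of the atoms below \<open>X\<close>.\<close>
    define f where "f = (\<lambda>X a b. E a b \<or> X i j \<and> X i k \<and> W a b \<or> X i j \<and> {a, b} = {i, j} \<or> X i k \<and> {a, b} = {i, k})"
    have Wjk: "W i j" "W i k" "W j i" "W k i"
      using addable_range[OF p'(1)] addable_range[OF p'(3)] i coc_sym[OF coW] by (auto simp: W_i)
    have EW: "E a b \<Longrightarrow> W a b" for a b
      using EK by (simp add: W_def)
    have f_le_W: "f X a b \<Longrightarrow> W a b" for X a b
      using Wjk EW by (auto simp: f_def doubleton_eq_iff)
    have "contractible_space (poset_space ?P)"
    proof (rule contractible_poset_space[OF finite_graphs_between[OF n] W_in, where f = f])
      have f_le: "X a b" if "X \<in> ?P" "f X a b" for X a b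
      proof -
        note f_le_prem = that(2)
        have X: "coconsistent n X" "\<And>a b. E a b \<Longrightarrow> X a b"
          using that(1) unfolding in_graphs_between by blast+
        have sym: "X x y \<Longrightarrow> X y x" for x y
          by (rule coc_sym[OF X(1)])
        consider "E a b" | "X i j" "X i k" "W a b" | "X i j" "{a, b} = {i, j}" | "X i k" "{a, b} = {i, k}"
          using f_le_prem unfolding f_def by blast
        then show ?thesis
        proof cases
          case 2
          then show ?thesis
            using forced[OF X] by blast
        qed (use X sym in \<open>auto simp: doubleton_eq_iff\<close>)
      qed
      show "f ` ?P \<subseteq> ?P"
      proof
        fix Y assume "Y \<in> f ` ?P"
        then obtain X where X: "Y = f X" "X \<in> ?P"
          by blast
        note X' = X(2)[unfolded in_graphs_between]
        have symX: "X a b \<Longrightarrow> X b a" for a b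
          using X' coc_sym by blast
        obtain a b where ab: "X a b" "atom n E F a b"
          by (rule atom_below[OF E X(2)])
        then have jk: "X i j \<or> X i k"
          using atoms[OF ab(2)] symX by (auto simp: doubleton_eq_iff)
        have "coconsistent n (f X)"
        proof (cases "X i j \<and> X i k")
          case True
          then have "f X = W"
          proof (intro ext iffI)
            show "f X a b \<Longrightarrow> W a b" for a b
              by (rule f_le_W)
            show "W a b \<Longrightarrow> f X a b" for a b
              using True by (simp add: f_def)
          qed
          then show ?thesis
            using coW by simp
        next
          case False
          then have "f X = add_edge i j E \<or> f X = add_edge i k E"
            using jk by (cases "X i j") (simp_all add: f_def add_edge_def fun_eq_iff)
          then show ?thesis
            using coconsistent_add_edge[OF E] p' by auto
        qed
        moreover have "\<exists>a b. f X a b \<and> \<not> E a b"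
          using jk empty unfolding f_def by blast
        moreover have "f X a b" if "E a b" for a b
          using that by (simp add: f_def)
        moreover have "F a b" if "f X a b" for a b
          using f_le[OF X(2) that] X' by blast
        moreover have "\<exists>a b. F a b \<and> \<not> f X a b"
          using f_le[OF X(2)] X' by blast
        ultimately show "Y \<in> ?P"
          unfolding X(1) in_graphs_between by blast
      qed
      show "mono_on ?P f"
        unfolding mono_on_def f_def le_fun_def le_bool_def by blast
      show "(\<forall>X\<in>?P. f X \<le> X \<and> f X \<le> W) \<or> (\<forall>X\<in>?P. X \<le> f X \<and> W \<le> f X)"
        unfolding le_fun_def le_bool_def using f_le f_le_W by blast
    qed
    then show ?thesis
      using W_in by blast
  qed
qed

lemma not_localized_contractible:
  assumes n: "n \<ge> 4" and E: "coconsistent n E" and F: "coconsistent n F" and EF: "E < F"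
    and nloc: "\<not> localized_pair n E F"
  shows "graphs_between n E F \<noteq> {} \<and> contractible_space (poset_space (graphs_between n E F))"
proof (cases "\<forall>i j k. atom n E F i j \<longrightarrow> atom n E F i k \<longrightarrow> j = k")
  case True
  then show ?thesis
    using matching_contractible[OF n E F EF nloc] by blast
next
  case False
  then obtain i j k where "atom n E F i j" "atom n E F i k" "j < k"
    by (metis linorder_neqE_nat)
  then show ?thesis
    using pencil_contractible[OF n E F EF nloc, of i j k] by (auto simp: atom_def pencil_at_def)
qed

section \<open>Spherical and facial intervals\<close>

theorem theorem3p10:
  fixes n :: nat and t :: "nat \<Rightarrow> real" and I J :: "nat set set"
  assumes "n \<ge> 4"
    and "strict_mono_on {1..n} t"
    and "I \<in> higher_bruhat n (n - 3)"
    and "J \<in> higher_bruhat n (n - 3)"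
    and "bruhat_less n (n - 3) I J"
  shows "(spherical_interval n (n - 3) I J \<longleftrightarrow> facial_interval n t I J) \<and>
         (\<not> facial_interval n t I J \<longrightarrow> contractible_interval n (n - 3) I J)"
proof -
  let ?E = "graph_of n I" and ?F = "graph_of n J"
  let ?X = "interval_space n (n - 3) I J" and ?Y = "poset_space (graphs_between n ?E ?F)"
  have IJ: "I \<subset> J"
    using assms(5) bruhat_le_imp_subset unfolding bruhat_less_def by blast
  have E: "coconsistent n ?E" and F: "coconsistent n ?F"
    using assms(1,3,4) higher_bruhat_iff by blast+
  have EF: "?E < ?F"
    using graph_of_less_iff[OF assms(1,3,4)] IJ by blast
  have facial: "facial_interval n t I J \<longleftrightarrow> localized_pair n ?E ?F"
    by (rule facial_interval_iff[OF assms(1-4) IJ])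
  have equiv: "?X homotopy_equivalent_space ?Y"
    by (rule interval_space_homotopy_equivalent[OF assms(1,3,4)])
  then obtain f g where fg: "continuous_map ?X ?Y f" "continuous_map ?Y ?X g"
    by (auto simp: homotopy_equivalent_space_def)
  have empty: "topspace ?X = {} \<longleftrightarrow> topspace ?Y = {}"
    using continuous_map_image_subset_topspace[OF fg(1)] continuous_map_image_subset_topspace[OF fg(2)] by auto
  have spherical: "spherical_interval n (n - 3) I J" if "facial_interval n t I J"
  proof -
    consider "graphs_between n ?E ?F = {}" | k where "?Y homotopy_equivalent_space nsphere k"
      using localized_sphere[OF assms(1) E F EF] facial \<open>facial_interval n t I J\<close> by blast
    then show ?thesis
    proof cases
      case 1
      then have "x \<notin> topspace ?Y" for x
        by (simp add: in_poset_space)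
      then have "topspace ?Y = {}"
        by blast
      then show ?thesis
        using empty by (simp add: spherical_interval_def)
    next
      case 2
      then show ?thesis
        using homotopy_eqv_trans[OF equiv] by (auto simp: spherical_interval_def)
    qed
  qed
  have contractible: "contractible_interval n (n - 3) I J \<and> \<not> spherical_interval n (n - 3) I J"
    if "\<not> facial_interval n t I J"
  proof -
    have *: "graphs_between n ?E ?F \<noteq> {}" "contractible_space ?Y"
      using not_localized_contractible[OF assms(1) E F EF] facial that by blast+
    then have "topspace ?X \<noteq> {}"
      using empty poset_space_nonempty[OF finite_graphs_between[OF assms(1)]] by blast
    moreover have "contractible_space ?X"
      using *(2) homotopy_equivalent_space_contractibility[OF equiv] by blast
    moreover have "\<not> ?X homotopy_equivalent_space nsphere k" for k
      using \<open>contractible_space ?X\<close> homotopy_equivalent_space_contractibility[of ?X "nsphere k"]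
        non_contractible_space_nsphere by blast
    ultimately show ?thesis
      by (simp add: contractible_interval_def spherical_interval_def)
  qed
  show ?thesis
    using spherical contractible by blast
qed

end
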